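(* For any finite simplicial set $X$, its model $\mathfrak{L}_X$ is a cofibrant object of the model category $\mathbf{cDGL}$, i.e. the morphism $0\to\mathfrak{L}_X$ has the left lifting property with respect to all trivial fibrations.
   Context: All algebraic objects are $\mathbb{Z}$-graded and over $\mathbb{Q}$. A dgl is a graded Lie algebra $L$ with a linear derivation $d$ of degree $-1$, $d^2=0$. A descending filtration of a dgl is $L=F_1L\supset F_2L\supset\cdots$ with $dF_kL\subset F_kL$ and $[F_kL,F_pL]\subset F_{k+p}L$. A complete dgl (cdgl) is a dgl with the topology given by such a filtration with $L=\varprojlim_k L/F_kL$; $\mathbf{cDGL}$ is the category of cdgl's and continuous dgl morphisms. Colimits in $\mathbf{cDGL}$ are completions of the colimits of dgl's. $\widehat{\mathbb{L}}(V)=\varprojlim_n\mathbb{L}(V)/\mathbb{L}(V)^n$ is the complete free Lie algebra ($L^1=L$, $L^n=[L,L^{n-1}]$). $\mathrm{MC}(L)$ is the set of Maurer-Cartan (MC) elements: $a\in L_{-1}$ with $da+\frac12[a,a]=0$. For $a\in\mathrm{MC}(L)$, $d_a=d+\mathrm{ad}_a$ and the component of $L$ at $a$ is $L^a=L_{>0}\oplus(L_0\cap\ker d_a)$ with differential $d_a$. The group $L_0$ (Baker-Campbell-Hausdorff product) acts on $\mathrm{MC}(L)$ by $x\,\mathcal{G}\,a=e^{\mathrm{ad}_x}(a)-\frac{e^{\mathrm{ad}_x}-1}{\mathrm{ad}_x}(dx)$, and $\widetilde{\mathrm{MC}}(L)$ is the set of orbits. Model structure on $\mathbf{cDGL}$: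 fibrations are the morphisms surjective in non-negative degrees; weak equivalences are the morphisms $f\colon A\to B$ such that $\widetilde{\mathrm{MC}}(f)$ is a bijection and $f\colon A^a\to B^{f(a)}$ is a quasi-isomorphism for every class $a\in\widetilde{\mathrm{MC}}(A)$; trivial fibrations are fibrations that are weak equivalences; cofibrations are the morphisms with the left lifting property with respect to trivial fibrations. The cosimplicial cdgl $\mathfrak{L}_{\Delta^\bullet}$ (constructed in earlier work of the authors, unique up to isomorphism): $\mathfrak{L}_{\Delta^n}=(\widehat{\mathbb{L}}(s^{-1}C_*(\Delta^n)),d)$, where $C_*(\Delta^n)$ is the rational simplicial chain complex of the standard $n$-simplex and $a_{i_0\dots i_k}$, of degree $k-1$, is the generator associated to the face $\langle i_0,\dots,i_k\rangle$, such that: each vertex generator $a_i$ is an MC element; the linear part of $d$ is the desuspension of the differential of $C_*(\Delta^n)$; the cofaces are the inclusions of faces on generators, and the codegeneracies $\sigma_j$ send $a_{i_0\dots i_k}$ to $a_{r_0\dots r_k}$ with $r_s=i_s$ if $i_s\le j$ and $r_s=i_s-1$ if $i_s>j$, with $a_{r_0\dots r_k}=0$ if two indices coincide. In particular $\mathfrak{L}_{\Delta^0}=\mathbb{L}(a)$ with $a$ an MC element, and $\mathfrak{L}_{\Delta^1}=(\widehat{\mathbb{L}}(a,b,x),d)$ with $a,b$ MC elements, $|x|=0$, $dx=\mathrm{ad}_xb+\sum_{n\ge0}\frac{B_n}{n!}\mathrm{ad}_x^n(b-a)$, $B_n$ the Bernoulli numbers. For $n\ge2$, $\mathfrak{L}_{\Delta^n}$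 is constructed inductively so that $d_{a_0}a_{0\dots n}\in\mathfrak{L}_{\partial\Delta^n}$, the sub-cdgl generated by the proper faces. For a simplicial set $X$, $\mathfrak{L}_X=\varinjlim_{\sigma\in X}\mathfrak{L}_{\Delta^{|\sigma|}}$ (colimit in $\mathbf{cDGL}$ over the simplices of $X$). A simplicial set is finite if it has finitely many non-degenerate simplices. *)

theory Defs
  imports
    "HOL-Algebra.Module"
    "HOL-Algebra.AbelCoset"
    "HOL-Library.Poly_Mapping"
    "HOL-Computational_Algebra.Formal_Power_Series"
begin

section \<open>Graded Lie algebras, dgl's and complete dgl's over the rationals\<close>

definition QQ :: "rat ring"
  where "QQ = \<lparr>carrier = UNIV, monoid.mult = (*), one = 1, ring.zero = 0, add = (+)\<rparr>"

text \<open>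
  A graded object is a family of vector spaces indexed by the integers. All operations and maps are
  therefore indexed by the degrees of their arguments; the carriers of different degrees are
  independent of each other (they may overlap). Of the records \<^typ>\<open>(rat, 'a) module\<close> only the
  additive group and the scalar multiplication are used.
\<close>

record 'a gla =
  sp :: "int \<Rightarrow> (rat, 'a) module"
  brk :: "int \<Rightarrow> int \<Rightarrow> 'a \<Rightarrow> 'a \<Rightarrow> 'a"

record 'a dgl = "'a gla" +
  dif :: "int \<Rightarrow> 'a \<Rightarrow> 'a"

text \<open>
  The component \<open>fil L k n\<close> is the degree \<open>n\<close> part of \<open>F\<^sub>k L\<close>. Filtrations start with
  \<open>F\<^sub>1 L = L\<close>, so the value at \<open>k = 0\<close> is irrelevant.
\<close>

record 'a cdgl = "'a dgl" +
  fil :: "nat \<Rightarrow> int \<Rightarrow> 'a set"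

abbreviation elts :: "('a, 'm) gla_scheme \<Rightarrow> int \<Rightarrow> 'a set"
  where "elts L n \<equiv> carrier (sp L n)"

definition Q_linear :: "(rat, 'a) module \<Rightarrow> (rat, 'b) module \<Rightarrow> ('a \<Rightarrow> 'b) \<Rightarrow> bool"
  where "Q_linear M N f \<longleftrightarrow>
    f \<in> carrier M \<rightarrow> carrier N \<and>
    (\<forall>x\<in>carrier M. \<forall>y\<in>carrier M. f (x \<oplus>\<^bsub>M\<^esub> y) = f x \<oplus>\<^bsub>N\<^esub> f y) \<and>
    (\<forall>q. \<forall>x\<in>carrier M. f (q \<odot>\<^bsub>M\<^esub> x) = q \<odot>\<^bsub>N\<^esub> f x)"

locale graded_lie_algebra =
  fixes L :: "('a, 'm) gla_scheme"
  assumes sp_module: "Module.module QQ (sp L n)"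
    and brk_linear_left: "y \<in> elts L m \<Longrightarrow> Q_linear (sp L n) (sp L (n + m)) (\<lambda>x. brk L n m x y)"
    and brk_linear_right: "x \<in> elts L n \<Longrightarrow> Q_linear (sp L m) (sp L (n + m)) (brk L n m x)"
    and antisymmetry: "\<lbrakk>x \<in> elts L n; y \<in> elts L m\<rbrakk> \<Longrightarrow>
      brk L n m x y = (- ((-1) powi (n * m))) \<odot>\<^bsub>sp L (n + m)\<^esub> brk L m n y x"
    and jacobi: "\<lbrakk>x \<in> elts L n; y \<in> elts L m; z \<in> elts L p\<rbrakk> \<Longrightarrow>
      brk L n (m + p) x (brk L m p y z) =
        brk L (n + m) p (brk L n m x y) z \<oplus>\<^bsub>sp L (n + m + p)\<^esub>
        ((-1) powi (n * m)) \<odot>\<^bsub>sp L (n + m + p)\<^esub> brk L m (n + p) y (brk L n p x z)"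

locale dg_lie_algebra = graded_lie_algebra L for L :: "('a, 'm) dgl_scheme" +
  assumes dif_linear: "Q_linear (sp L n) (sp L (n - 1)) (dif L n)"
    and dif_dif: "x \<in> elts L n \<Longrightarrow> dif L (n - 1) (dif L n x) = \<zero>\<^bsub>sp L (n - 2)\<^esub>"
    and dif_derivation: "\<lbrakk>x \<in> elts L n; y \<in> elts L m\<rbrakk> \<Longrightarrow>
      dif L (n + m) (brk L n m x y) =
        brk L (n - 1) m (dif L n x) y \<oplus>\<^bsub>sp L (n + m - 1)\<^esub>
        ((-1) powi n) \<odot>\<^bsub>sp L (n + m - 1)\<^esub> brk L n (m - 1) x (dif L m y)"

definition quot_mod :: "(rat, 'a) module \<Rightarrow> 'a set \<Rightarrow> (rat, 'a set) module"
  where "quot_mod M H = \<lparr>carrier = a_rcosets\<^bsub>M\<^esub> H, monoid.mult = undefined, one = undefined,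
    ring.zero = H, add = set_add M,
    smult = (\<lambda>q X. \<Union>x\<in>X. H +>\<^bsub>M\<^esub> (q \<odot>\<^bsub>M\<^esub> x))\<rparr>"

text \<open>
  The inverse limit of the quotients of \<open>M\<close> by a descending sequence \<open>F 1, F 2, \<dots>\<close> of subspaces.
  Its elements are the coherent sequences of cosets; because the index starts at 0,
  the \<open>k\<close>-th entry is a coset of \<open>F (k + 1)\<close>.
\<close>

definition inv_limit :: "(rat, 'a) module \<Rightarrow> (nat \<Rightarrow> 'a set) \<Rightarrow> (rat, nat \<Rightarrow> 'a set) module"
  where "inv_limit M F =
    \<lparr>carrier = {\<xi>. \<forall>k. \<xi> k \<in> carrier (quot_mod M (F (Suc k))) \<and> \<xi> (Suc k) \<subseteq> \<xi> k},
     monoid.mult = undefined, one = undefined,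
     ring.zero = (\<lambda>k. \<zero>\<^bsub>quot_mod M (F (Suc k))\<^esub>),
     add = (\<lambda>\<xi> \<eta> k. \<xi> k \<oplus>\<^bsub>quot_mod M (F (Suc k))\<^esub> \<eta> k),
     smult = (\<lambda>q \<xi> k. q \<odot>\<^bsub>quot_mod M (F (Suc k))\<^esub> \<xi> k)\<rparr>"

text \<open>
  The chosen filtration represents the topology: continuity of morphisms (below) is the only
  condition relating the filtrations of source and target.
\<close>

locale complete_dg_lie_algebra = dg_lie_algebra L for L :: "('a, 'm) cdgl_scheme" +
  assumes fil_one: "fil L 1 n = elts L n"
    and fil_submodule: "k \<ge> 1 \<Longrightarrow> submodule (fil L k n) QQ (sp L n)"
    and fil_descending: "k \<ge> 1 \<Longrightarrow> fil L (Suc k) n \<subseteq> fil L k n"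
    and fil_dif: "\<lbrakk>k \<ge> 1; x \<in> fil L k n\<rbrakk> \<Longrightarrow> dif L n x \<in> fil L k (n - 1)"
    and fil_brk: "\<lbrakk>k \<ge> 1; p \<ge> 1; x \<in> fil L k n; y \<in> fil L p m\<rbrakk> \<Longrightarrow>
      brk L n m x y \<in> fil L (k + p) (n + m)"
    and complete: "bij_betw (\<lambda>x k. fil L (Suc k) n +>\<^bsub>sp L n\<^esub> x)
      (elts L n) (carrier (inv_limit (sp L n) (\<lambda>k. fil L k n)))"

definition cdgl_morphism ::
    "('a, 'm) cdgl_scheme \<Rightarrow> ('b, 'k) cdgl_scheme \<Rightarrow> (int \<Rightarrow> 'a \<Rightarrow> 'b) \<Rightarrow> bool"
  where "cdgl_morphism A B f \<longleftrightarrow>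
    (\<forall>n. Q_linear (sp A n) (sp B n) (f n)) \<and>
    (\<forall>n m. \<forall>x\<in>elts A n. \<forall>y\<in>elts A m. f (n + m) (brk A n m x y) = brk B n m (f n x) (f m y)) \<and>
    (\<forall>n. \<forall>x\<in>elts A n. f (n - 1) (dif A n x) = dif B n (f n x)) \<and>
    (\<forall>k\<ge>1. \<exists>m\<ge>1. \<forall>n. f n ` fil A m n \<subseteq> fil B k n)"

text \<open>Equality of morphisms out of \<open>A\<close>: values outside the carriers are irrelevant.\<close>

definition eq_morphism :: "('a, 'm) gla_scheme \<Rightarrow> (int \<Rightarrow> 'a \<Rightarrow> 'b) \<Rightarrow> (int \<Rightarrow> 'a \<Rightarrow> 'b) \<Rightarrow> bool"
  where "eq_morphism A f g \<longleftrightarrow> (\<forall>n. \<forall>x\<in>elts A n. f n x = g n x)"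

definition comp_morphism :: "(int \<Rightarrow> 'b \<Rightarrow> 'c) \<Rightarrow> (int \<Rightarrow> 'a \<Rightarrow> 'b) \<Rightarrow> int \<Rightarrow> 'a \<Rightarrow> 'c"
  where "comp_morphism g f = (\<lambda>n. g n \<circ> f n)"


section \<open>Maurer-Cartan elements, gauge action and components\<close>

definition has_series :: "('a, 'm) cdgl_scheme \<Rightarrow> int \<Rightarrow> (nat \<Rightarrow> 'a) \<Rightarrow> 'a \<Rightarrow> bool"
  where "has_series L n s l \<longleftrightarrow> l \<in> elts L n \<and>
    (\<forall>k\<ge>1. \<exists>N. \<forall>m\<ge>N. finsum (sp L n) s {..<m} \<ominus>\<^bsub>sp L n\<^esub> l \<in> fil L k n)"

definition series :: "('a, 'm) cdgl_scheme \<Rightarrow> int \<Rightarrow> (nat \<Rightarrow> 'a) \<Rightarrow> 'a"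
  where "series L n s = (THE l. has_series L n s l)"

definition MC :: "('a, 'm) dgl_scheme \<Rightarrow> 'a set"
  where "MC L = {a \<in> elts L (-1).
    dif L (-1) a \<oplus>\<^bsub>sp L (-2)\<^esub> (1/2) \<odot>\<^bsub>sp L (-2)\<^esub> brk L (-1) (-1) a a = \<zero>\<^bsub>sp L (-2)\<^esub>}"

definition gauge :: "('a, 'm) cdgl_scheme \<Rightarrow> 'a \<Rightarrow> 'a \<Rightarrow> 'a"
  where "gauge L x a =
    series L (-1) (\<lambda>i. (1 / fact i) \<odot>\<^bsub>sp L (-1)\<^esub> (brk L 0 (-1) x ^^ i) a) \<ominus>\<^bsub>sp L (-1)\<^esub>
    series L (-1) (\<lambda>i. (1 / fact (Suc i)) \<odot>\<^bsub>sp L (-1)\<^esub> (brk L 0 (-1) x ^^ i) (dif L 0 x))"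

definition gauge_orbit :: "('a, 'm) cdgl_scheme \<Rightarrow> 'a \<Rightarrow> 'a set"
  where "gauge_orbit L a = (\<lambda>x. gauge L x a) ` elts L 0"

definition MC_orbits :: "('a, 'm) cdgl_scheme \<Rightarrow> 'a set set"
  where "MC_orbits L = gauge_orbit L ` MC L"

text \<open>The map of orbit sets induced by \<open>f\<close>; it sends the orbit of \<open>a\<close> to the orbit of \<open>f a\<close>.\<close>

definition MC_orbits_map :: "('b, 'k) cdgl_scheme \<Rightarrow> (int \<Rightarrow> 'a \<Rightarrow> 'b) \<Rightarrow> 'a set \<Rightarrow> 'b set"
  where "MC_orbits_map B f \<Omega> = (\<Union>a\<in>\<Omega>. gauge_orbit B (f (-1) a))"

definition twisted_dif :: "('a, 'm) dgl_scheme \<Rightarrow> 'a \<Rightarrow> int \<Rightarrow> 'a \<Rightarrow> 'a"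
  where "twisted_dif L a n x = dif L n x \<oplus>\<^bsub>sp L (n - 1)\<^esub> brk L (-1) n a x"

definition component :: "('a, 'm) dgl_scheme \<Rightarrow> 'a \<Rightarrow> 'a dgl"
  where "component L a =
    \<lparr>sp = (\<lambda>n. if n < 0 then (sp L n)\<lparr>carrier := {\<zero>\<^bsub>sp L n\<^esub>}\<rparr>
             else if n = 0 then
               (sp L 0)\<lparr>carrier := {x \<in> elts L 0. twisted_dif L a 0 x = \<zero>\<^bsub>sp L (-1)\<^esub>}\<rparr>
             else sp L n),
     brk = brk L,
     dif = twisted_dif L a\<rparr>"

definition cycles :: "('a, 'm) dgl_scheme \<Rightarrow> int \<Rightarrow> 'a set"
  where "cycles L n = {x \<in> elts L n. dif L n x = \<zero>\<^bsub>sp L (n - 1)\<^esub>}"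

definition boundaries :: "('a, 'm) dgl_scheme \<Rightarrow> int \<Rightarrow> 'a set"
  where "boundaries L n = dif L (n + 1) ` elts L (n + 1)"

definition homology :: "('a, 'm) dgl_scheme \<Rightarrow> int \<Rightarrow> (rat, 'a set) module"
  where "homology L n = quot_mod ((sp L n)\<lparr>carrier := cycles L n\<rparr>) (boundaries L n)"

definition homology_map ::
    "('b, 'k) dgl_scheme \<Rightarrow> (int \<Rightarrow> 'a \<Rightarrow> 'b) \<Rightarrow> int \<Rightarrow> 'a set \<Rightarrow> 'b set"
  where "homology_map B f n X = (\<Union>x\<in>X. boundaries B n +>\<^bsub>sp B n\<^esub> f n x)"

definition quasi_iso ::
    "('a, 'm) dgl_scheme \<Rightarrow> ('b, 'k) dgl_scheme \<Rightarrow> (int \<Rightarrow> 'a \<Rightarrow> 'b) \<Rightarrow> bool"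
  where "quasi_iso A B f \<longleftrightarrow>
    (\<forall>n. bij_betw (homology_map B f n) (carrier (homology A n)) (carrier (homology B n)))"


section \<open>The model structure\<close>

definition fibration ::
    "('a, 'm) cdgl_scheme \<Rightarrow> ('b, 'k) cdgl_scheme \<Rightarrow> (int \<Rightarrow> 'a \<Rightarrow> 'b) \<Rightarrow> bool"
  where "fibration A B f \<longleftrightarrow> cdgl_morphism A B f \<and> (\<forall>n\<ge>0. f n ` elts A n = elts B n)"

definition weak_equivalence ::
    "('a, 'm) cdgl_scheme \<Rightarrow> ('b, 'k) cdgl_scheme \<Rightarrow> (int \<Rightarrow> 'a \<Rightarrow> 'b) \<Rightarrow> bool"
  where "weak_equivalence A B f \<longleftrightarrow> cdgl_morphism A B f \<and>
    bij_betw (MC_orbits_map B f) (MC_orbits A) (MC_orbits B) \<and>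
    (\<forall>a\<in>MC A. quasi_iso (component A a) (component B (f (-1) a)) f)"

definition left_lifting ::
    "('k, 'w) cdgl_scheme \<Rightarrow> ('l, 'x) cdgl_scheme \<Rightarrow> (int \<Rightarrow> 'k \<Rightarrow> 'l) \<Rightarrow>
     ('a, 'y) cdgl_scheme \<Rightarrow> ('b, 'z) cdgl_scheme \<Rightarrow> (int \<Rightarrow> 'a \<Rightarrow> 'b) \<Rightarrow> bool"
  where "left_lifting K L i A B p \<longleftrightarrow>
    (\<forall>u v. cdgl_morphism K A u \<and> cdgl_morphism L B v \<and>
           eq_morphism K (comp_morphism p u) (comp_morphism v i) \<longrightarrow>
       (\<exists>h. cdgl_morphism L A h \<and> eq_morphism K (comp_morphism h i) u \<and>
            eq_morphism L (comp_morphism p h) v))"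

text \<open>
  From here on the objects of \<open>cDGL\<close> are the cdgl's whose elements are taken from a type \<open>'u\<close>,
  which serves as a universe; \<open>'u\<close> is arbitrary, so any statement made for it holds in every
  universe. It appears as the type of the quantified test objects in the notions of cofibration and
  colimit. Any set of cdgl's can be transported into one common universe.
\<close>

definition cofibration :: "'u cdgl \<Rightarrow> 'u cdgl \<Rightarrow> (int \<Rightarrow> 'u \<Rightarrow> 'u) \<Rightarrow> bool"
  where "cofibration K L i \<longleftrightarrow> cdgl_morphism K L i \<and>
    (\<forall>(A :: 'u cdgl) (B :: 'u cdgl) p.
       complete_dg_lie_algebra A \<and> complete_dg_lie_algebra B \<and>
       fibration A B p \<and> weak_equivalence A B p \<longrightarrow> left_lifting K L i A B p)"

definition zero_cdgl :: "'u cdgl"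
  where "zero_cdgl =
    \<lparr>sp = (\<lambda>n. \<lparr>carrier = {undefined}, monoid.mult = (\<lambda>_ _. undefined), one = undefined,
                ring.zero = undefined, add = (\<lambda>_ _. undefined), smult = (\<lambda>_ _. undefined)\<rparr>),
     brk = (\<lambda>_ _ _ _. undefined), dif = (\<lambda>_ _. undefined), fil = (\<lambda>_ _. {undefined})\<rparr>"

definition cofibrant :: "'u cdgl \<Rightarrow> bool"
  where "cofibrant L \<longleftrightarrow> cofibration zero_cdgl L (\<lambda>n _. \<zero>\<^bsub>sp L n\<^esub>)"


section \<open>Complete free Lie algebras\<close>

text \<open>
  The free Lie algebra on a set \<open>G\<close> of generators with degrees \<open>deg\<close> is the free nonassociative
  algebra on \<open>G\<close> (finite linear combinations of bracketed words) modulo the homogeneous ideal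
  generated by graded antisymmetry and the graded Jacobi identity.
\<close>

datatype 'g word = Gen 'g | Br "'g word" "'g word"

primrec wdeg :: "('g \<Rightarrow> int) \<Rightarrow> 'g word \<Rightarrow> int"
  where
    "wdeg deg (Gen g) = deg g"
  | "wdeg deg (Br u v) = wdeg deg u + wdeg deg v"

definition wprod :: "('g word \<Rightarrow>\<^sub>0 rat) \<Rightarrow> ('g word \<Rightarrow>\<^sub>0 rat) \<Rightarrow> ('g word \<Rightarrow>\<^sub>0 rat)"
  where "wprod p r = (\<Sum>u\<in>Poly_Mapping.keys p. \<Sum>v\<in>Poly_Mapping.keys r.
    Poly_Mapping.single (Br u v) (Poly_Mapping.lookup p u * Poly_Mapping.lookup r v))"

definition nonassoc_mod :: "'g set \<Rightarrow> ('g \<Rightarrow> int) \<Rightarrow> int \<Rightarrow> (rat, 'g word \<Rightarrow>\<^sub>0 rat) module"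
  where "nonassoc_mod G deg n =
    \<lparr>carrier = {p. \<forall>u\<in>Poly_Mapping.keys p. set_word u \<subseteq> G \<and> wdeg deg u = n},
     monoid.mult = undefined, one = undefined, ring.zero = 0, add = (+),
     smult = (\<lambda>q. Poly_Mapping.map ((*) q))\<rparr>"

text \<open>Here the record \<^typ>\<open>'a gla\<close> merely holds a graded nonassociative algebra.\<close>

definition free_nonassoc :: "'g set \<Rightarrow> ('g \<Rightarrow> int) \<Rightarrow> ('g word \<Rightarrow>\<^sub>0 rat) gla"
  where "free_nonassoc G deg = \<lparr>sp = nonassoc_mod G deg, brk = (\<lambda>_ _. wprod)\<rparr>"

inductive lie_ideal :: "'g set \<Rightarrow> ('g \<Rightarrow> int) \<Rightarrow> int \<Rightarrow> ('g word \<Rightarrow>\<^sub>0 rat) \<Rightarrow> bool"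
  for G :: "'g set" and deg :: "'g \<Rightarrow> int"
  where
    antisym: "\<lbrakk>p \<in> elts (free_nonassoc G deg) n; r \<in> elts (free_nonassoc G deg) m\<rbrakk> \<Longrightarrow>
      lie_ideal G deg (n + m)
        (wprod p r + Poly_Mapping.map ((*) ((-1) powi (n * m))) (wprod r p))"
  | jacobi: "\<lbrakk>p \<in> elts (free_nonassoc G deg) n; r \<in> elts (free_nonassoc G deg) m;
      s \<in> elts (free_nonassoc G deg) l\<rbrakk> \<Longrightarrow>
      lie_ideal G deg (n + m + l)
        (wprod p (wprod r s) - wprod (wprod p r) s
          - Poly_Mapping.map ((*) ((-1) powi (n * m))) (wprod r (wprod p s)))"
  | zero: "lie_ideal G deg n 0"
  | add: "\<lbrakk>lie_ideal G deg n p; lie_ideal G deg n r\<rbrakk> \<Longrightarrow> lie_ideal G deg n (p + r)"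
  | scale: "lie_ideal G deg n p \<Longrightarrow> lie_ideal G deg n (Poly_Mapping.map ((*) q) p)"
  | left: "\<lbrakk>r \<in> elts (free_nonassoc G deg) m; lie_ideal G deg n p\<rbrakk> \<Longrightarrow>
      lie_ideal G deg (m + n) (wprod r p)"
  | right: "\<lbrakk>lie_ideal G deg n p; r \<in> elts (free_nonassoc G deg) m\<rbrakk> \<Longrightarrow>
      lie_ideal G deg (n + m) (wprod p r)"

definition quot_gla :: "('a, 'm) gla_scheme \<Rightarrow> (int \<Rightarrow> 'a set) \<Rightarrow> 'a set gla"
  where "quot_gla L I =
    \<lparr>sp = (\<lambda>n. quot_mod (sp L n) (I n)),
     brk = (\<lambda>n m X Y. \<Union>x\<in>X. \<Union>y\<in>Y. I (n + m) +>\<^bsub>sp L (n + m)\<^esub> brk L n m x y)\<rparr>"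

definition free_lie :: "'g set \<Rightarrow> ('g \<Rightarrow> int) \<Rightarrow> ('g word \<Rightarrow>\<^sub>0 rat) set gla"
  where "free_lie G deg = quot_gla (free_nonassoc G deg) (\<lambda>n. {p. lie_ideal G deg n p})"

definition mod_span :: "(rat, 'a) module \<Rightarrow> 'a set \<Rightarrow> 'a set"
  where "mod_span M S = \<Inter>{H. submodule H QQ M \<and> S \<subseteq> H}"

text \<open>The lower central series, with the irrelevant value at index 0 set to the whole algebra.\<close>

fun lower_central :: "('a, 'm) gla_scheme \<Rightarrow> nat \<Rightarrow> int \<Rightarrow> 'a set"
  where
    "lower_central L 0 n = elts L n"
  | "lower_central L (Suc 0) n = elts L n"
  | "lower_central L (Suc (Suc k)) n = mod_span (sp L n)
       {brk L m (n - m) x y | m x y. x \<in> elts L m \<and> y \<in> lower_central L (Suc k) (n - m)}"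

text \<open>The completion of a graded Lie algebra with respect to a descending filtration by ideals.\<close>

definition completion :: "('a, 'm) gla_scheme \<Rightarrow> (nat \<Rightarrow> int \<Rightarrow> 'a set) \<Rightarrow> (nat \<Rightarrow> 'a set) gla"
  where "completion L F =
    \<lparr>sp = (\<lambda>n. inv_limit (sp L n) (\<lambda>k. F k n)),
     brk = (\<lambda>n m \<xi> \<eta> k. \<Union>x\<in>\<xi> k. \<Union>y\<in>\<eta> k. F (Suc k) (n + m) +>\<^bsub>sp L (n + m)\<^esub> brk L n m x y)\<rparr>"

text \<open>\<open>F\<^sub>k\<close> of the completion is the kernel of the projection onto \<open>L / F\<^sub>k L\<close>.\<close>

definition completion_fil ::
    "('a, 'm) gla_scheme \<Rightarrow> (nat \<Rightarrow> int \<Rightarrow> 'a set) \<Rightarrow> nat \<Rightarrow> int \<Rightarrow> (nat \<Rightarrow> 'a set) set"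
  where "completion_fil L F k n = {\<xi> \<in> elts (completion L F) n. \<xi> (k - 1) = F k n}"

type_synonym 'g cfl = "nat \<Rightarrow> ('g word \<Rightarrow>\<^sub>0 rat) set set"

definition complete_free_lie ::
    "'g set \<Rightarrow> ('g \<Rightarrow> int) \<Rightarrow> (int \<Rightarrow> 'g cfl \<Rightarrow> 'g cfl) \<Rightarrow> 'g cfl cdgl"
  where "complete_free_lie G deg d =
    (let L = free_lie G deg; C = completion L (lower_central L) in
     \<lparr>sp = sp C, brk = brk C, dif = d, fil = completion_fil L (lower_central L)\<rparr>)"

definition cfl_gen :: "'g set \<Rightarrow> ('g \<Rightarrow> int) \<Rightarrow> 'g \<Rightarrow> 'g cfl"
  where "cfl_gen G deg g = (\<lambda>k. lower_central (free_lie G deg) (Suc k) (deg g)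
    +>\<^bsub>sp (free_lie G deg) (deg g)\<^esub>
      ({p. lie_ideal G deg (deg g) p} +>\<^bsub>nonassoc_mod G deg (deg g)\<^esub> Poly_Mapping.single (Gen g) 1))"


section \<open>The cosimplicial cdgl of the standard simplices\<close>

text \<open>The face \<open>\<langle>i\<^sub>0, \<dots>, i\<^sub>k\<rangle>\<close> is represented by the set of its vertices.\<close>

definition faces :: "nat \<Rightarrow> nat set set"
  where "faces n = {I. I \<noteq> {} \<and> I \<subseteq> {..n}}"

definition face_deg :: "nat set \<Rightarrow> int"
  where "face_deg I = int (card I) - 2"

type_synonym simp_elt = "nat set cfl"

definition simplex_cdgl :: "(nat \<Rightarrow> int \<Rightarrow> simp_elt \<Rightarrow> simp_elt) \<Rightarrow> nat \<Rightarrow> simp_elt cdgl"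
  where "simplex_cdgl d n = complete_free_lie (faces n) face_deg (d n)"

definition face_gen :: "nat \<Rightarrow> nat set \<Rightarrow> simp_elt"
  where "face_gen n I = cfl_gen (faces n) face_deg I"

definition coface_map :: "nat \<Rightarrow> nat \<Rightarrow> nat"
  where "coface_map i k = (if k < i then k else Suc k)"

definition codegeneracy_map :: "nat \<Rightarrow> nat \<Rightarrow> nat"
  where "codegeneracy_map j k = (if k \<le> j then k else k - 1)"

text \<open>Generating function \<open>t / (e\<^sup>t - 1)\<close>, so \<open>B\<^sub>1 = - 1/2\<close>.\<close>

definition bernoulli :: "nat \<Rightarrow> rat"
  where "bernoulli n = fact n * fps_nth (fps_X / (fps_exp 1 - 1)) n"

definition sub_cdgl :: "('a, 'm) cdgl_scheme \<Rightarrow> (int \<Rightarrow> 'a set) \<Rightarrow> bool"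
  where "sub_cdgl L H \<longleftrightarrow>
    (\<forall>n. submodule (H n) QQ (sp L n)) \<and>
    (\<forall>n m. \<forall>x\<in>H n. \<forall>y\<in>H m. brk L n m x y \<in> H (n + m)) \<and>
    (\<forall>n. \<forall>x\<in>H n. dif L n x \<in> H (n - 1)) \<and>
    (\<forall>n. \<forall>x\<in>elts L n. (\<forall>k\<ge>1. \<exists>y\<in>H n. x \<ominus>\<^bsub>sp L n\<^esub> y \<in> fil L k n) \<longrightarrow> x \<in> H n)"

definition generated_sub_cdgl :: "('a, 'm) cdgl_scheme \<Rightarrow> (int \<Rightarrow> 'a set) \<Rightarrow> int \<Rightarrow> 'a set"
  where "generated_sub_cdgl L S n = \<Inter>{H n | H. sub_cdgl L H \<and> (\<forall>m. S m \<subseteq> H m)}"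

definition boundary_cdgl :: "(nat \<Rightarrow> int \<Rightarrow> simp_elt \<Rightarrow> simp_elt) \<Rightarrow> nat \<Rightarrow> int \<Rightarrow> simp_elt set"
  where "boundary_cdgl d n = generated_sub_cdgl (simplex_cdgl d n)
    (\<lambda>m. {face_gen n I | I. I \<in> faces n \<and> I \<noteq> {..n} \<and> face_deg I = m})"

text \<open>
  The cosimplicial cdgl, given by the differentials \<open>d n\<close>, the cofaces
  \<open>cf n i\<close> from the \<open>n\<close>-simplex to the \<open>(n+1)\<close>-simplex and the codegeneracies \<open>cd n j\<close> from the
  \<open>(n+1)\<close>-simplex to the \<open>n\<close>-simplex. The cosimplicial identities hold because they hold on
  generators and the morphisms are continuous. Modulo \<open>F\<^sub>2\<close> an element of a complete free
  Lie algebra is its linear part.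
\<close>

locale cosimplicial_simplex_cdgl =
  fixes d :: "nat \<Rightarrow> int \<Rightarrow> simp_elt \<Rightarrow> simp_elt"
    and cf :: "nat \<Rightarrow> nat \<Rightarrow> int \<Rightarrow> simp_elt \<Rightarrow> simp_elt"
    and cd :: "nat \<Rightarrow> nat \<Rightarrow> int \<Rightarrow> simp_elt \<Rightarrow> simp_elt"
  assumes complete_dgl: "complete_dg_lie_algebra (simplex_cdgl d n)"
    and vertex_MC: "i \<le> n \<Longrightarrow> face_gen n {i} \<in> MC (simplex_cdgl d n)"
    and linear_part: "\<lbrakk>I \<in> faces n; card I \<ge> 2\<rbrakk> \<Longrightarrow>
      (let L = simplex_cdgl d n; M = sp L (face_deg I - 1) in
        dif L (face_deg I) (face_gen n I) \<ominus>\<^bsub>M\<^esub>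
          (\<Oplus>\<^bsub>M\<^esub>i\<in>I. ((-1) ^ card {j\<in>I. j < i}) \<odot>\<^bsub>M\<^esub> face_gen n (I - {i}))
        \<in> fil L 2 (face_deg I - 1))"
    and coface_morphism: "i \<le> Suc n \<Longrightarrow>
      cdgl_morphism (simplex_cdgl d n) (simplex_cdgl d (Suc n)) (cf n i)"
    and coface_gen: "\<lbrakk>i \<le> Suc n; I \<in> faces n\<rbrakk> \<Longrightarrow>
      cf n i (face_deg I) (face_gen n I) = face_gen (Suc n) (coface_map i ` I)"
    and codegeneracy_morphism: "j \<le> n \<Longrightarrow>
      cdgl_morphism (simplex_cdgl d (Suc n)) (simplex_cdgl d n) (cd n j)"
    and codegeneracy_gen: "\<lbrakk>j \<le> n; I \<in> faces (Suc n)\<rbrakk> \<Longrightarrow>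
      cd n j (face_deg I) (face_gen (Suc n) I) =
        (if inj_on (codegeneracy_map j) I then face_gen n (codegeneracy_map j ` I)
         else \<zero>\<^bsub>sp (simplex_cdgl d n) (face_deg I)\<^esub>)"
    and interval:
      "let L = simplex_cdgl d 1; M = sp L (-1);
           a = face_gen 1 {0}; b = face_gen 1 {1}; x = face_gen 1 {0, 1}; ad = brk L 0 (-1) x in
        dif L 0 x = ad b \<oplus>\<^bsub>M\<^esub>
          series L (-1) (\<lambda>n. (bernoulli n / fact n) \<odot>\<^bsub>M\<^esub> (ad ^^ n) (b \<ominus>\<^bsub>M\<^esub> a))"
    and top_cell: "n \<ge> 2 \<Longrightarrow>
      twisted_dif (simplex_cdgl d n) (face_gen n {0}) (int n - 1) (face_gen n {..n})
        \<in> boundary_cdgl d n (int n - 2)"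


section \<open>Simplicial sets and their models\<close>

record 'x sset =
  simplices :: "nat \<Rightarrow> 'x set"
  face :: "nat \<Rightarrow> nat \<Rightarrow> 'x \<Rightarrow> 'x"
  degeneracy :: "nat \<Rightarrow> nat \<Rightarrow> 'x \<Rightarrow> 'x"

text \<open>
  \<open>face X n i\<close> maps \<open>(n+1)\<close>-simplices to \<open>n\<close>-simplices and \<open>degeneracy X n j\<close> maps
  \<open>n\<close>-simplices to \<open>(n+1)\<close>-simplices.
\<close>

locale simplicial_set =
  fixes X :: "'x sset"
  assumes face_closed: "\<lbrakk>i \<le> Suc n; x \<in> simplices X (Suc n)\<rbrakk> \<Longrightarrow> face X n i x \<in> simplices X n"
    and degeneracy_closed:
      "\<lbrakk>j \<le> n; x \<in> simplices X n\<rbrakk> \<Longrightarrow> degeneracy X n j x \<in> simplices X (Suc n)"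
    and face_face: "\<lbrakk>i < j; j \<le> Suc (Suc n); x \<in> simplices X (Suc (Suc n))\<rbrakk> \<Longrightarrow>
      face X n i (face X (Suc n) j x) = face X n (j - 1) (face X (Suc n) i x)"
    and face_degeneracy_less: "\<lbrakk>i < j; j \<le> Suc n; x \<in> simplices X (Suc n)\<rbrakk> \<Longrightarrow>
      face X (Suc n) i (degeneracy X (Suc n) j x) = degeneracy X n (j - 1) (face X n i x)"
    and face_degeneracy_same: "\<lbrakk>i = j \<or> i = Suc j; j \<le> n; x \<in> simplices X n\<rbrakk> \<Longrightarrow>
      face X n i (degeneracy X n j x) = x"
    and face_degeneracy_greater: "\<lbrakk>Suc j < i; i \<le> Suc (Suc n); x \<in> simplices X (Suc n)\<rbrakk> \<Longrightarrow>
      face X (Suc n) i (degeneracy X (Suc n) j x) = degeneracy X n j (face X n (i - 1) x)"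
    and degeneracy_degeneracy: "\<lbrakk>i \<le> j; j \<le> n; x \<in> simplices X n\<rbrakk> \<Longrightarrow>
      degeneracy X (Suc n) i (degeneracy X n j x) = degeneracy X (Suc n) (Suc j) (degeneracy X n i x)"

definition degenerate :: "'x sset \<Rightarrow> nat \<Rightarrow> 'x \<Rightarrow> bool"
  where "degenerate X n x \<longleftrightarrow>
    (\<exists>m j. \<exists>y\<in>simplices X m. n = Suc m \<and> j \<le> m \<and> x = degeneracy X m j y)"

definition finite_sset :: "'x sset \<Rightarrow> bool"
  where "finite_sset X \<longleftrightarrow> finite {(n, x). x \<in> simplices X n \<and> \<not> degenerate X n x}"

text \<open>
  A cocone on the diagram of the \<open>simplex_cdgl d n\<close> over the category of simplices of \<open>X\<close>.
  That category is generated by the morphisms given by faces and degeneracies, so compatibility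
  with those suffices.
\<close>

definition model_cocone ::
    "(nat \<Rightarrow> int \<Rightarrow> simp_elt \<Rightarrow> simp_elt) \<Rightarrow>
     (nat \<Rightarrow> nat \<Rightarrow> int \<Rightarrow> simp_elt \<Rightarrow> simp_elt) \<Rightarrow>
     (nat \<Rightarrow> nat \<Rightarrow> int \<Rightarrow> simp_elt \<Rightarrow> simp_elt) \<Rightarrow>
     'x sset \<Rightarrow> 'u cdgl \<Rightarrow> (nat \<Rightarrow> 'x \<Rightarrow> int \<Rightarrow> simp_elt \<Rightarrow> 'u) \<Rightarrow> bool"
  where "model_cocone d cf cd X L \<iota> \<longleftrightarrow>
    (\<forall>n. \<forall>x\<in>simplices X n. cdgl_morphism (simplex_cdgl d n) L (\<iota> n x)) \<and>
    (\<forall>n. \<forall>x\<in>simplices X (Suc n). \<forall>i\<le>Suc n.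
       eq_morphism (simplex_cdgl d n) (\<iota> n (face X n i x)) (comp_morphism (\<iota> (Suc n) x) (cf n i))) \<and>
    (\<forall>n. \<forall>x\<in>simplices X n. \<forall>j\<le>n.
       eq_morphism (simplex_cdgl d (Suc n))
         (\<iota> (Suc n) (degeneracy X n j x)) (comp_morphism (\<iota> n x) (cd n j)))"

text \<open>The colimit in \<open>cDGL\<close> is given by its universal property, hence up to isomorphism.\<close>

definition is_model ::
    "(nat \<Rightarrow> int \<Rightarrow> simp_elt \<Rightarrow> simp_elt) \<Rightarrow>
     (nat \<Rightarrow> nat \<Rightarrow> int \<Rightarrow> simp_elt \<Rightarrow> simp_elt) \<Rightarrow>
     (nat \<Rightarrow> nat \<Rightarrow> int \<Rightarrow> simp_elt \<Rightarrow> simp_elt) \<Rightarrow>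
     'x sset \<Rightarrow> 'u cdgl \<Rightarrow> (nat \<Rightarrow> 'x \<Rightarrow> int \<Rightarrow> simp_elt \<Rightarrow> 'u) \<Rightarrow> bool"
  where "is_model d cf cd X L \<iota> \<longleftrightarrow>
    complete_dg_lie_algebra L \<and> model_cocone d cf cd X L \<iota> \<and>
    (\<forall>(M :: 'u cdgl) \<kappa>. complete_dg_lie_algebra M \<and> model_cocone d cf cd X M \<kappa> \<longrightarrow>
       (\<exists>h. cdgl_morphism L M h \<and>
          (\<forall>n. \<forall>x\<in>simplices X n.
             eq_morphism (simplex_cdgl d n) (comp_morphism h (\<iota> n x)) (\<kappa> n x)) \<and>
          (\<forall>h'. cdgl_morphism L M h' \<and>
             (\<forall>n. \<forall>x\<in>simplices X n.
                eq_morphism (simplex_cdgl d n) (comp_morphism h' (\<iota> n x)) (\<kappa> n x)) \<longrightarrow>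
             eq_morphism L h h')))"

end

theory Submission
  imports Defs
begin

text \<open>
  By the universal property of the colimit, lifting a morphism \<open>v\<close> from the model through a trivial fibration
  \<open>p: A \<rightarrow> B\<close> amounts to lifting the induced cocone of morphisms from simplices to \<open>B\<close>: the lifted cocone
  induces a morphism \<open>h\<close> to \<open>A\<close>, and \<open>p \<circ> h = v\<close> because both are induced by the same cocone on \<open>B\<close>. The cocone is
  lifted by induction on the dimension of the simplices (\<open>K_spec\<close>). At a degenerate simplex the lift is dictated by
  any presentation as a degeneracy (\<open>extend_degenerate\<close>). At any other simplex the lifts on the facets fit together,
  and since the dgl of a simplex is completely free, only the value at the top generator is missing
  (\<open>extend_over_simplex\<close>).

  In dimension 0 this value is a Maurer-Cartan element over a given one; it exists because \<open>p\<close> is bijective on gauge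
  orbits and surjective in degree 0 (\<open>lift_MC\<close>). In dimension 1 it is a gauge between two given Maurer-Cartan
  elements over a given gauge (\<open>lift_path\<close>). In dimension \<open>n \<ge> 2\<close> the twisted differential of the top generator lies
  in the boundary of the simplex, so a primitive of a given cycle of degree \<open>n - 2\<close> over a given primitive is needed;
  it exists because \<open>p\<close> induces isomorphisms on the homology of components in degrees \<open>n - 2\<close> and \<open>n - 1\<close>
  (\<open>lift_primitive\<close>).

  Dimension 1 requires the groupoid structure of gauges. Instead of the Baker-Campbell-Hausdorff product, whose
  properties would have to be proved in every complete dgl, the 2-simplex is used: the twisted differential \<open>P\<close> of its
  top generator has degree 0 and linear part \<open>a\<^sub>1\<^sub>2 - a\<^sub>0\<^sub>2 + a\<^sub>0\<^sub>1\<close>. Given the values of two edges, the equation \<open>P = 0\<close> has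
  exactly one solution for the third, by successive approximation along the filtration, and \<open>d\<^sub>a P = 0\<close> forces the
  solution to be a gauge between the remaining vertices (\<open>triangle_horn\<close>, \<open>triangle_unique\<close>). Composites, inverses and
  their naturality all come from filling such horns. In the same way the interval shows that the gauge action
  preserves Maurer-Cartan elements (\<open>gauge_MC\<close>).

  Two facts about a complete free Lie algebra carry these arguments: Lie morphisms may be prescribed on generators
  (\<open>ex_lie_morphism\<close>), and agreement of two Lie morphisms, or of \<open>\<phi> \<circ> d\<close> and \<open>d \<circ> \<phi>\<close>, modulo \<open>F\<^sub>k\<close> on generators spreads to
  all elements and improves to \<open>F\<^sub>k\<^sub>+\<^sub>1\<close> on \<open>F\<^sub>2\<close> (\<open>approximation_principle\<close>).
\<close>

section \<open>Rational modules and congruence modulo the filtration\<close>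

lemma QQ_simps [simp]:
  "carrier QQ = UNIV" "a \<otimes>\<^bsub>QQ\<^esub> b = a * b" "a \<oplus>\<^bsub>QQ\<^esub> b = a + b" "\<one>\<^bsub>QQ\<^esub> = 1" "\<zero>\<^bsub>QQ\<^esub> = 0"
  by (simp_all add: QQ_def)

lemma cring_QQ: "cring QQ"
proof (intro cringI abelian_groupI comm_monoidI)
  show "\<exists>y\<in>carrier QQ. y \<oplus>\<^bsub>QQ\<^esub> x = \<zero>\<^bsub>QQ\<^esub>" for x
    by (rule bexI[of _ "- x"]) simp_all
qed (simp_all add: algebra_simps)

lemma (in Module.module) module_abelian_group: "abelian_group M"
  by (rule abelian_group_axioms)

lemma submodule_abelian_subgroup:
  assumes "abelian_group M" "submodule H QQ M"
  shows "abelian_subgroup H M"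
  using assms by (intro abelian_subgroupI3 additive_subgroup.intro)
    (auto simp: submodule_def)

lemma Q_linear_closed: "\<lbrakk>Q_linear M N f; x \<in> carrier M\<rbrakk> \<Longrightarrow> f x \<in> carrier N"
  by (auto simp: Q_linear_def)

lemma Q_linear_add:
  "\<lbrakk>Q_linear M N f; x \<in> carrier M; y \<in> carrier M\<rbrakk> \<Longrightarrow> f (x \<oplus>\<^bsub>M\<^esub> y) = f x \<oplus>\<^bsub>N\<^esub> f y"
  by (auto simp: Q_linear_def)

lemma Q_linear_smult:
  "\<lbrakk>Q_linear M N f; x \<in> carrier M\<rbrakk> \<Longrightarrow> f (q \<odot>\<^bsub>M\<^esub> x) = q \<odot>\<^bsub>N\<^esub> f x"
  by (auto simp: Q_linear_def)

lemma module_QQ_smult_minus_one: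
  assumes "Module.module QQ M" "x \<in> carrier M"
  shows "(-1) \<odot>\<^bsub>M\<^esub> x = \<ominus>\<^bsub>M\<^esub> x"
proof -
  interpret Module.module QQ M by fact
  have "(-1) \<odot>\<^bsub>M\<^esub> x \<oplus>\<^bsub>M\<^esub> x = (-1 + 1) \<odot>\<^bsub>M\<^esub> x"
    using smult_l_distr[of "-1" 1 x] assms(2) smult_one[of x] by simp
  also have "\<dots> = \<zero>\<^bsub>M\<^esub>" using smult_l_null[of x] assms(2) by simp
  finally show ?thesis
    using assms(2) smult_closed[of "-1" x] by (simp add: M.minus_equality)
qed

lemma
  assumes "Q_linear M N f" "Module.module QQ M" "Module.module QQ N"
  shows Q_linear_zero: "f \<zero>\<^bsub>M\<^esub> = \<zero>\<^bsub>N\<^esub>"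
    and Q_linear_uminus: "x \<in> carrier M \<Longrightarrow> f (\<ominus>\<^bsub>M\<^esub> x) = \<ominus>\<^bsub>N\<^esub> f x"
    and Q_linear_minus: "\<lbrakk>x \<in> carrier M; y \<in> carrier M\<rbrakk> \<Longrightarrow> f (x \<ominus>\<^bsub>M\<^esub> y) = f x \<ominus>\<^bsub>N\<^esub> f y"
proof -
  interpret M: Module.module QQ M by fact
  interpret N: Module.module QQ N by fact
  note l = assms(1)
  show "f \<zero>\<^bsub>M\<^esub> = \<zero>\<^bsub>N\<^esub>"
    using Q_linear_smult[OF l, of "\<zero>\<^bsub>M\<^esub>" 0] Q_linear_closed[OF l, of "\<zero>\<^bsub>M\<^esub>"]
      M.smult_r_null[of 0] N.smult_l_null by simp
  show um: "f (\<ominus>\<^bsub>M\<^esub> x) = \<ominus>\<^bsub>N\<^esub> f x" if "x \<in> carrier M" for x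
    using Q_linear_smult[OF l that, of "-1"] Q_linear_closed[OF l that] that
    by (simp add: module_QQ_smult_minus_one assms)
  show "f (x \<ominus>\<^bsub>M\<^esub> y) = f x \<ominus>\<^bsub>N\<^esub> f y" if "x \<in> carrier M" "y \<in> carrier M"
    using that by (simp add: a_minus_def Q_linear_add[OF l] um)
qed

lemma Q_linear_finsum:
  assumes "Q_linear M N f" "Module.module QQ M" "Module.module QQ N"
    and "finite I" "\<And>i. i \<in> I \<Longrightarrow> g i \<in> carrier M"
  shows "f (finsum M g I) = finsum N (\<lambda>i. f (g i)) I"
proof -
  interpret M: Module.module QQ M by fact
  interpret N: Module.module QQ N by fact
  show ?thesis using assms(4,5)
  proof (induction I)
    case empty
    then show ?case using Q_linear_zero[OF assms(1-3)] by simp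
  next
    case (insert i I)
    have g: "g \<in> insert i I \<rightarrow> carrier M" using insert by auto
    have fg: "(\<lambda>i. f (g i)) \<in> insert i I \<rightarrow> carrier N"
      using insert Q_linear_closed[OF assms(1)] by auto
    show ?case using insert g fg
      by (simp add: Q_linear_add[OF assms(1)] Pi_def)
  qed
qed

lemma Q_linear_comp: "\<lbrakk>Q_linear M N f; Q_linear N P g\<rbrakk> \<Longrightarrow> Q_linear M P (\<lambda>x. g (f x))"
  unfolding Q_linear_def Pi_iff by simp

sublocale graded_lie_algebra \<subseteq> sp: Module.module QQ "sp L n" for n
  by (rule sp_module)

context graded_lie_algebra
begin

lemma brk_closed [simp, intro]:
  "\<lbrakk>x \<in> elts L n; y \<in> elts L m\<rbrakk> \<Longrightarrow> brk L n m x y \<in> elts L (n + m)"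
  using brk_linear_left Q_linear_closed by fastforce

lemma smult_closed [simp, intro]: "x \<in> elts L n \<Longrightarrow> q \<odot>\<^bsub>sp L n\<^esub> x \<in> elts L n"
  using sp.smult_closed[of q x n] by simp

lemma smult_add_left:
  "x \<in> elts L n \<Longrightarrow> (p + q) \<odot>\<^bsub>sp L n\<^esub> x = p \<odot>\<^bsub>sp L n\<^esub> x \<oplus>\<^bsub>sp L n\<^esub> q \<odot>\<^bsub>sp L n\<^esub> x"
  using sp.smult_l_distr[of p q x n] by simp

lemma smult_add_right:
  "\<lbrakk>x \<in> elts L n; y \<in> elts L n\<rbrakk> \<Longrightarrow>
    q \<odot>\<^bsub>sp L n\<^esub> (x \<oplus>\<^bsub>sp L n\<^esub> y) = q \<odot>\<^bsub>sp L n\<^esub> x \<oplus>\<^bsub>sp L n\<^esub> q \<odot>\<^bsub>sp L n\<^esub> y"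
  using sp.smult_r_distr[of q x n y] by simp

lemma smult_smult: "x \<in> elts L n \<Longrightarrow> p \<odot>\<^bsub>sp L n\<^esub> (q \<odot>\<^bsub>sp L n\<^esub> x) = (p * q) \<odot>\<^bsub>sp L n\<^esub> x"
  using sp.smult_assoc1[of p q x n] by simp

lemma smult_1 [simp]: "x \<in> elts L n \<Longrightarrow> 1 \<odot>\<^bsub>sp L n\<^esub> x = x"
  using sp.smult_one[of x n] by simp

lemma smult_0 [simp]: "x \<in> elts L n \<Longrightarrow> 0 \<odot>\<^bsub>sp L n\<^esub> x = \<zero>\<^bsub>sp L n\<^esub>"
  using sp.smult_l_null[of x n] by simp

lemma smult_zero [simp]: "q \<odot>\<^bsub>sp L n\<^esub> \<zero>\<^bsub>sp L n\<^esub> = \<zero>\<^bsub>sp L n\<^esub>"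
  using sp.smult_r_null[of q n] by simp

lemma smult_neg_1: "x \<in> elts L n \<Longrightarrow> (-1) \<odot>\<^bsub>sp L n\<^esub> x = \<ominus>\<^bsub>sp L n\<^esub> x"
  by (rule module_QQ_smult_minus_one[OF sp_module])

lemma brk_add_left:
  "\<lbrakk>x \<in> elts L n; x' \<in> elts L n; y \<in> elts L m\<rbrakk> \<Longrightarrow>
    brk L n m (x \<oplus>\<^bsub>sp L n\<^esub> x') y = brk L n m x y \<oplus>\<^bsub>sp L (n + m)\<^esub> brk L n m x' y"
  using Q_linear_add[OF brk_linear_left] .

lemma brk_add_right:
  "\<lbrakk>x \<in> elts L n; y \<in> elts L m; y' \<in> elts L m\<rbrakk> \<Longrightarrow>
    brk L n m x (y \<oplus>\<^bsub>sp L m\<^esub> y') = brk L n m x y \<oplus>\<^bsub>sp L (n + m)\<^esub> brk L n m x y'"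
  using Q_linear_add[OF brk_linear_right] .

lemma brk_smult_left:
  "\<lbrakk>x \<in> elts L n; y \<in> elts L m\<rbrakk> \<Longrightarrow>
    brk L n m (q \<odot>\<^bsub>sp L n\<^esub> x) y = q \<odot>\<^bsub>sp L (n + m)\<^esub> brk L n m x y"
  using Q_linear_smult[OF brk_linear_left] .

lemma brk_smult_right:
  "\<lbrakk>x \<in> elts L n; y \<in> elts L m\<rbrakk> \<Longrightarrow>
    brk L n m x (q \<odot>\<^bsub>sp L m\<^esub> y) = q \<odot>\<^bsub>sp L (n + m)\<^esub> brk L n m x y"
  using Q_linear_smult[OF brk_linear_right] .

lemma brk_minus_left:
  "\<lbrakk>x \<in> elts L n; x' \<in> elts L n; y \<in> elts L m\<rbrakk> \<Longrightarrow>
    brk L n m (x \<ominus>\<^bsub>sp L n\<^esub> x') y = brk L n m x y \<ominus>\<^bsub>sp L (n + m)\<^esub> brk L n m x' y"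
  using Q_linear_minus[OF brk_linear_left sp_module sp_module] .

lemma brk_minus_right:
  "\<lbrakk>x \<in> elts L n; y \<in> elts L m; y' \<in> elts L m\<rbrakk> \<Longrightarrow>
    brk L n m x (y \<ominus>\<^bsub>sp L m\<^esub> y') = brk L n m x y \<ominus>\<^bsub>sp L (n + m)\<^esub> brk L n m x y'"
  using Q_linear_minus[OF brk_linear_right sp_module sp_module] .

lemma brk_zero_left [simp]: "y \<in> elts L m \<Longrightarrow> brk L n m \<zero>\<^bsub>sp L n\<^esub> y = \<zero>\<^bsub>sp L (n + m)\<^esub>"
  using Q_linear_zero[OF brk_linear_left sp_module sp_module] .

lemma brk_zero_right [simp]: "x \<in> elts L n \<Longrightarrow> brk L n m x \<zero>\<^bsub>sp L m\<^esub> = \<zero>\<^bsub>sp L (n + m)\<^esub>"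
  using Q_linear_zero[OF brk_linear_right sp_module sp_module] .

end

context dg_lie_algebra
begin

lemma dif_closed [simp, intro]: "x \<in> elts L n \<Longrightarrow> dif L n x \<in> elts L (n - 1)"
  using Q_linear_closed[OF dif_linear] .

lemma dif_add:
  "\<lbrakk>x \<in> elts L n; y \<in> elts L n\<rbrakk> \<Longrightarrow>
    dif L n (x \<oplus>\<^bsub>sp L n\<^esub> y) = dif L n x \<oplus>\<^bsub>sp L (n - 1)\<^esub> dif L n y"
  using Q_linear_add[OF dif_linear] .

lemma dif_smult: "x \<in> elts L n \<Longrightarrow> dif L n (q \<odot>\<^bsub>sp L n\<^esub> x) = q \<odot>\<^bsub>sp L (n - 1)\<^esub> dif L n x"
  using Q_linear_smult[OF dif_linear] .

lemma dif_minus: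
  "\<lbrakk>x \<in> elts L n; y \<in> elts L n\<rbrakk> \<Longrightarrow>
    dif L n (x \<ominus>\<^bsub>sp L n\<^esub> y) = dif L n x \<ominus>\<^bsub>sp L (n - 1)\<^esub> dif L n y"
  using Q_linear_minus[OF dif_linear sp_module sp_module] .

lemma dif_uminus:
  "x \<in> elts L n \<Longrightarrow> dif L n (\<ominus>\<^bsub>sp L n\<^esub> x) = \<ominus>\<^bsub>sp L (n - 1)\<^esub> dif L n x"
  using Q_linear_uminus[OF dif_linear sp_module sp_module] .

lemma dif_zero [simp]: "dif L n \<zero>\<^bsub>sp L n\<^esub> = \<zero>\<^bsub>sp L (n - 1)\<^esub>"
  using Q_linear_zero[OF dif_linear sp_module sp_module] .

end

text \<open>
  Membership of both sides is part of the congruence, so that chains of congruences carry the degree information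
  along.
\<close>

definition fcong :: "('a, 'm) cdgl_scheme \<Rightarrow> nat \<Rightarrow> int \<Rightarrow> 'a \<Rightarrow> 'a \<Rightarrow> bool"
  where "fcong L k n x y \<longleftrightarrow> x \<in> elts L n \<and> y \<in> elts L n \<and> x \<ominus>\<^bsub>sp L n\<^esub> y \<in> fil L k n"

lemma (in abelian_group) uminus_zero [simp]: "\<ominus> \<zero> = \<zero>"
  by (rule minus_equality) simp_all

lemma (in abelian_group) minus_decompose:
  assumes "x \<in> carrier G" "y \<in> carrier G" "z \<in> carrier G" "w \<in> carrier G"
  shows "x \<ominus> z = (x \<ominus> y) \<oplus> (y \<ominus> z)"
    and "(x \<oplus> y) \<ominus> (z \<oplus> w) = (x \<ominus> z) \<oplus> (y \<ominus> w)"
    and "x \<ominus> y = \<ominus> (y \<ominus> x)"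
    and "(x \<ominus> y = \<zero>) = (x = y)"
    and "(x \<ominus> y) \<oplus> y = x"
    and "(x \<oplus> y) \<ominus> y = x"
    and "(x \<ominus> y = z) = (x = z \<oplus> y)"
proof -
  show 5: "(x \<ominus> y) \<oplus> y = x" using assms by (simp add: minus_eq a_assoc l_neg)
  show "x \<ominus> z = (x \<ominus> y) \<oplus> (y \<ominus> z)"
    using assms by (simp add: minus_eq a_assoc r_neg2 r_neg1)
  show "(x \<oplus> y) \<ominus> (z \<oplus> w) = (x \<ominus> z) \<oplus> (y \<ominus> w)"
    using assms by (simp add: minus_eq minus_add a_ac)
  show "x \<ominus> y = \<ominus> (y \<ominus> x)"
    using assms by (simp add: minus_eq minus_add a_ac)
  show "(x \<ominus> y = \<zero>) = (x = y)"
    using assms 5 by (metis minus_eq r_neg l_zero)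
  show 6: "(x \<oplus> y) \<ominus> y = x" using assms by (simp add: minus_eq a_assoc r_neg)
  show "(x \<ominus> y = z) = (x = z \<oplus> y)"
    using assms 5 by (auto simp: minus_eq a_assoc r_neg)
qed

context complete_dg_lie_algebra
begin

lemma fil_subset: "1 \<le> k \<Longrightarrow> fil L k n \<subseteq> elts L n"
  using sp.submoduleE(1)[OF fil_submodule] .

lemma fil_abelian_subgroup: "1 \<le> k \<Longrightarrow> abelian_subgroup (fil L k n) (sp L n)"
  using submodule_abelian_subgroup fil_submodule sp.abelian_group_axioms by blast

lemma fil_mem:
  assumes "1 \<le> k"
  shows "\<zero>\<^bsub>sp L n\<^esub> \<in> fil L k n"
    and "x \<in> fil L k n \<Longrightarrow> y \<in> fil L k n \<Longrightarrow> x \<oplus>\<^bsub>sp L n\<^esub> y \<in> fil L k n"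
    and "x \<in> fil L k n \<Longrightarrow> \<ominus>\<^bsub>sp L n\<^esub> x \<in> fil L k n"
    and "x \<in> fil L k n \<Longrightarrow> y \<in> fil L k n \<Longrightarrow> x \<ominus>\<^bsub>sp L n\<^esub> y \<in> fil L k n"
    and "x \<in> fil L k n \<Longrightarrow> q \<odot>\<^bsub>sp L n\<^esub> x \<in> fil L k n"
  using additive_subgroup.zero_closed abelian_subgroup.axioms(1)[OF fil_abelian_subgroup]
    sp.submoduleE(3-5)[OF fil_submodule] assms
  by (auto simp: a_minus_def)

lemma fil_antimono: "\<lbrakk>1 \<le> j; j \<le> k\<rbrakk> \<Longrightarrow> fil L k n \<subseteq> fil L j n"
proof (induction k)
  case (Suc k)
  then show ?case using fil_descending[of k n] by (cases "j = Suc k") auto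
qed simp

lemma fcong_closed: "fcong L k n x y \<Longrightarrow> x \<in> elts L n" "fcong L k n x y \<Longrightarrow> y \<in> elts L n"
  by (auto simp: fcong_def)

lemma fcong_refl: "\<lbrakk>1 \<le> k; x \<in> elts L n\<rbrakk> \<Longrightarrow> fcong L k n x x"
  using fil_mem(1)[of k n] by (simp add: fcong_def sp.minus_eq sp.r_neg)

lemma fcong_one: "\<lbrakk>x \<in> elts L n; y \<in> elts L n\<rbrakk> \<Longrightarrow> fcong L 1 n x y"
  using fil_one by (simp add: fcong_def)

lemma fcong_sym: "\<lbrakk>1 \<le> k; fcong L k n x y\<rbrakk> \<Longrightarrow> fcong L k n y x"
  using fil_mem(3)[of k "x \<ominus>\<^bsub>sp L n\<^esub> y" n] sp.minus_decompose(3)[of y n x]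
  by (auto simp: fcong_def)

lemma fcong_trans: "\<lbrakk>1 \<le> k; fcong L k n x y; fcong L k n y z\<rbrakk> \<Longrightarrow> fcong L k n x z"
  using fil_mem(2)[of k "x \<ominus>\<^bsub>sp L n\<^esub> y" n "y \<ominus>\<^bsub>sp L n\<^esub> z"] sp.minus_decompose(1)[of x n y z]
  by (auto simp: fcong_def)

lemma fcong_mono: "\<lbrakk>1 \<le> j; j \<le> k; fcong L k n x y\<rbrakk> \<Longrightarrow> fcong L j n x y"
  using fil_antimono by (auto simp: fcong_def)

lemma fcong_add:
  "\<lbrakk>1 \<le> k; fcong L k n x y; fcong L k n z w\<rbrakk> \<Longrightarrow>
    fcong L k n (x \<oplus>\<^bsub>sp L n\<^esub> z) (y \<oplus>\<^bsub>sp L n\<^esub> w)"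
  using fil_mem(2)[of k "x \<ominus>\<^bsub>sp L n\<^esub> y" n "z \<ominus>\<^bsub>sp L n\<^esub> w"] sp.minus_decompose(2)[of x n z y w]
  by (auto simp: fcong_def)

lemma fcong_smult:
  assumes "1 \<le> k" "fcong L k n x y" shows "fcong L k n (q \<odot>\<^bsub>sp L n\<^esub> x) (q \<odot>\<^bsub>sp L n\<^esub> y)"
proof -
  have "q \<odot>\<^bsub>sp L n\<^esub> x \<ominus>\<^bsub>sp L n\<^esub> q \<odot>\<^bsub>sp L n\<^esub> y = q \<odot>\<^bsub>sp L n\<^esub> (x \<ominus>\<^bsub>sp L n\<^esub> y)"
    using assms(2) by (simp add: fcong_def a_minus_def smult_add_right sp.smult_r_minus)
  then show ?thesis using assms fil_mem(5) by (simp add: fcong_def)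
qed

lemma fcong_uminus: "\<lbrakk>1 \<le> k; fcong L k n x y\<rbrakk> \<Longrightarrow> fcong L k n (\<ominus>\<^bsub>sp L n\<^esub> x) (\<ominus>\<^bsub>sp L n\<^esub> y)"
  using fcong_smult[of k n x y "-1"] smult_neg_1 fcong_closed by metis

lemma fcong_minus:
  "\<lbrakk>1 \<le> k; fcong L k n x y; fcong L k n z w\<rbrakk> \<Longrightarrow>
    fcong L k n (x \<ominus>\<^bsub>sp L n\<^esub> z) (y \<ominus>\<^bsub>sp L n\<^esub> w)"
  by (simp add: a_minus_def fcong_add fcong_uminus)

text \<open>
  Brackets gain one filtration step: since every element lies in \<open>F\<^sub>1\<close>, replacing both
  factors by congruent ones modulo \<open>F\<^sub>k\<close> changes the bracket by an element of \<open>F\<^sub>k\<^sub>+\<^sub>1\<close>. All the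
  successive approximations below rest on this gain.
\<close>

lemma fcong_brk:
  assumes "1 \<le> k" "fcong L k n x x'" "fcong L k m y y'"
  shows "fcong L (Suc k) (n + m) (brk L n m x y) (brk L n m x' y')"
proof -
  have c: "x \<in> elts L n" "x' \<in> elts L n" "y \<in> elts L m" "y' \<in> elts L m"
    using assms fcong_closed by blast+
  have "brk L n m (x \<ominus>\<^bsub>sp L n\<^esub> x') y \<in> fil L (k + 1) (n + m)"
    using assms c fil_one by (intro fil_brk) (auto simp: fcong_def)
  then have 1: "fcong L (Suc k) (n + m) (brk L n m x y) (brk L n m x' y)"
    using c by (simp add: fcong_def brk_minus_left)
  have "brk L n m x' (y \<ominus>\<^bsub>sp L m\<^esub> y') \<in> fil L (1 + k) (n + m)"
    using assms c fil_one by (intro fil_brk) (auto simp: fcong_def)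
  then have "fcong L (Suc k) (n + m) (brk L n m x' y) (brk L n m x' y')"
    using c by (simp add: fcong_def brk_minus_right)
  with 1 show ?thesis using fcong_trans by simp
qed

lemma fil_iff_fcong: "\<lbrakk>x \<in> elts L n\<rbrakk> \<Longrightarrow> x \<in> fil L k n \<longleftrightarrow> fcong L k n x \<zero>\<^bsub>sp L n\<^esub>"
  by (simp add: fcong_def a_minus_def)

lemma fcong_coset:
  assumes "1 \<le> k" "x \<in> elts L n" "y \<in> elts L n"
  shows "fcong L k n x y \<longleftrightarrow> fil L k n +>\<^bsub>sp L n\<^esub> x = fil L k n +>\<^bsub>sp L n\<^esub> y"
proof -
  interpret F: abelian_subgroup "fil L k n" "sp L n" by (rule fil_abelian_subgroup) fact
  show ?thesis
    using F.a_rcos_module_rev[OF assms(3,2)] F.a_rcos_module_imp[OF assms(3), of x]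
      F.a_repr_independence'[of x y] F.a_rcos_self[OF assms(2)] assms
    by (auto simp: fcong_def a_minus_def)
qed

text \<open>
  The two halves of completeness: injectivity of the map to the inverse limit says that congruence at all levels is
  equality, surjectivity says that coherent sequences have limits.
\<close>

lemma eq_if_fcong:
  assumes "x \<in> elts L n" "y \<in> elts L n" "\<And>k. fcong L (Suc k) n x y"
  shows "x = y"
proof -
  have "(\<lambda>k. fil L (Suc k) n +>\<^bsub>sp L n\<^esub> x) = (\<lambda>k. fil L (Suc k) n +>\<^bsub>sp L n\<^esub> y)"
    using assms by (intro ext) (simp add: fcong_coset[symmetric])
  then show ?thesis
    using bij_betw_imp_inj_on[OF complete] assms(1,2) by (auto dest: inj_onD)
qed

lemma fil_coset_mono:
  assumes "1 \<le> j" "j \<le> k" shows "fil L k n +>\<^bsub>sp L n\<^esub> x \<subseteq> fil L j n +>\<^bsub>sp L n\<^esub> x"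
  using fil_antimono[OF assms] by (auto simp: a_r_coset_def')

lemma ex_fcong_limit:
  assumes "\<And>k. fcong L (Suc k) n (s (Suc k)) (s k)"
  shows "\<exists>l\<in>elts L n. \<forall>k. fcong L (Suc k) n l (s k)"
proof -
  define \<xi> where "\<xi> = (\<lambda>k. fil L (Suc k) n +>\<^bsub>sp L n\<^esub> s k)"
  have sc: "s k \<in> elts L n" for k using assms fcong_closed(2) by blast
  have "\<xi> \<in> carrier (inv_limit (sp L n) (\<lambda>k. fil L k n))"
    unfolding inv_limit_def quot_mod_def
  proof (clarsimp, intro conjI)
    fix k
    show "\<xi> k \<in> a_rcosets\<^bsub>sp L n\<^esub> fil L (Suc k) n"
      unfolding \<xi>_def using sc by (intro sp.a_rcosetsI fil_subset) auto
    have "\<xi> k = fil L (Suc k) n +>\<^bsub>sp L n\<^esub> s (Suc k)"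
      unfolding \<xi>_def using assms[of k] sc by (simp add: fcong_coset)
    then show "\<xi> (Suc k) \<subseteq> \<xi> k" unfolding \<xi>_def by (simp add: fil_coset_mono)
  qed
  then obtain l where "l \<in> elts L n" "\<xi> = (\<lambda>k. fil L (Suc k) n +>\<^bsub>sp L n\<^esub> l)"
    using bij_betw_imp_surj_on[OF complete, of n] by blast
  then show ?thesis
    using sc unfolding \<xi>_def by (intro bexI[of _ l] allI) (auto simp: fcong_coset dest: fun_cong)
qed

end

section \<open>Quotient modules\<close>

lemma quot_mod_simps [simp]:
  "carrier (quot_mod M H) = a_rcosets\<^bsub>M\<^esub> H" "\<zero>\<^bsub>quot_mod M H\<^esub> = H"
  "X \<oplus>\<^bsub>quot_mod M H\<^esub> Y = X <+>\<^bsub>M\<^esub> Y"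
  "q \<odot>\<^bsub>quot_mod M H\<^esub> X = (\<Union>x\<in>X. H +>\<^bsub>M\<^esub> (q \<odot>\<^bsub>M\<^esub> x))"
  by (simp_all add: quot_mod_def)

lemma quot_mod_abelian_group:
  assumes "abelian_subgroup H M"
  shows "abelian_group (quot_mod M H)"
proof -
  interpret abelian_subgroup H M by fact
  interpret Q: comm_group "M A_Mod H" by (rule a_factorgroup_is_comm_group)
  have [simp]: "carrier (M A_Mod H) = a_rcosets\<^bsub>M\<^esub> H" "\<one>\<^bsub>M A_Mod H\<^esub> = H"
    by (simp_all add: A_FactGroup_def')
  show ?thesis
  proof (rule abelian_groupI)
    fix X Y Z
    assume X: "X \<in> carrier (quot_mod M H)"
    show "\<exists>Y\<in>carrier (quot_mod M H). Y \<oplus>\<^bsub>quot_mod M H\<^esub> X = \<zero>\<^bsub>quot_mod M H\<^esub>"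
      using Q.l_inv_ex[of X] X by simp
    show "\<zero>\<^bsub>quot_mod M H\<^esub> \<oplus>\<^bsub>quot_mod M H\<^esub> X = X"
      using Q.l_one[of X] X by simp
    assume Y: "Y \<in> carrier (quot_mod M H)"
    show "X \<oplus>\<^bsub>quot_mod M H\<^esub> Y \<in> carrier (quot_mod M H)"
      using Q.m_closed[of X Y] X Y by simp
    show "X \<oplus>\<^bsub>quot_mod M H\<^esub> Y = Y \<oplus>\<^bsub>quot_mod M H\<^esub> X"
      using Q.m_comm[of X Y] X Y by simp
    assume "Z \<in> carrier (quot_mod M H)"
    then show "X \<oplus>\<^bsub>quot_mod M H\<^esub> Y \<oplus>\<^bsub>quot_mod M H\<^esub> Z = X \<oplus>\<^bsub>quot_mod M H\<^esub> (Y \<oplus>\<^bsub>quot_mod M H\<^esub> Z)"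
      using Q.m_assoc[of X Y Z] X Y by simp
  qed (use a_subgroup_in_rcosets in simp)
qed

lemma coset_smult:
  assumes "Module.module QQ M" "submodule H QQ M" "x \<in> carrier M" "y \<in> H +>\<^bsub>M\<^esub> x"
  shows "H +>\<^bsub>M\<^esub> (q \<odot>\<^bsub>M\<^esub> y) = H +>\<^bsub>M\<^esub> (q \<odot>\<^bsub>M\<^esub> x)"
proof -
  interpret M: Module.module QQ M by fact
  interpret H: submodule H QQ M by fact
  interpret H': abelian_subgroup H M
    using submodule_abelian_subgroup[OF M.module_abelian_group assms(2)] .
  obtain h where h: "h \<in> H" "y = h \<oplus>\<^bsub>M\<^esub> x" using assms(4) by (auto simp: a_r_coset_def')
  have hc: "h \<in> carrier M" using h(1) H'.a_subset by blast
  have "q \<odot>\<^bsub>M\<^esub> y = q \<odot>\<^bsub>M\<^esub> h \<oplus>\<^bsub>M\<^esub> q \<odot>\<^bsub>M\<^esub> x"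
    using h hc assms(3) M.smult_r_distr[of q h x] by simp
  then have "q \<odot>\<^bsub>M\<^esub> y \<in> H +>\<^bsub>M\<^esub> (q \<odot>\<^bsub>M\<^esub> x)"
    using H.smult_closed[of q h] h(1) by (auto simp: a_r_coset_def')
  then show ?thesis
    using H'.a_repr_independence'[of "q \<odot>\<^bsub>M\<^esub> y" "q \<odot>\<^bsub>M\<^esub> x"] M.smult_closed[of q x] assms(3) by simp
qed

lemma quot_mod_smult_coset:
  assumes "Module.module QQ M" "submodule H QQ M" "x \<in> carrier M"
  shows "q \<odot>\<^bsub>quot_mod M H\<^esub> (H +>\<^bsub>M\<^esub> x) = H +>\<^bsub>M\<^esub> (q \<odot>\<^bsub>M\<^esub> x)"
proof -
  interpret M: Module.module QQ M by fact
  interpret H': abelian_subgroup H M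
    using submodule_abelian_subgroup[OF M.module_abelian_group assms(2)] .
  have "x \<in> H +>\<^bsub>M\<^esub> x" using H'.a_rcos_self assms(3) .
  then show ?thesis
    unfolding quot_mod_simps by (rule UN_constant_eq) (use coset_smult[OF assms] in blast)
qed

lemma quot_mod_module:
  assumes M: "Module.module QQ M" and H: "submodule H QQ M"
  shows "Module.module QQ (quot_mod M H)"
proof -
  interpret M: Module.module QQ M by fact
  interpret H': abelian_subgroup H M
    using submodule_abelian_subgroup[OF M.module_abelian_group H] .
  have cosets: "\<exists>x\<in>carrier M. X = H +>\<^bsub>M\<^esub> x" if "X \<in> a_rcosets\<^bsub>M\<^esub> H" for X
    using that by (auto simp: A_RCOSETS_def')
  have sc: "q \<odot>\<^bsub>M\<^esub> x \<in> carrier M" if "x \<in> carrier M" for q x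
    using M.smult_closed[of q x] that by simp
  note s = quot_mod_smult_coset[OF M H]
  show ?thesis
  proof (rule moduleI[OF cring_QQ quot_mod_abelian_group[OF H'.is_abelian_subgroup]])
    fix a b :: rat and X Y
    assume X: "X \<in> carrier (quot_mod M H)"
    then obtain x where x: "x \<in> carrier M" "X = H +>\<^bsub>M\<^esub> x" using cosets by auto
    show "a \<odot>\<^bsub>quot_mod M H\<^esub> X \<in> carrier (quot_mod M H)"
      unfolding x(2) s[OF x(1)] using M.a_rcosetsI[OF H'.a_subset sc[OF x(1)]] by simp
    show "(a \<oplus>\<^bsub>QQ\<^esub> b) \<odot>\<^bsub>quot_mod M H\<^esub> X = a \<odot>\<^bsub>quot_mod M H\<^esub> X \<oplus>\<^bsub>quot_mod M H\<^esub> b \<odot>\<^bsub>quot_mod M H\<^esub> X"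
      using M.smult_l_distr[of a b x] H'.a_rcos_sum[OF sc sc, of x x a b] x(1)
      by (simp only: x(2) s[OF x(1)] QQ_simps UNIV_I quot_mod_simps(3))
    show "(a \<otimes>\<^bsub>QQ\<^esub> b) \<odot>\<^bsub>quot_mod M H\<^esub> X = a \<odot>\<^bsub>quot_mod M H\<^esub> (b \<odot>\<^bsub>quot_mod M H\<^esub> X)"
      using M.smult_assoc1[of a b x] x(1) sc[OF x(1)]
      by (simp only: x(2) s[OF x(1)] s[OF sc[OF x(1)]] QQ_simps UNIV_I)
    show "\<one>\<^bsub>QQ\<^esub> \<odot>\<^bsub>quot_mod M H\<^esub> X = X"
      using M.smult_one[of x] x(1) by (simp only: x(2) s[OF x(1)] QQ_simps UNIV_I)
    assume "Y \<in> carrier (quot_mod M H)"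
    then obtain y where y: "y \<in> carrier M" "Y = H +>\<^bsub>M\<^esub> y" using cosets by auto
    show "a \<odot>\<^bsub>quot_mod M H\<^esub> (X \<oplus>\<^bsub>quot_mod M H\<^esub> Y) =
        a \<odot>\<^bsub>quot_mod M H\<^esub> X \<oplus>\<^bsub>quot_mod M H\<^esub> a \<odot>\<^bsub>quot_mod M H\<^esub> Y"
      using M.smult_r_distr[of a x y] H'.a_rcos_sum[OF x(1) y(1)] x(1) y(1)
        H'.a_rcos_sum[OF sc[OF x(1)] sc[OF y(1)], of a a] s[OF M.add.m_closed[OF x(1) y(1)]]
      by (simp only: x(2) y(2) s[OF x(1)] s[OF y(1)] QQ_simps UNIV_I quot_mod_simps(3))
  qed
qed

lemma mod_span_submodule:
  assumes "Module.module QQ M" "S \<subseteq> carrier M"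
  shows "submodule (mod_span M S) QQ M" "S \<subseteq> mod_span M S"
proof -
  interpret M: Module.module QQ M by fact
  let ?F = "{H. submodule H QQ M \<and> S \<subseteq> H}"
  have c: "carrier M \<in> ?F" using M.carrier_is_submodule assms(2) by simp
  show "submodule (mod_span M S) QQ M"
    unfolding mod_span_def
  proof (rule M.submoduleI)
    show "\<Inter> ?F \<subseteq> carrier M" using c by blast
  qed (use M.submoduleE in \<open>auto simp: submodule_def intro: subgroup.one_closed[of _ "add_monoid M", simplified]\<close>)
  show "S \<subseteq> mod_span M S" unfolding mod_span_def by blast
qed

lemma mod_span_least: "\<lbrakk>submodule H QQ M; S \<subseteq> H\<rbrakk> \<Longrightarrow> mod_span M S \<subseteq> H"
  unfolding mod_span_def by blast

section \<open>Nonassociative polynomials and their evaluation\<close>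

primrec wlen :: "'g word \<Rightarrow> nat"
  where
    "wlen (Gen g) = 1"
  | "wlen (Br u v) = wlen u + wlen v"

lemma wlen_pos: "1 \<le> wlen w"
  by (induction w) auto

text \<open>
  The lower bound \<open>m\<close> on the length of words corresponds to the \<open>m\<close>-th term of the lower central series.
\<close>

definition words :: "'g set \<Rightarrow> ('g \<Rightarrow> int) \<Rightarrow> nat \<Rightarrow> int \<Rightarrow> 'g word set"
  where "words G deg m n = {w. set_word w \<subseteq> G \<and> wdeg deg w = n \<and> m \<le> wlen w}"

definition polys :: "'g set \<Rightarrow> ('g \<Rightarrow> int) \<Rightarrow> nat \<Rightarrow> int \<Rightarrow> ('g word \<Rightarrow>\<^sub>0 rat) set"
  where "polys G deg m n = {p. Poly_Mapping.keys p \<subseteq> words G deg m n}"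

lemma words_antimono: "m \<le> m' \<Longrightarrow> words G deg m' n \<subseteq> words G deg m n"
  by (auto simp: words_def)

lemma polys_antimono: "m \<le> m' \<Longrightarrow> polys G deg m' n \<subseteq> polys G deg m n"
  using words_antimono by (force simp: polys_def)

lemma words_0_1: "words G deg 0 n = words G deg 1 n"
  using wlen_pos by (auto simp: words_def)

lemma nonassoc_simps [simp]:
  "sp (free_nonassoc G deg) n = nonassoc_mod G deg n"
  "brk (free_nonassoc G deg) n m = wprod"
  "carrier (nonassoc_mod G deg n) = polys G deg 0 n"
  "x \<oplus>\<^bsub>nonassoc_mod G deg n\<^esub> y = x + y"
  "\<zero>\<^bsub>nonassoc_mod G deg n\<^esub> = 0"
  "q \<odot>\<^bsub>nonassoc_mod G deg n\<^esub> x = Poly_Mapping.map ((*) q) x"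
  by (auto simp: free_nonassoc_def nonassoc_mod_def polys_def words_def)

lemma lookup_scale [simp]:
  "Poly_Mapping.lookup (Poly_Mapping.map ((*) q) p) u = (q :: rat) * Poly_Mapping.lookup p u"
  by (simp add: Poly_Mapping.map.rep_eq when_def)

lemma scale_laws:
  fixes p r :: "'b \<Rightarrow>\<^sub>0 rat"
  shows "Poly_Mapping.map ((*) a) (p + r) = Poly_Mapping.map ((*) a) p + Poly_Mapping.map ((*) a) r"
    and "Poly_Mapping.map ((*) (a + b)) p = Poly_Mapping.map ((*) a) p + Poly_Mapping.map ((*) b) p"
    and "Poly_Mapping.map ((*) (a * b)) p = Poly_Mapping.map ((*) a) (Poly_Mapping.map ((*) b) p)"
    and "Poly_Mapping.map ((*) 1) p = p"
    and "Poly_Mapping.map ((*) (-1)) p = - p"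
  by (rule poly_mapping_eqI, simp add: lookup_add algebra_simps)+

lemma keys_scale: "Poly_Mapping.keys (Poly_Mapping.map ((*) (q::rat)) p) \<subseteq> Poly_Mapping.keys p"
  by (auto simp: in_keys_iff)

lemma polys_closed:
  "0 \<in> polys G deg m n"
  "\<lbrakk>p \<in> polys G deg m n; r \<in> polys G deg m n\<rbrakk> \<Longrightarrow> p + r \<in> polys G deg m n"
  "p \<in> polys G deg m n \<Longrightarrow> Poly_Mapping.map ((*) q) p \<in> polys G deg m n"
  "p \<in> polys G deg m n \<Longrightarrow> - p \<in> polys G deg m n"
  "\<lbrakk>p \<in> polys G deg m n; r \<in> polys G deg m n\<rbrakk> \<Longrightarrow> p - r \<in> polys G deg m n"
proof -
  show add: "p + r \<in> polys G deg m n" if "p \<in> polys G deg m n" "r \<in> polys G deg m n" for p r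
    using that Poly_Mapping.keys_add[of p r] by (auto simp: polys_def)
  show sc: "Poly_Mapping.map ((*) q) p \<in> polys G deg m n" if "p \<in> polys G deg m n" for p q
    using that keys_scale[of q p] by (auto simp: polys_def)
  show um: "- p \<in> polys G deg m n" if "p \<in> polys G deg m n" for p
    using sc[OF that, of "-1"] by (simp add: scale_laws)
  show "p - r \<in> polys G deg m n" if "p \<in> polys G deg m n" "r \<in> polys G deg m n"
    using add[OF that(1) um[OF that(2)]] by simp
qed (simp add: polys_def)

lemma single_in_polys: "u \<in> words G deg m n \<Longrightarrow> Poly_Mapping.single u c \<in> polys G deg m n"
  by (auto simp: polys_def)

lemma poly_induct [consumes 1, case_names zero single add]:
  assumes "p \<in> polys G deg m n"
    and "P 0"
    and "\<And>u c. u \<in> words G deg m n \<Longrightarrow> P (Poly_Mapping.single u c)"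
    and "\<And>p r. \<lbrakk>p \<in> polys G deg m n; r \<in> polys G deg m n; P p; P r\<rbrakk> \<Longrightarrow> P (p + r)"
  shows "P p"
proof -
  let ?m = "\<lambda>u. Poly_Mapping.single u (Poly_Mapping.lookup p u)"
  have "K \<subseteq> words G deg m n \<Longrightarrow> sum ?m K \<in> polys G deg m n \<and> P (sum ?m K)"
    if "finite K" for K
    using that
  proof (induction K)
    case empty
    then show ?case using assms(2) by (simp add: polys_closed)
  next
    case (insert u K)
    then show ?case using assms(3,4) by (simp add: polys_closed single_in_polys)
  qed
  moreover have "sum ?m (Poly_Mapping.keys p) = p"
    by (rule poly_mapping_eqI)
      (simp add: lookup_sum lookup_single when_def in_keys_iff)
  ultimately show ?thesis using assms(1) by (metis finite_keys mem_Collect_eq polys_def)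
qed

lemma wprod_superset:
  assumes "finite S" "finite T" "Poly_Mapping.keys p \<subseteq> S" "Poly_Mapping.keys r \<subseteq> T"
  shows "wprod p r = (\<Sum>u\<in>S. \<Sum>v\<in>T.
    Poly_Mapping.single (Br u v) (Poly_Mapping.lookup p u * Poly_Mapping.lookup r v))"
proof -
  have "wprod p r = (\<Sum>u\<in>Poly_Mapping.keys p. \<Sum>v\<in>T.
      Poly_Mapping.single (Br u v) (Poly_Mapping.lookup p u * Poly_Mapping.lookup r v))"
    unfolding wprod_def using assms by (intro sum.cong sum.mono_neutral_left) (auto simp: in_keys_iff)
  also have "\<dots> = (\<Sum>u\<in>S. \<Sum>v\<in>T.
      Poly_Mapping.single (Br u v) (Poly_Mapping.lookup p u * Poly_Mapping.lookup r v))"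
    using assms by (intro sum.mono_neutral_left) (auto simp: in_keys_iff)
  finally show ?thesis .
qed

lemma wprod_add_left: "wprod (p + p') r = wprod p r + wprod p' r"
proof -
  let ?S = "Poly_Mapping.keys p \<union> Poly_Mapping.keys p'" and ?T = "Poly_Mapping.keys r"
  have "wprod q r = (\<Sum>u\<in>?S. \<Sum>v\<in>?T.
      Poly_Mapping.single (Br u v) (Poly_Mapping.lookup q u * Poly_Mapping.lookup r v))"
    if "Poly_Mapping.keys q \<subseteq> ?S" for q
    using that by (intro wprod_superset) auto
  then show ?thesis
    using Poly_Mapping.keys_add[of p p']
    by (simp add: lookup_add distrib_right single_add sum.distrib)
qed

lemma wprod_add_right: "wprod p (r + r') = wprod p r + wprod p r'"
proof -
  let ?T = "Poly_Mapping.keys r \<union> Poly_Mapping.keys r'" and ?S = "Poly_Mapping.keys p"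
  have "wprod p q = (\<Sum>u\<in>?S. \<Sum>v\<in>?T.
      Poly_Mapping.single (Br u v) (Poly_Mapping.lookup p u * Poly_Mapping.lookup q v))"
    if "Poly_Mapping.keys q \<subseteq> ?T" for q
    using that by (intro wprod_superset) auto
  then show ?thesis
    using Poly_Mapping.keys_add[of r r']
    by (simp add: lookup_add distrib_left single_add sum.distrib)
qed

lemma wprod_single:
  "wprod (Poly_Mapping.single u a) (Poly_Mapping.single v b) = Poly_Mapping.single (Br u v) (a * b)"
  by (subst wprod_superset[of "{u}" "{v}"]) auto

lemma wprod_zero [simp]: "wprod 0 r = 0" "wprod p 0 = 0"
  by (simp_all add: wprod_def)

lemma wprod_diff: "wprod (p - p') r = wprod p r - wprod p' r" "wprod p (r - r') = wprod p r - wprod p r'"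
proof -
  show "wprod (p - p') r = wprod p r - wprod p' r"
    using wprod_add_left[of "p - p'" p' r] by simp
  show "wprod p (r - r') = wprod p r - wprod p r'"
    using wprod_add_right[of p "r - r'" r'] by simp
qed

lemma wprod_in_polys:
  assumes "p \<in> polys G deg a n" "r \<in> polys G deg b m"
  shows "wprod p r \<in> polys G deg (a + b) (n + m)"
  using assms(1)
proof (induction rule: poly_induct)
  case (single u c)
  show ?case using assms(2)
  proof (induction rule: poly_induct)
    case (single v e)
    then show ?case using \<open>u \<in> _\<close>
      unfolding wprod_single by (intro single_in_polys) (auto simp: words_def)
  qed (simp_all add: polys_closed wprod_add_right)
qed (simp_all add: polys_closed wprod_add_left)

lemma nonassoc_module: "Module.module QQ (nonassoc_mod G deg n)"
proof (rule moduleI[OF cring_QQ])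
  show "abelian_group (nonassoc_mod G deg n)"
  proof (rule abelian_groupI)
    fix x assume x: "x \<in> carrier (nonassoc_mod G deg n)"
    show "\<exists>y\<in>carrier (nonassoc_mod G deg n). y \<oplus>\<^bsub>nonassoc_mod G deg n\<^esub> x = \<zero>\<^bsub>nonassoc_mod G deg n\<^esub>"
      using x by (intro bexI[of _ "- x"]) (auto simp: polys_closed)
  qed (auto simp: polys_closed algebra_simps)
qed (auto simp: polys_closed scale_laws)

primrec ev :: "('a, 'm) gla_scheme \<Rightarrow> ('g \<Rightarrow> int) \<Rightarrow> ('g \<Rightarrow> 'a) \<Rightarrow> 'g word \<Rightarrow> 'a"
  where
    "ev A deg f (Gen g) = f g"
  | "ev A deg f (Br u v) = brk A (wdeg deg u) (wdeg deg v) (ev A deg f u) (ev A deg f v)"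

definition evp :: "('a, 'm) gla_scheme \<Rightarrow> ('g \<Rightarrow> int) \<Rightarrow> ('g \<Rightarrow> 'a) \<Rightarrow> int \<Rightarrow> ('g word \<Rightarrow>\<^sub>0 rat) \<Rightarrow> 'a"
  where "evp A deg f n p =
    finsum (sp A n) (\<lambda>u. Poly_Mapping.lookup p u \<odot>\<^bsub>sp A n\<^esub> ev A deg f u) (Poly_Mapping.keys p)"

text \<open>
  A choice of values for the generators in a graded Lie algebra. Evaluation of polynomials is linear, turns the
  product of words into the bracket and kills the relations.
\<close>

locale gen_values = graded_lie_algebra A for A :: "('a, 'm) gla_scheme" +
  fixes G :: "'g set" and deg :: "'g \<Rightarrow> int" and f :: "'g \<Rightarrow> 'a"
  assumes f_closed: "g \<in> G \<Longrightarrow> f g \<in> elts A (deg g)"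
begin

lemma ev_closed: "set_word u \<subseteq> G \<Longrightarrow> ev A deg f u \<in> elts A (wdeg deg u)"
  by (induction u) (auto simp: f_closed)

lemma ev_words: "u \<in> words G deg m n \<Longrightarrow> ev A deg f u \<in> elts A n"
  using ev_closed by (auto simp: words_def)

lemma evp_superset:
  assumes "finite S" "Poly_Mapping.keys p \<subseteq> S" "S \<subseteq> words G deg m n"
  shows "evp A deg f n p = finsum (sp A n) (\<lambda>u. Poly_Mapping.lookup p u \<odot>\<^bsub>sp A n\<^esub> ev A deg f u) S"
  unfolding evp_def
proof (rule sp.add.finprod_mono_neutral_cong_left)
  show "\<And>i. i \<in> S - Poly_Mapping.keys p \<Longrightarrow>
      Poly_Mapping.lookup p i \<odot>\<^bsub>sp A n\<^esub> ev A deg f i = \<zero>\<^bsub>sp A n\<^esub>"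
    using assms ev_words by (auto simp: in_keys_iff)
qed (use assms ev_words in auto)

lemma evp_closed [simp, intro]: "p \<in> polys G deg m n \<Longrightarrow> evp A deg f n p \<in> elts A n"
  unfolding evp_def using ev_words by (intro sp.finsum_closed) (auto simp: polys_def)

lemma evp_zero [simp]: "evp A deg f n 0 = \<zero>\<^bsub>sp A n\<^esub>"
  by (simp add: evp_def)

lemma evp_single: "u \<in> words G deg m n \<Longrightarrow> evp A deg f n (Poly_Mapping.single u c) = c \<odot>\<^bsub>sp A n\<^esub> ev A deg f u"
  using evp_superset[of "{u}" "Poly_Mapping.single u c" m n] ev_words[of u m n]
  by simp

lemma evp_add:
  assumes "p \<in> polys G deg m n" "r \<in> polys G deg m n"
  shows "evp A deg f n (p + r) = evp A deg f n p \<oplus>\<^bsub>sp A n\<^esub> evp A deg f n r"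
proof -
  let ?S = "Poly_Mapping.keys p \<union> Poly_Mapping.keys r"
  let ?t = "\<lambda>q u. Poly_Mapping.lookup q u \<odot>\<^bsub>sp A n\<^esub> ev A deg f u"
  have S: "finite ?S" "?S \<subseteq> words G deg m n" using assms by (auto simp: polys_def)
  have c: "?t q \<in> ?S \<rightarrow> elts A n" for q using S ev_words by blast
  have "evp A deg f n (p + r) = finsum (sp A n) (?t (p + r)) ?S"
    using S Poly_Mapping.keys_add[of p r] by (intro evp_superset[where m = m]) auto
  also have "\<dots> = finsum (sp A n) (\<lambda>u. ?t p u \<oplus>\<^bsub>sp A n\<^esub> ?t r u) ?S"
    using S ev_words c by (intro sp.finsum_cong') (auto simp: lookup_add smult_add_left)
  also have "\<dots> = finsum (sp A n) (?t p) ?S \<oplus>\<^bsub>sp A n\<^esub> finsum (sp A n) (?t r) ?S"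
    by (rule sp.finsum_addf[OF c c])
  also have "finsum (sp A n) (?t p) ?S = evp A deg f n p"
    using S by (intro evp_superset[where m = m, symmetric]) auto
  also have "finsum (sp A n) (?t r) ?S = evp A deg f n r"
    using S by (intro evp_superset[where m = m, symmetric]) auto
  finally show ?thesis .
qed

lemma evp_scale:
  assumes "p \<in> polys G deg m n"
  shows "evp A deg f n (Poly_Mapping.map ((*) q) p) = q \<odot>\<^bsub>sp A n\<^esub> evp A deg f n p"
  using assms
proof (induction rule: poly_induct)
  case zero
  then show ?case by (simp add: scale_laws poly_mapping_eqI[of "Poly_Mapping.map ((*) q) 0" 0])
next
  case (single u c)
  have "Poly_Mapping.map ((*) q) (Poly_Mapping.single u c) = Poly_Mapping.single u (q * c)"
    by (rule poly_mapping_eqI) (simp add: lookup_single when_def)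
  then show ?case using single ev_words[OF single] by (simp add: evp_single smult_smult)
next
  case (add p r)
  then show ?case using evp_closed
    by (simp add: scale_laws evp_add[where m = m] polys_closed smult_add_right)
qed

lemma evp_diff:
  assumes "p \<in> polys G deg m n" "r \<in> polys G deg m n"
  shows "evp A deg f n (p - r) = evp A deg f n p \<ominus>\<^bsub>sp A n\<^esub> evp A deg f n r"
proof -
  have "p - r = p + Poly_Mapping.map ((*) (-1)) r" by (simp add: scale_laws)
  then show ?thesis
    using assms evp_closed
    by (simp only: evp_add polys_closed evp_scale smult_neg_1 a_minus_def)
qed

lemma evp_wprod:
  assumes "p \<in> polys G deg a n" "r \<in> polys G deg b m"
  shows "evp A deg f (n + m) (wprod p r) = brk A n m (evp A deg f n p) (evp A deg f m r)"
  using assms(1)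
proof (induction rule: poly_induct)
  case zero
  show ?case using evp_closed[OF assms(2)] by simp
next
  case (single u c)
  show ?case using assms(2)
  proof (induction rule: poly_induct)
    case zero
    show ?case using evp_closed[OF single_in_polys[OF single]] by simp
  next
    case (single v e)
    have w: "Br u v \<in> words G deg (a + b) (n + m)" using single \<open>u \<in> _\<close> by (auto simp: words_def)
    have d: "wdeg deg u = n" "wdeg deg v = m" using single \<open>u \<in> _\<close> by (auto simp: words_def)
    show ?case
      using ev_words[OF single] ev_words[OF \<open>u \<in> _\<close>]
      by (simp add: wprod_single evp_single[OF w] evp_single[OF \<open>u \<in> _\<close>] evp_single[OF single] d
          brk_smult_left brk_smult_right smult_smult mult.commute)
  next
    case (add r r')
    then show ?case
      using evp_closed[OF single_in_polys[OF single]] single_in_polys[OF single]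
        wprod_in_polys[OF single_in_polys[OF single]]
      by (simp add: wprod_add_right evp_add[where m = "a + b"] evp_add[where m = b] brk_add_right evp_closed)
  qed
next
  case (add p p')
  then show ?case
    using wprod_in_polys[OF _ assms(2)] evp_closed[OF assms(2)]
    by (simp add: wprod_add_left evp_add[where m = "a + b"] evp_add[where m = a] brk_add_left evp_closed)
qed

end

lemma lie_ideal_in_polys: "lie_ideal G deg n p \<Longrightarrow> p \<in> polys G deg 0 n"
proof (induction rule: lie_ideal.induct)
  case (antisym p n r m)
  then show ?case using wprod_in_polys[of p G deg 0 n r 0 m] wprod_in_polys[of r G deg 0 m p 0 n]
    by (simp add: polys_closed add.commute)
next
  case (jacobi p n r m s l)
  then have "wprod p (wprod r s) \<in> polys G deg 0 (n + m + l)" "wprod (wprod p r) s \<in> polys G deg 0 (n + m + l)"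
    "wprod r (wprod p s) \<in> polys G deg 0 (n + m + l)"
    using wprod_in_polys[of _ G deg 0 _ _ 0]
    by (simp_all) (metis add.assoc add.left_commute add_0)+
  then show ?case by (simp add: polys_closed)
next
  case (left r m n p)
  then show ?case using wprod_in_polys[of r G deg 0 m p 0 n] by simp
next
  case (right n p r m)
  then show ?case using wprod_in_polys[of p G deg 0 n r 0 m] by simp
qed (auto simp: polys_closed)

lemma (in gen_values) evp_lie_ideal:
  "lie_ideal G deg n p \<Longrightarrow> evp A deg f n p = \<zero>\<^bsub>sp A n\<^esub>"
proof (induction rule: lie_ideal.induct)
  case (antisym p n r m)
  then have p: "p \<in> polys G deg 0 n" and r: "r \<in> polys G deg 0 m" by auto
  have w: "wprod p r \<in> polys G deg 0 (n + m)" "wprod r p \<in> polys G deg 0 (n + m)"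
    using wprod_in_polys[OF p r] wprod_in_polys[OF r p] by (simp_all add: add.commute)
  have e: "evp A deg f (n + m) (wprod r p) = brk A m n (evp A deg f m r) (evp A deg f n p)"
    using evp_wprod[OF r p] by (simp add: add.commute)
  have c: "brk A m n (evp A deg f m r) (evp A deg f n p) \<in> elts A (n + m)"
    using brk_closed[of "evp A deg f m r" m "evp A deg f n p" n] p r by (simp add: evp_closed add.commute)
  let ?s = "(- 1) powi (n * m) :: rat"
  let ?y = "brk A m n (evp A deg f m r) (evp A deg f n p)"
  have "evp A deg f (n + m) (wprod p r + Poly_Mapping.map ((*) ?s) (wprod r p)) =
      brk A n m (evp A deg f n p) (evp A deg f m r) \<oplus>\<^bsub>sp A (n + m)\<^esub> ?s \<odot>\<^bsub>sp A (n + m)\<^esub> ?y"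
    using w by (simp add: evp_add[where m = 0] polys_closed evp_scale[where m = 0] e evp_wprod[OF p r])
  also have "brk A n m (evp A deg f n p) (evp A deg f m r) = (- ?s) \<odot>\<^bsub>sp A (n + m)\<^esub> ?y"
    using p r by (intro antisymmetry) auto
  also have "(- ?s) \<odot>\<^bsub>sp A (n + m)\<^esub> ?y \<oplus>\<^bsub>sp A (n + m)\<^esub> ?s \<odot>\<^bsub>sp A (n + m)\<^esub> ?y = \<zero>\<^bsub>sp A (n + m)\<^esub>"
    using smult_add_left[OF c, of "- ?s" ?s] c by simp
  finally show ?case .
next
  case (jacobi p n r m s l)
  then have p: "p \<in> polys G deg 0 n" and r: "r \<in> polys G deg 0 m" and s: "s \<in> polys G deg 0 l" by auto
  let ?p = "evp A deg f n p" and ?r = "evp A deg f m r" and ?s = "evp A deg f l s"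
  let ?N = "sp A (n + m + l)"
  let ?g = "(- 1) powi (n * m) :: rat"
  have c: "?p \<in> elts A n" "?r \<in> elts A m" "?s \<in> elts A l" using p r s by auto
  have w: "wprod p r \<in> polys G deg 0 (n + m)" "wprod r s \<in> polys G deg 0 (m + l)"
    "wprod p s \<in> polys G deg 0 (n + l)"
    using wprod_in_polys[OF p r] wprod_in_polys[OF r s] wprod_in_polys[OF p s] by simp_all
  have ww: "wprod p (wprod r s) \<in> polys G deg 0 (n + m + l)"
    "wprod (wprod p r) s \<in> polys G deg 0 (n + m + l)"
    "wprod r (wprod p s) \<in> polys G deg 0 (n + m + l)"
    using wprod_in_polys[OF p w(2)] wprod_in_polys[OF w(1) s] wprod_in_polys[OF r w(3)]
    by (simp_all add: ac_simps)
  have e1: "evp A deg f (n + m + l) (wprod p (wprod r s)) = brk A n (m + l) ?p (brk A m l ?r ?s)"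
    using evp_wprod[OF p w(2)] evp_wprod[OF r s] by (simp add: add.assoc)
  have e2: "evp A deg f (n + m + l) (wprod (wprod p r) s) = brk A (n + m) l (brk A n m ?p ?r) ?s"
    using evp_wprod[OF w(1) s] evp_wprod[OF p r] by simp
  have e3: "evp A deg f (n + m + l) (wprod r (wprod p s)) = brk A m (n + l) ?r (brk A n l ?p ?s)"
    using evp_wprod[OF r w(3)] evp_wprod[OF p s] by (simp add: ac_simps)
  have cc: "brk A (n + m) l (brk A n m ?p ?r) ?s \<in> elts A (n + m + l)"
    "brk A m (n + l) ?r (brk A n l ?p ?s) \<in> elts A (n + m + l)"
    using brk_closed[OF brk_closed[OF c(1,2)] c(3)] brk_closed[OF c(2) brk_closed[OF c(1,3)]]
    by (simp_all add: ac_simps)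
  have "evp A deg f (n + m + l) (wprod p (wprod r s) - wprod (wprod p r) s
      - Poly_Mapping.map ((*) ?g) (wprod r (wprod p s))) =
      (brk A n (m + l) ?p (brk A m l ?r ?s) \<ominus>\<^bsub>?N\<^esub> brk A (n + m) l (brk A n m ?p ?r) ?s) \<ominus>\<^bsub>?N\<^esub>
      ?g \<odot>\<^bsub>?N\<^esub> brk A m (n + l) ?r (brk A n l ?p ?s)"
    using ww by (simp add: evp_diff[where m = 0] polys_closed evp_scale[where m = 0] e1 e2 e3)
  also have "\<dots> = \<zero>\<^bsub>?N\<^esub>"
    using graded_lie_algebra.jacobi[OF graded_lie_algebra_axioms, of ?p n ?r m ?s l] c cc
    by (simp add: sp.minus_decompose(4,6) sp.a_comm[of "brk A (n + m) l (brk A n m ?p ?r) ?s"])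
  finally show ?case .
next
  case (add n p r)
  then show ?case by (simp add: evp_add[where m = 0] lie_ideal_in_polys)
next
  case (scale n p q)
  then show ?case by (simp add: evp_scale[where m = 0] lie_ideal_in_polys)
next
  case (left r m n p)
  then show ?case using evp_closed[of r 0 m] by (simp add: evp_wprod[of r 0 m p 0 n] lie_ideal_in_polys)
next
  case (right n p r m)
  then show ?case using evp_closed[of r 0 m] by (simp add: evp_wprod[of p 0 n r 0 m] lie_ideal_in_polys)
qed simp

section \<open>Polynomial representatives in complete free Lie algebras\<close>

abbreviation relations :: "'g set \<Rightarrow> ('g \<Rightarrow> int) \<Rightarrow> int \<Rightarrow> ('g word \<Rightarrow>\<^sub>0 rat) set"
  where "relations G deg n \<equiv> {p. lie_ideal G deg n p}"

abbreviation poly_class :: "'g set \<Rightarrow> ('g \<Rightarrow> int) \<Rightarrow> int \<Rightarrow> ('g word \<Rightarrow>\<^sub>0 rat) \<Rightarrow> ('g word \<Rightarrow>\<^sub>0 rat) set"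
  where "poly_class G deg n p \<equiv> relations G deg n +>\<^bsub>nonassoc_mod G deg n\<^esub> p"

lemma lie_ideal_uminus: "lie_ideal G deg n p \<Longrightarrow> lie_ideal G deg n (- p)"
  using lie_ideal.scale[of G deg n p "-1"] by (simp add: scale_laws)

lemma lie_ideal_diff: "\<lbrakk>lie_ideal G deg n p; lie_ideal G deg n q\<rbrakk> \<Longrightarrow> lie_ideal G deg n (p - q)"
  using lie_ideal.add[OF _ lie_ideal_uminus] by fastforce

lemma relations_submodule: "submodule (relations G deg n) QQ (nonassoc_mod G deg n)"
proof -
  interpret N: Module.module QQ "nonassoc_mod G deg n" by (rule nonassoc_module)
  have um: "\<ominus>\<^bsub>nonassoc_mod G deg n\<^esub> p = - p" if "p \<in> polys G deg 0 n" for p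
    using that by (intro N.minus_equality) (auto simp: polys_closed)
  show ?thesis
    using lie_ideal.zero lie_ideal.add lie_ideal.scale
    by (intro N.submoduleI) (auto simp: lie_ideal_in_polys um lie_ideal_uminus)
qed

lemma sp_free_lie: "sp (free_lie G deg) n = quot_mod (nonassoc_mod G deg n) (relations G deg n)"
  by (simp add: free_lie_def quot_gla_def)

lemma free_lie_module: "Module.module QQ (sp (free_lie G deg) n)"
  unfolding sp_free_lie by (rule quot_mod_module[OF nonassoc_module relations_submodule])

lemma mem_poly_class: "q \<in> poly_class G deg n p \<longleftrightarrow> lie_ideal G deg n (q - p)"
  by (auto simp: a_r_coset_def' intro!: exI[of _ "q - p"])

lemma poly_class_eq:
  assumes "lie_ideal G deg n (q - p)" shows "poly_class G deg n q = poly_class G deg n p"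
proof -
  have "lie_ideal G deg n (r - q) \<longleftrightarrow> lie_ideal G deg n (r - p)" for r
    using lie_ideal.add[OF _ assms, of "r - q"] lie_ideal_diff[OF _ assms, of "r - p"] by auto
  then show ?thesis by (auto simp: mem_poly_class)
qed

lemma elts_free_lie: "X \<in> elts (free_lie G deg) n \<longleftrightarrow> (\<exists>p\<in>polys G deg 0 n. X = poly_class G deg n p)"
  by (auto simp: sp_free_lie A_RCOSETS_def')

lemma free_lie_representative:
  assumes "X \<in> elts (free_lie G deg) n" "p \<in> X"
  shows "p \<in> polys G deg 0 n" "X = poly_class G deg n p"
proof -
  obtain r where r: "r \<in> polys G deg 0 n" "X = poly_class G deg n r"
    using assms(1) elts_free_lie by blast
  then have l: "lie_ideal G deg n (p - r)" using assms(2) mem_poly_class by blast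
  show "p \<in> polys G deg 0 n" using polys_closed(2)[OF lie_ideal_in_polys[OF l] r(1)] by simp
  show "X = poly_class G deg n p" using poly_class_eq[OF l] r by simp
qed

lemma poly_class_self: "p \<in> poly_class G deg n p"
  by (simp add: mem_poly_class lie_ideal.zero)

lemma elts_free_lieI: "p \<in> polys G deg 0 n \<Longrightarrow> poly_class G deg n p \<in> elts (free_lie G deg) n"
  using elts_free_lie by blast

lemma free_lie_nonempty: "X \<in> elts (free_lie G deg) n \<Longrightarrow> \<exists>p. p \<in> X"
  using poly_class_self unfolding elts_free_lie by blast

lemma free_lie_add_mem: "\<lbrakk>p \<in> X; r \<in> Y\<rbrakk> \<Longrightarrow> p + r \<in> X \<oplus>\<^bsub>sp (free_lie G deg) n\<^esub> Y"
  by (auto simp: sp_free_lie set_add_def')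

lemma free_lie_smult_mem: "p \<in> X \<Longrightarrow> Poly_Mapping.map ((*) q) p \<in> q \<odot>\<^bsub>sp (free_lie G deg) n\<^esub> X"
  using poly_class_self by (fastforce simp: sp_free_lie)

lemma free_lie_brk_mem: "\<lbrakk>p \<in> X; r \<in> Y\<rbrakk> \<Longrightarrow> wprod p r \<in> brk (free_lie G deg) n m X Y"
  using poly_class_self by (fastforce simp: free_lie_def quot_gla_def)

lemma lie_ideal_wprod_cong:
  assumes "p \<in> polys G deg 0 n" "r' \<in> polys G deg 0 m"
    and "lie_ideal G deg n (p - p')" "lie_ideal G deg m (r - r')"
  shows "lie_ideal G deg (n + m) (wprod p r - wprod p' r')"
proof -
  have "wprod p r - wprod p' r' = wprod p (r - r') + wprod (p - p') r'"
    by (simp add: wprod_diff)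
  moreover have "lie_ideal G deg (n + m) (wprod p (r - r'))" "lie_ideal G deg (n + m) (wprod (p - p') r')"
    using lie_ideal.left[of p G deg n m] lie_ideal.right[of G deg n _ r' m] assms by auto
  ultimately show ?thesis using lie_ideal.add by metis
qed

lemma free_lie_brk:
  assumes "X \<in> elts (free_lie G deg) n" "Y \<in> elts (free_lie G deg) m" "p \<in> X" "r \<in> Y"
  shows "brk (free_lie G deg) n m X Y = poly_class G deg (n + m) (wprod p r)"
proof -
  have "poly_class G deg (n + m) (wprod p' r') = poly_class G deg (n + m) (wprod p r)"
    if "p' \<in> X" "r' \<in> Y" for p' r'
  proof (rule poly_class_eq, rule lie_ideal_wprod_cong)
    show "p' \<in> polys G deg 0 n" "r \<in> polys G deg 0 m"
      using free_lie_representative(1)[OF assms(1) that(1)] free_lie_representative(1)[OF assms(2,4)] .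
    show "lie_ideal G deg n (p' - p)" "lie_ideal G deg m (r' - r)"
      using free_lie_representative(2)[OF assms(1,3)] free_lie_representative(2)[OF assms(2,4)]
        that mem_poly_class by blast+
  qed
  note eq = this
  have "(\<Union>r'\<in>Y. poly_class G deg (n + m) (wprod p' r')) = poly_class G deg (n + m) (wprod p r)"
    if "p' \<in> X" for p'
    by (rule UN_constant_eq[OF assms(4)]) (intro ballI eq that)
  then have "(\<Union>p'\<in>X. \<Union>r'\<in>Y. poly_class G deg (n + m) (wprod p' r')) =
      poly_class G deg (n + m) (wprod p r)"
    by (intro UN_constant_eq[OF assms(3)] ballI)
  then show ?thesis by (simp add: free_lie_def quot_gla_def)
qed

lemma free_lie_brk_closed:
  assumes "X \<in> elts (free_lie G deg) n" "Y \<in> elts (free_lie G deg) m"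
  shows "brk (free_lie G deg) n m X Y \<in> elts (free_lie G deg) (n + m)"
proof -
  obtain p r where pr: "p \<in> X" "r \<in> Y" using assms free_lie_nonempty by blast
  then have "wprod p r \<in> polys G deg 0 (n + m)"
    using wprod_in_polys[of p G deg 0 n r 0 m] free_lie_representative(1)[OF assms(1) pr(1)]
      free_lie_representative(1)[OF assms(2) pr(2)] by simp
  then show ?thesis using free_lie_brk[OF assms pr] elts_free_lieI by simp
qed

text \<open>
  An element of the \<open>k\<close>-th term of the lower central series is represented by a combination of
  words of length at least \<open>k\<close>: such classes form a submodule, and it contains the brackets
  that span the term.
\<close>

lemma lower_central_long:
  "submodule (lower_central (free_lie G deg) (Suc k) n) QQ (sp (free_lie G deg) n) \<and>
    lower_central (free_lie G deg) (Suc k) n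
      \<subseteq> {X \<in> elts (free_lie G deg) n. \<exists>p\<in>X. p \<in> polys G deg (Suc k) n}"
proof (induction k arbitrary: n)
  case 0
  interpret F: Module.module QQ "sp (free_lie G deg) n" by (rule free_lie_module)
  have "\<exists>p\<in>X. p \<in> polys G deg (Suc 0) n" if X: "X \<in> elts (free_lie G deg) n" for X
  proof -
    obtain p where p: "p \<in> X" using free_lie_nonempty[OF X] ..
    have "p \<in> polys G deg (Suc 0) n"
      using free_lie_representative(1)[OF X p] by (simp add: polys_def words_0_1)
    with p show ?thesis ..
  qed
  then show ?case using F.carrier_is_submodule by auto
next
  case (Suc k)
  let ?F = "free_lie G deg"
  interpret F: Module.module QQ "sp ?F n" by (rule free_lie_module)
  let ?S = "{brk ?F m (n - m) x y | m x y. x \<in> elts ?F m \<and> y \<in> lower_central ?F (Suc k) (n - m)}"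
  let ?T = "{X \<in> elts ?F n. \<exists>p\<in>X. p \<in> polys G deg (Suc (Suc k)) n}"
  have ST: "?S \<subseteq> ?T"
  proof clarify
    fix m x y assume x: "x \<in> elts ?F m" and y: "y \<in> lower_central ?F (Suc k) (n - m)"
    obtain r where r: "y \<in> elts ?F (n - m)" "r \<in> y" "r \<in> polys G deg (Suc k) (n - m)"
      using Suc.IH y by blast
    obtain p where p: "p \<in> polys G deg 1 m" "x = poly_class G deg m p"
      using x unfolding elts_free_lie by (auto simp: polys_def words_0_1)
    have "wprod p r \<in> polys G deg (Suc (Suc k)) n"
      using wprod_in_polys[OF p(1) r(3)] by simp
    moreover have "wprod p r \<in> brk ?F m (n - m) x y" by (rule free_lie_brk_mem[OF _ r(2)]) (simp add: p(2) poly_class_self)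
    ultimately show "brk ?F m (n - m) x y \<in> elts ?F n \<and>
        (\<exists>q\<in>brk ?F m (n - m) x y. q \<in> polys G deg (Suc (Suc k)) n)"
      using free_lie_brk_closed[OF x r(1)] by auto
  qed
  have T: "submodule ?T QQ (sp ?F n)"
  proof (rule F.submoduleI)
    show "\<zero>\<^bsub>sp ?F n\<^esub> \<in> ?T"
      using F.zero_closed lie_ideal.zero[of G deg n] by (auto simp: sp_free_lie polys_closed)
    have sm: "q \<odot>\<^bsub>sp ?F n\<^esub> X \<in> ?T" if X: "X \<in> ?T" for X q
    proof -
      obtain p where "p \<in> X" "p \<in> polys G deg (Suc (Suc k)) n" using X by blast
      then have "Poly_Mapping.map ((*) q) p \<in> q \<odot>\<^bsub>sp ?F n\<^esub> X"
        "Poly_Mapping.map ((*) q) p \<in> polys G deg (Suc (Suc k)) n"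
        using free_lie_smult_mem by (auto simp: polys_closed)
      then show ?thesis using F.smult_closed[of q X] X by auto
    qed
    then show "q \<odot>\<^bsub>sp ?F n\<^esub> X \<in> ?T" if "X \<in> ?T" for X q using that .
    show "\<ominus>\<^bsub>sp ?F n\<^esub> X \<in> ?T" if "X \<in> ?T" for X
      using sm[OF that, of "-1"] that module_QQ_smult_minus_one[OF free_lie_module, of X] by simp
    show "X \<oplus>\<^bsub>sp ?F n\<^esub> Y \<in> ?T" if XY: "X \<in> ?T" "Y \<in> ?T" for X Y
    proof -
      obtain p r where "p \<in> X" "p \<in> polys G deg (Suc (Suc k)) n" "r \<in> Y" "r \<in> polys G deg (Suc (Suc k)) n"
        using XY by blast
      then have "p + r \<in> X \<oplus>\<^bsub>sp ?F n\<^esub> Y" "p + r \<in> polys G deg (Suc (Suc k)) n"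
        using free_lie_add_mem by (auto simp: polys_closed)
      then show ?thesis using F.add.m_closed[of X Y] XY by auto
    qed
  qed auto
  have "?S \<subseteq> elts ?F n" using ST by blast
  then show ?case
    using mod_span_submodule(1)[OF free_lie_module] mod_span_least[OF T ST] by simp
qed

text \<open>
  The polynomials representing the \<open>k\<close>-th entry of an element of the completion; they determine
  that element modulo \<open>F\<^sub>k\<^sub>+\<^sub>1\<close>.
\<close>

definition rep :: "'g cfl \<Rightarrow> nat \<Rightarrow> ('g word \<Rightarrow>\<^sub>0 rat) set"
  where "rep \<xi> k = \<Union> (\<xi> k)"

lemma sp_complete_free_lie:
  "sp (complete_free_lie G deg dd) n =
    inv_limit (sp (free_lie G deg) n) (\<lambda>k. lower_central (free_lie G deg) k n)"
  by (simp add: complete_free_lie_def Let_def completion_def)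

lemma elts_complete_free_lie:
  "\<xi> \<in> elts (complete_free_lie G deg dd) n \<longleftrightarrow>
    (\<forall>k. \<xi> k \<in> a_rcosets\<^bsub>sp (free_lie G deg) n\<^esub> lower_central (free_lie G deg) (Suc k) n \<and>
      \<xi> (Suc k) \<subseteq> \<xi> k)"
  by (simp add: sp_complete_free_lie inv_limit_def)

lemma fil_complete_free_lie:
  "\<xi> \<in> fil (complete_free_lie G deg dd) (Suc k) n \<longleftrightarrow>
    \<xi> \<in> elts (complete_free_lie G deg dd) n \<and> \<xi> k = lower_central (free_lie G deg) (Suc k) n"
  by (simp add: complete_free_lie_def Let_def completion_fil_def)

lemma lower_central_subgroup:
  "abelian_subgroup (lower_central (free_lie G deg) (Suc k) n) (sp (free_lie G deg) n)"
proof -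
  interpret F: Module.module QQ "sp (free_lie G deg) n" by (rule free_lie_module)
  show ?thesis using submodule_abelian_subgroup[OF F.module_abelian_group] lower_central_long by blast
qed

text \<open>
  The operations on the completion are computed on representatives of representatives, so polynomials representing the
  entries can be combined directly.
\<close>

lemma rep_add:
  assumes "p \<in> rep \<xi> k" "r \<in> rep \<eta> k"
  shows "p + r \<in> rep (\<xi> \<oplus>\<^bsub>sp (complete_free_lie G deg dd) n\<^esub> \<eta>) k"
proof -
  obtain X Y where "X \<in> \<xi> k" "Y \<in> \<eta> k" "p \<in> X" "r \<in> Y" using assms by (auto simp: rep_def)
  then have "X \<oplus>\<^bsub>sp (free_lie G deg) n\<^esub> Y \<in> (\<xi> \<oplus>\<^bsub>sp (complete_free_lie G deg dd) n\<^esub> \<eta>) k"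
    by (auto simp: sp_complete_free_lie inv_limit_def set_add_def')
  then show ?thesis using free_lie_add_mem[OF \<open>p \<in> X\<close> \<open>r \<in> Y\<close>] by (auto simp: rep_def)
qed

lemma lower_central_coset_mem:
  assumes "p \<in> Z" shows "p \<in> \<Union> (lower_central (free_lie G deg) (Suc k) n +>\<^bsub>sp (free_lie G deg) n\<^esub> Z)"
proof -
  interpret S: abelian_subgroup "lower_central (free_lie G deg) (Suc k) n" "sp (free_lie G deg) n"
    by (rule lower_central_subgroup)
  have "\<zero>\<^bsub>sp (free_lie G deg) n\<^esub> \<oplus>\<^bsub>sp (free_lie G deg) n\<^esub> Z
      \<in> lower_central (free_lie G deg) (Suc k) n +>\<^bsub>sp (free_lie G deg) n\<^esub> Z"
    using S.zero_closed by (auto simp: a_r_coset_def')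
  moreover have "0 + p \<in> \<zero>\<^bsub>sp (free_lie G deg) n\<^esub> \<oplus>\<^bsub>sp (free_lie G deg) n\<^esub> Z"
    using assms by (intro free_lie_add_mem) (auto simp: sp_free_lie lie_ideal.zero)
  ultimately show ?thesis by auto
qed

lemma rep_smult:
  assumes "p \<in> rep \<xi> k"
  shows "Poly_Mapping.map ((*) q) p \<in> rep (q \<odot>\<^bsub>sp (complete_free_lie G deg dd) n\<^esub> \<xi>) k"
proof -
  obtain X where "X \<in> \<xi> k" "p \<in> X" using assms by (auto simp: rep_def)
  moreover have "Poly_Mapping.map ((*) q) p \<in> \<Union> (lower_central (free_lie G deg) (Suc k) n
      +>\<^bsub>sp (free_lie G deg) n\<^esub> (q \<odot>\<^bsub>sp (free_lie G deg) n\<^esub> X))"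
    by (rule lower_central_coset_mem[OF free_lie_smult_mem[OF \<open>p \<in> X\<close>]])
  ultimately show ?thesis
    by (auto simp: rep_def sp_complete_free_lie inv_limit_def)
qed

lemma rep_brk:
  assumes "p \<in> rep \<xi> k" "r \<in> rep \<eta> k"
  shows "wprod p r \<in> rep (brk (complete_free_lie G deg dd) n m \<xi> \<eta>) k"
proof -
  obtain X Y where "X \<in> \<xi> k" "Y \<in> \<eta> k" "p \<in> X" "r \<in> Y" using assms by (auto simp: rep_def)
  moreover have "wprod p r \<in> \<Union> (lower_central (free_lie G deg) (Suc k) (n + m)
      +>\<^bsub>sp (free_lie G deg) (n + m)\<^esub> brk (free_lie G deg) n m X Y)"
    by (rule lower_central_coset_mem[OF free_lie_brk_mem[OF \<open>p \<in> X\<close> \<open>r \<in> Y\<close>]])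
  ultimately show ?thesis
    by (auto simp: rep_def complete_free_lie_def Let_def completion_def)
qed

lemma rep_gen: "Poly_Mapping.single (Gen g) 1 \<in> rep (cfl_gen G deg g) k"
  unfolding rep_def cfl_gen_def by (rule lower_central_coset_mem[OF poly_class_self])

text \<open>
  An entry is a coset of the lower central series in the free Lie algebra, which itself consists of cosets of relations.
  Hence two polynomials representing it differ by a relation and a combination of long words, and a shared
  representative makes two entries equal.
\<close>

lemma
  assumes \<xi>: "\<xi> \<in> elts (complete_free_lie G deg dd) n"
  shows rep_nonempty: "\<exists>p. p \<in> rep \<xi> k"
    and rep_in_polys: "p \<in> rep \<xi> k \<Longrightarrow> p \<in> polys G deg 0 n"
    and rep_diff: "\<lbrakk>p \<in> rep \<xi> k; r \<in> rep \<xi> k\<rbrakk> \<Longrightarrow>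
      \<exists>q\<in>polys G deg (Suc k) n. lie_ideal G deg n (p - r - q)"
    and rep_cong: "\<lbrakk>\<eta> \<in> elts (complete_free_lie G deg dd) n; p \<in> rep \<xi> k; p \<in> rep \<eta> k\<rbrakk> \<Longrightarrow> \<xi> k = \<eta> k"
    and rep_Suc: "rep \<xi> (Suc k) \<subseteq> rep \<xi> k"
proof -
  let ?F = "free_lie G deg" and ?H = "lower_central (free_lie G deg) (Suc k) n"
  interpret F: Module.module QQ "sp ?F n" by (rule free_lie_module)
  interpret S: abelian_subgroup ?H "sp ?F n" by (rule lower_central_subgroup)
  have coset: "\<exists>Z\<in>elts ?F n. \<zeta> k = ?H +>\<^bsub>sp ?F n\<^esub> Z"
    if "\<zeta> \<in> elts (complete_free_lie G deg dd) n" for \<zeta>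
    using that unfolding elts_complete_free_lie A_RCOSETS_def' by fast
  have mem: "X \<in> elts ?F n" if "\<zeta> \<in> elts (complete_free_lie G deg dd) n" "X \<in> \<zeta> k" for \<zeta> X
    using coset[OF that(1)] that(2) S.a_elemrcos_carrier by metis
  obtain Z where Z: "Z \<in> elts ?F n" "\<xi> k = ?H +>\<^bsub>sp ?F n\<^esub> Z" using coset[OF \<xi>] by blast
  obtain z where z: "z \<in> Z" using free_lie_nonempty[OF Z(1)] by blast
  show "\<exists>p. p \<in> rep \<xi> k" using lower_central_coset_mem[OF z, where G = G and deg = deg and k = k and n = n] Z(2) by (auto simp: rep_def)
  show "p \<in> polys G deg 0 n" if "p \<in> rep \<xi> k" for p
    using that free_lie_representative(1)[OF mem[OF \<xi>]] unfolding rep_def by blast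
  show "rep \<xi> (Suc k) \<subseteq> rep \<xi> k" using \<xi> by (auto simp: rep_def elts_complete_free_lie)
  show "\<xi> k = \<eta> k" if \<eta>: "\<eta> \<in> elts (complete_free_lie G deg dd) n" and p: "p \<in> rep \<xi> k" "p \<in> rep \<eta> k" for p \<eta>
  proof -
    obtain X Y where XY: "X \<in> \<xi> k" "p \<in> X" "Y \<in> \<eta> k" "p \<in> Y" using p by (auto simp: rep_def)
    have "X = Y"
      using free_lie_representative(2)[OF mem[OF \<xi> XY(1)] XY(2)]
        free_lie_representative(2)[OF mem[OF \<eta> XY(3)] XY(4)] by simp
    obtain W where W: "W \<in> elts ?F n" "\<eta> k = ?H +>\<^bsub>sp ?F n\<^esub> W" using coset[OF \<eta>] by blast
    show ?thesis
      using S.a_repr_independence'[of X Z] S.a_repr_independence'[of Y W] XY Z W \<open>X = Y\<close> by simp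
  qed
  show "\<exists>q\<in>polys G deg (Suc k) n. lie_ideal G deg n (p - r - q)"
    if pr: "p \<in> rep \<xi> k" "r \<in> rep \<xi> k" for p r
  proof -
    obtain X Y where XY: "X \<in> \<xi> k" "p \<in> X" "Y \<in> \<xi> k" "r \<in> Y" using pr by (auto simp: rep_def)
    have c: "X \<in> elts ?F n" "Y \<in> elts ?F n" using mem[OF \<xi>] XY by blast+
    have "X \<in> ?H +>\<^bsub>sp ?F n\<^esub> Y"
      using S.a_repr_independence'[of Y Z] XY Z by simp
    then obtain h where h: "h \<in> ?H" "X = h \<oplus>\<^bsub>sp ?F n\<^esub> Y" by (auto simp: a_r_coset_def')
    obtain q where q: "q \<in> h" "q \<in> polys G deg (Suc k) n" using h(1) lower_central_long by blast
    have "q + r \<in> X" using free_lie_add_mem[OF q(1) XY(4)] h(2) by simp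
    then have "lie_ideal G deg n (p - (q + r))"
      using free_lie_representative(2)[OF c(1)] XY(2) mem_poly_class by blast
    then show ?thesis using q(2) by (auto simp: algebra_simps)
  qed
qed

lemma rep_antimono:
  assumes "\<xi> \<in> elts (complete_free_lie G deg dd) n" "k \<le> j" shows "\<xi> j \<subseteq> \<xi> k"
  using assms(2)
proof (induction j)
  case (Suc j)
  then show ?case using assms(1) elts_complete_free_lie[of \<xi> G deg dd n] by (cases "k = Suc j") auto
qed simp

lemma fil_long_rep:
  assumes "\<xi> \<in> fil (complete_free_lie G deg dd) (Suc k) n" "k \<le> j"
  shows "\<exists>p\<in>rep \<xi> j. p \<in> polys G deg (Suc k) n"
proof -
  have \<xi>: "\<xi> \<in> elts (complete_free_lie G deg dd) n"
    "\<xi> k = lower_central (free_lie G deg) (Suc k) n"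
    using assms(1) fil_complete_free_lie by blast+
  obtain p where "p \<in> rep \<xi> j" using rep_nonempty[OF \<xi>(1)] by blast
  then obtain X where X: "X \<in> \<xi> j" by (auto simp: rep_def)
  then have "X \<in> lower_central (free_lie G deg) (Suc k) n" using rep_antimono[OF \<xi>(1) assms(2)] \<xi>(2) by blast
  then obtain q where "q \<in> X" "q \<in> polys G deg (Suc k) n" using lower_central_long by blast
  then show ?thesis using X by (auto simp: rep_def)
qed

lemma lower_central_descending:
  "lower_central (free_lie G deg) (Suc (Suc k)) n \<subseteq> lower_central (free_lie G deg) (Suc k) n"
proof (induction k arbitrary: n)
  case 0
  then show ?case using lower_central_long[of G deg "Suc 0" n] by auto
next
  case (Suc k)
  let ?F = "free_lie G deg"
  let ?S = "\<lambda>k. {brk ?F m (n - m) x y | m x y. x \<in> elts ?F m \<and> y \<in> lower_central ?F (Suc k) (n - m)}"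
  have "brk ?F m (n - m) x y \<in> elts ?F n"
    if "x \<in> elts ?F m" "y \<in> lower_central ?F (Suc k) (n - m)" for m x y
    using free_lie_brk_closed[of x G deg m y "n - m"] lower_central_long[of G deg k "n - m"] that by auto
  then have "?S k \<subseteq> elts ?F n" by blast
  then have "?S k \<subseteq> lower_central ?F (Suc (Suc k)) n"
    using mod_span_submodule(2)[OF free_lie_module, of "?S k" G deg n] by simp
  moreover have "?S (Suc k) \<subseteq> ?S k"
  proof (rule subsetI)
    fix z assume "z \<in> ?S (Suc k)"
    then obtain m x y where "z = brk ?F m (n - m) x y" "x \<in> elts ?F m"
      "y \<in> lower_central ?F (Suc (Suc k)) (n - m)" by (elim CollectE exE conjE)
    then show "z \<in> ?S k" using subsetD[OF Suc.IH] by (intro CollectI exI conjI)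
  qed
  ultimately have "?S (Suc k) \<subseteq> lower_central ?F (Suc (Suc k)) n" by (rule subset_trans[rotated])
  then show ?case
    unfolding lower_central.simps(3)[of ?F "Suc k" n]
    by (rule mod_span_least[OF conjunct1[OF lower_central_long]])
qed

locale complete_free = complete_dg_lie_algebra "complete_free_lie G deg dd"
  for G :: "'g set" and deg :: "'g \<Rightarrow> int" and dd :: "int \<Rightarrow> 'g cfl \<Rightarrow> 'g cfl"
begin

abbreviation "C \<equiv> complete_free_lie G deg dd"
abbreviation "gen \<equiv> cfl_gen G deg"

lemma fcong_if_entry_eq:
  assumes "\<xi> \<in> elts C n" "\<eta> \<in> elts C n" "\<xi> k = \<eta> k"
  shows "fcong C (Suc k) n \<xi> \<eta>"
proof -
  let ?H = "lower_central (free_lie G deg) (Suc k) n"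
  let ?z = "\<xi> \<ominus>\<^bsub>sp C n\<^esub> \<eta>"
  have z: "?z \<in> elts C n" "?z \<oplus>\<^bsub>sp C n\<^esub> \<eta> = \<xi>"
    using assms sp.minus_decompose(5) by auto
  interpret Q: abelian_group "quot_mod (sp (free_lie G deg) n) ?H"
    by (rule quot_mod_abelian_group[OF lower_central_subgroup])
  have c: "?z k \<in> carrier (quot_mod (sp (free_lie G deg) n) ?H)"
    "\<eta> k \<in> carrier (quot_mod (sp (free_lie G deg) n) ?H)"
    using z(1) assms(2) by (simp_all only: elts_complete_free_lie quot_mod_simps)
  have "\<xi> k = ?z k \<oplus>\<^bsub>quot_mod (sp (free_lie G deg) n) ?H\<^esub> \<eta> k"
    by (subst z(2)[symmetric]) (simp add: sp_complete_free_lie inv_limit_def)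
  then have "?z k = ?H"
    using Q.add.r_cancel_one[OF c(2) c(1)] assms(3) by simp
  then show ?thesis using assms z(1) by (simp add: fcong_def fil_complete_free_lie)
qed

lemma gen_closed:
  assumes "g \<in> G" shows "gen g \<in> elts C (deg g)"
proof -
  let ?F = "free_lie G deg" and ?n = "deg g"
  let ?X = "poly_class G deg ?n (Poly_Mapping.single (Gen g) 1)"
  interpret F: Module.module QQ "sp ?F ?n" by (rule free_lie_module)
  have "Gen g \<in> words G deg 0 ?n" using assms by (simp add: words_def)
  then have X: "?X \<in> elts ?F ?n" by (intro elts_free_lieI single_in_polys)
  have "lower_central ?F (Suc k) ?n +>\<^bsub>sp ?F ?n\<^esub> ?X \<in> a_rcosets\<^bsub>sp ?F ?n\<^esub> lower_central ?F (Suc k) ?n" for k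
    using X lower_central_long[of G deg k ?n] by (intro F.a_rcosetsI) blast+
  moreover have "lower_central ?F (Suc (Suc k)) ?n +>\<^bsub>sp ?F ?n\<^esub> ?X
      \<subseteq> lower_central ?F (Suc k) ?n +>\<^bsub>sp ?F ?n\<^esub> ?X" for k
    using lower_central_descending[of G deg k ?n] unfolding a_r_coset_def' by blast
  ultimately show ?thesis
    unfolding elts_complete_free_lie cfl_gen_def by blast
qed

end

section \<open>Morphisms out of a complete free Lie algebra\<close>

text \<open>
  Continuous linear maps of degree \<open>e\<close>. Degree \<open>-1\<close> accounts for differentials, so that \<open>\<phi> \<circ> d\<close> and \<open>d \<circ> \<phi>\<close> can be
  compared in the same way as two morphisms.
\<close>

definition cont_linear ::
    "('a, 'm) cdgl_scheme \<Rightarrow> ('b, 'k) cdgl_scheme \<Rightarrow> int \<Rightarrow> (int \<Rightarrow> 'a \<Rightarrow> 'b) \<Rightarrow> bool"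
  where "cont_linear A B e \<alpha> \<longleftrightarrow>
    (\<forall>n. Q_linear (sp A n) (sp B (n + e)) (\<alpha> n)) \<and>
    (\<forall>k\<ge>1. \<exists>m\<ge>1. \<forall>n. \<alpha> n ` fil A m n \<subseteq> fil B k (n + e))"

definition lie_morphism ::
    "('a, 'm) cdgl_scheme \<Rightarrow> ('b, 'k) cdgl_scheme \<Rightarrow> (int \<Rightarrow> 'a \<Rightarrow> 'b) \<Rightarrow> bool"
  where "lie_morphism A B f \<longleftrightarrow> cont_linear A B 0 f \<and>
    (\<forall>n m. \<forall>x\<in>elts A n. \<forall>y\<in>elts A m. f (n + m) (brk A n m x y) = brk B n m (f n x) (f m y))"

lemma cdgl_morphism_iff:
  "cdgl_morphism A B f \<longleftrightarrow>
    lie_morphism A B f \<and> (\<forall>n. \<forall>x\<in>elts A n. f (n - 1) (dif A n x) = dif B n (f n x))"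
  by (auto simp: cdgl_morphism_def lie_morphism_def cont_linear_def)

lemma lie_morphism_cont: "lie_morphism A B f \<Longrightarrow> cont_linear A B 0 f"
  by (simp add: lie_morphism_def)

lemma lie_morphism_linear: "lie_morphism A B f \<Longrightarrow> Q_linear (sp A n) (sp B n) (f n)"
  by (simp add: lie_morphism_def cont_linear_def)

lemma lie_morphism_closed: "\<lbrakk>lie_morphism A B f; x \<in> elts A n\<rbrakk> \<Longrightarrow> f n x \<in> elts B n"
  using Q_linear_closed[OF lie_morphism_linear] by metis

lemma lie_morphism_brk:
  "\<lbrakk>lie_morphism A B f; x \<in> elts A n; y \<in> elts A m\<rbrakk> \<Longrightarrow>
    f (n + m) (brk A n m x y) = brk B n m (f n x) (f m y)"
  by (simp add: lie_morphism_def)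

lemma cdgl_morphism_lie: "cdgl_morphism A B f \<Longrightarrow> lie_morphism A B f"
  by (simp add: cdgl_morphism_iff)

lemma cdgl_morphism_dif:
  "\<lbrakk>cdgl_morphism A B f; x \<in> elts A n\<rbrakk> \<Longrightarrow> f (n - 1) (dif A n x) = dif B n (f n x)"
  by (simp add: cdgl_morphism_iff)

lemma cont_linear_comp:
  assumes "cont_linear A B e f" "cont_linear B D e' g"
  shows "cont_linear A D (e + e') (\<lambda>n x. g (n + e) (f n x))"
  unfolding cont_linear_def
proof (intro conjI allI impI)
  fix n
  show "Q_linear (sp A n) (sp D (n + (e + e'))) (\<lambda>x. g (n + e) (f n x))"
  proof (rule Q_linear_comp[where N = "sp B (n + e)" and f = "f n" and g = "g (n + e)"])
    show "Q_linear (sp A n) (sp B (n + e)) (f n)" using assms(1) by (simp add: cont_linear_def)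
    have "Q_linear (sp B (n + e)) (sp D (n + e + e')) (g (n + e))"
      using assms(2) unfolding cont_linear_def by blast
    then show "Q_linear (sp B (n + e)) (sp D (n + (e + e'))) (g (n + e))" by (simp add: add.assoc)
  qed
next
  fix k :: nat assume "1 \<le> k"
  then obtain m where m: "1 \<le> m" "\<And>n. g n ` fil B m n \<subseteq> fil D k (n + e')"
    using assms(2) unfolding cont_linear_def by blast
  then obtain m' where m': "1 \<le> m'" "\<And>n. f n ` fil A m' n \<subseteq> fil B m (n + e)"
    using assms(1) unfolding cont_linear_def by blast
  have "(\<lambda>x. g (n + e) (f n x)) ` fil A m' n \<subseteq> fil D k (n + (e + e'))" for n
    using m(2)[of "n + e"] m'(2)[of n] by (auto simp: add.assoc)
  with m'(1) show "\<exists>m\<ge>1. \<forall>n. (\<lambda>x. g (n + e) (f n x)) ` fil A m n \<subseteq> fil D k (n + (e + e'))" by blast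
qed

lemma lie_morphism_comp:
  assumes "lie_morphism A B f" "lie_morphism B D g"
  shows "lie_morphism A D (\<lambda>n x. g n (f n x))"
proof -
  have "cont_linear A D 0 (\<lambda>n x. g n (f n x))"
    using cont_linear_comp[OF lie_morphism_cont[OF assms(1)] lie_morphism_cont[OF assms(2)]] by simp
  then show ?thesis
    using lie_morphism_closed[OF assms(1)]
    by (simp add: lie_morphism_def[of A D] lie_morphism_brk[OF assms(1)] lie_morphism_brk[OF assms(2)])
qed

lemma cdgl_morphism_comp:
  assumes "cdgl_morphism A B f" "cdgl_morphism B D g"
  shows "cdgl_morphism A D (\<lambda>n x. g n (f n x))"
  using assms lie_morphism_closed[of A B f] lie_morphism_comp[of A B f D g]
  by (simp add: cdgl_morphism_iff)

lemma cdgl_morphism_comp_morphism: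
  "\<lbrakk>cdgl_morphism A B f; cdgl_morphism B D g\<rbrakk> \<Longrightarrow> cdgl_morphism A D (comp_morphism g f)"
  using cdgl_morphism_comp[of A B f D g] by (simp add: comp_morphism_def comp_def)

lemma cont_linear_dif:
  assumes "complete_dg_lie_algebra L" shows "cont_linear L L (-1) (dif L)"
proof -
  interpret complete_dg_lie_algebra L by fact
  have "\<exists>m\<ge>1. \<forall>n. dif L n ` fil L m n \<subseteq> fil L k (n - 1)" if "1 \<le> k" for k
    using fil_dif that by blast
  then show ?thesis using dif_linear by (simp add: cont_linear_def)
qed

lemma lie_morphism_ops:
  assumes "lie_morphism A B f" "complete_dg_lie_algebra A" "complete_dg_lie_algebra B"
  shows "f n \<zero>\<^bsub>sp A n\<^esub> = \<zero>\<^bsub>sp B n\<^esub>"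
    and "\<lbrakk>x \<in> elts A n; y \<in> elts A n\<rbrakk> \<Longrightarrow> f n (x \<oplus>\<^bsub>sp A n\<^esub> y) = f n x \<oplus>\<^bsub>sp B n\<^esub> f n y"
    and "\<lbrakk>x \<in> elts A n; y \<in> elts A n\<rbrakk> \<Longrightarrow> f n (x \<ominus>\<^bsub>sp A n\<^esub> y) = f n x \<ominus>\<^bsub>sp B n\<^esub> f n y"
    and "x \<in> elts A n \<Longrightarrow> f n (\<ominus>\<^bsub>sp A n\<^esub> x) = \<ominus>\<^bsub>sp B n\<^esub> f n x"
    and "x \<in> elts A n \<Longrightarrow> f n (q \<odot>\<^bsub>sp A n\<^esub> x) = q \<odot>\<^bsub>sp B n\<^esub> f n x"
proof -
  interpret A: complete_dg_lie_algebra A by fact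
  interpret B: complete_dg_lie_algebra B by fact
  note l = lie_morphism_linear[OF assms(1), of n]
  note m = A.sp_module[of n] B.sp_module[of n]
  show "f n \<zero>\<^bsub>sp A n\<^esub> = \<zero>\<^bsub>sp B n\<^esub>" by (rule Q_linear_zero[OF l m])
  show "\<lbrakk>x \<in> elts A n; y \<in> elts A n\<rbrakk> \<Longrightarrow> f n (x \<oplus>\<^bsub>sp A n\<^esub> y) = f n x \<oplus>\<^bsub>sp B n\<^esub> f n y"
    by (rule Q_linear_add[OF l])
  show "\<lbrakk>x \<in> elts A n; y \<in> elts A n\<rbrakk> \<Longrightarrow> f n (x \<ominus>\<^bsub>sp A n\<^esub> y) = f n x \<ominus>\<^bsub>sp B n\<^esub> f n y"
    by (rule Q_linear_minus[OF l m])
  show "x \<in> elts A n \<Longrightarrow> f n (\<ominus>\<^bsub>sp A n\<^esub> x) = \<ominus>\<^bsub>sp B n\<^esub> f n x"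
    by (rule Q_linear_uminus[OF l m])
  show "x \<in> elts A n \<Longrightarrow> f n (q \<odot>\<^bsub>sp A n\<^esub> x) = q \<odot>\<^bsub>sp B n\<^esub> f n x"
    by (rule Q_linear_smult[OF l])
qed

lemma cont_linear_fcong:
  assumes "complete_dg_lie_algebra A" "complete_dg_lie_algebra B" "cont_linear A B e \<alpha>" "1 \<le> k"
  shows "\<exists>m\<ge>1. \<forall>n x y. fcong A m n x y \<longrightarrow> fcong B k (n + e) (\<alpha> n x) (\<alpha> n y)"
proof -
  interpret A: complete_dg_lie_algebra A by fact
  interpret B: complete_dg_lie_algebra B by fact
  have l: "Q_linear (sp A n) (sp B (n + e)) (\<alpha> n)" for n using assms(3) by (simp add: cont_linear_def)
  obtain m where m: "1 \<le> m" "\<And>n. \<alpha> n ` fil A m n \<subseteq> fil B k (n + e)"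
    using assms(3,4) unfolding cont_linear_def by blast
  have "fcong B k (n + e) (\<alpha> n x) (\<alpha> n y)" if "fcong A m n x y" for n x y
    using that m(2)[of n] Q_linear_minus[OF l A.sp_module B.sp_module, of x n y] Q_linear_closed[OF l]
    by (force simp: fcong_def)
  with m(1) show ?thesis by blast
qed

text \<open>
  For a Lie morphism \<open>\<phi>\<close>, both \<open>\<phi> \<circ> d\<close> and \<open>d \<circ> \<phi>\<close> are derivations along \<open>\<phi>\<close>.
\<close>

lemma dif_commute_brk_fcong:
  assumes CC: "complete_dg_lie_algebra C" and A: "complete_dg_lie_algebra A"
    and \<phi>: "lie_morphism C A \<phi>" and k: "1 \<le> k" and x: "x \<in> elts C n" and y: "y \<in> elts C m"
    and cx: "fcong A k (n - 1) (\<phi> (n - 1) (dif C n x)) (dif A n (\<phi> n x))"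
    and cy: "fcong A k (m - 1) (\<phi> (m - 1) (dif C m y)) (dif A m (\<phi> m y))"
  shows "fcong A (Suc k) (n + m - 1) (\<phi> (n + m - 1) (dif C (n + m) (brk C n m x y)))
    (dif A (n + m) (\<phi> (n + m) (brk C n m x y)))"
proof -
  interpret A: complete_dg_lie_algebra A by fact
  interpret C: complete_dg_lie_algebra C by fact
  let ?\<alpha> = "\<lambda>n x. \<phi> (n - 1) (dif C n x)" and ?\<beta> = "\<lambda>n x. dif A n (\<phi> n x)"
  have fx: "\<phi> n x \<in> elts A n" and fy: "\<phi> m y \<in> elts A m"
    using lie_morphism_closed[OF \<phi>] x y by auto
  have "fcong A (Suc k) (n - 1 + m) (brk A (n - 1) m (?\<alpha> n x) (\<phi> m y)) (brk A (n - 1) m (?\<beta> n x) (\<phi> m y))"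
    using A.fcong_brk[OF k, of "n - 1"] cx A.fcong_refl[OF k fy] by simp
  moreover have "n - 1 + m = n + m - 1" "n + (m - 1) = n + m - 1" by auto
  ultimately have c1: "fcong A (Suc k) (n + m - 1) (brk A (n - 1) m (?\<alpha> n x) (\<phi> m y)) (brk A (n - 1) m (?\<beta> n x) (\<phi> m y))"
    by simp
  have "fcong A (Suc k) (n + (m - 1)) (brk A n (m - 1) (\<phi> n x) (?\<alpha> m y)) (brk A n (m - 1) (\<phi> n x) (?\<beta> m y))"
    using A.fcong_brk[OF k, of n] cy A.fcong_refl[OF k fx] by simp
  then have c2: "fcong A (Suc k) (n + m - 1) (brk A n (m - 1) (\<phi> n x) (?\<alpha> m y)) (brk A n (m - 1) (\<phi> n x) (?\<beta> m y))"
    by (simp add: \<open>n + (m - 1) = n + m - 1\<close>)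
  have b1: "brk C (n - 1) m (dif C n x) y \<in> elts C (n + m - 1)"
    using C.brk_closed[OF C.dif_closed[OF x] y] by (simp add: \<open>n - 1 + m = n + m - 1\<close>)
  have b2: "brk C n (m - 1) x (dif C m y) \<in> elts C (n + m - 1)"
    using C.brk_closed[OF x C.dif_closed[OF y]] by (simp add: \<open>n + (m - 1) = n + m - 1\<close>)
  have b1': "\<phi> (n + m - 1) (brk C (n - 1) m (dif C n x) y) = brk A (n - 1) m (?\<alpha> n x) (\<phi> m y)"
    using lie_morphism_brk[OF \<phi> C.dif_closed[OF x] y] by (simp add: \<open>n - 1 + m = n + m - 1\<close>)
  have b2': "\<phi> (n + m - 1) (brk C n (m - 1) x (dif C m y)) = brk A n (m - 1) (\<phi> n x) (?\<alpha> m y)"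
    using lie_morphism_brk[OF \<phi> x C.dif_closed[OF y]] by (simp add: \<open>n + (m - 1) = n + m - 1\<close>)
  have "?\<alpha> (n + m) (brk C n m x y) = brk A (n - 1) m (?\<alpha> n x) (\<phi> m y) \<oplus>\<^bsub>sp A (n + m - 1)\<^esub>
      ((-1) powi n) \<odot>\<^bsub>sp A (n + m - 1)\<^esub> brk A n (m - 1) (\<phi> n x) (?\<alpha> m y)"
    using b1 b2 by (simp add: C.dif_derivation[OF x y] lie_morphism_ops[OF \<phi> CC A] b1' b2')
  moreover have "?\<beta> (n + m) (brk C n m x y) = brk A (n - 1) m (?\<beta> n x) (\<phi> m y) \<oplus>\<^bsub>sp A (n + m - 1)\<^esub>
      ((-1) powi n) \<odot>\<^bsub>sp A (n + m - 1)\<^esub> brk A n (m - 1) (\<phi> n x) (?\<beta> m y)"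
    by (simp add: lie_morphism_brk[OF \<phi> x y] A.dif_derivation[OF fx fy])
  ultimately show ?thesis
    using A.fcong_add[OF _ c1 A.fcong_smult[OF _ c2]] by simp
qed

context complete_free
begin

sublocale gv: gen_values C G deg gen
  by unfold_locales (rule gen_closed)

text \<open>
  Evaluating a polynomial at the generators of the completion itself yields the element that it represents.
\<close>

lemma rep_ev: "set_word u \<subseteq> G \<Longrightarrow> Poly_Mapping.single u 1 \<in> rep (ev C deg gen u) k"
proof (induction u)
  case (Gen g)
  then show ?case by (simp add: rep_gen)
next
  case (Br u v)
  then show ?case using rep_brk[of "Poly_Mapping.single u 1" _ k "Poly_Mapping.single v 1"]
    by (auto simp: wprod_single)
qed

lemma rep_evp:
  assumes "p \<in> polys G deg m n" shows "p \<in> rep (evp C deg gen n p) k"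
  using assms
proof (induction rule: poly_induct)
  case zero
  interpret S: abelian_subgroup "lower_central (free_lie G deg) (Suc k) n" "sp (free_lie G deg) n"
    by (rule lower_central_subgroup)
  have "relations G deg n \<in> lower_central (free_lie G deg) (Suc k) n"
    using additive_subgroup.zero_closed[OF S.is_additive_subgroup] by (simp add: sp_free_lie)
  then have "0 \<in> rep (\<zero>\<^bsub>sp C n\<^esub>) k"
    using lie_ideal.zero[of G deg n] by (auto simp: rep_def sp_complete_free_lie inv_limit_def)
  then show ?case by simp
next
  case (single u c)
  have "Poly_Mapping.map ((*) c) (Poly_Mapping.single u 1) = Poly_Mapping.single u c"
    by (rule poly_mapping_eqI) (simp add: lookup_single when_def)
  moreover have "Poly_Mapping.single u 1 \<in> rep (ev C deg gen u) k"
    using single rep_ev by (simp add: words_def)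
  ultimately show ?case
    using rep_smult[of "Poly_Mapping.single u 1" "ev C deg gen u" k c G deg dd n]
    by (simp add: gv.evp_single[OF single])
next
  case (add p r)
  then show ?case using rep_add by (simp add: gv.evp_add[OF add(1,2)])
qed

text \<open>The polynomial \<open>p\<close> represents the \<open>k\<close>-th entry of both sides, so these entries are equal.\<close>

lemma fcong_evp_rep:
  assumes "\<xi> \<in> elts C n" "p \<in> rep \<xi> k"
  shows "fcong C (Suc k) n \<xi> (evp C deg gen n p)"
proof -
  have p: "p \<in> polys G deg 0 n" using rep_in_polys assms by metis
  then show ?thesis
    using assms rep_cong[OF assms(1) gv.evp_closed[OF p] assms(2) rep_evp[OF p]]
    by (intro fcong_if_entry_eq) auto
qed

lemma ex_polynomial_approximation:
  assumes "\<xi> \<in> elts C n" "1 \<le> k"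
  shows "\<exists>p\<in>polys G deg 0 n. fcong C k n \<xi> (evp C deg gen n p)"
proof -
  obtain j where k: "k = Suc j" using assms(2) by (cases k) auto
  obtain p where "p \<in> rep \<xi> j" using rep_nonempty assms(1) by metis
  then show ?thesis using fcong_evp_rep rep_in_polys assms(1) unfolding k by metis
qed

lemma ex_long_polynomial_approximation:
  assumes "\<xi> \<in> fil C (Suc m) n" "Suc m \<le> k"
  shows "\<exists>p\<in>polys G deg (Suc m) n. fcong C k n \<xi> (evp C deg gen n p)"
proof -
  obtain j where k: "k = Suc j" using assms(2) by (cases k) auto
  obtain p where "p \<in> rep \<xi> j" "p \<in> polys G deg (Suc m) n" using fil_long_rep[OF assms(1)] assms(2) k by auto
  moreover have "\<xi> \<in> elts C n" using fil_subset[of "Suc m" n] assms(1) by auto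
  ultimately show ?thesis using fcong_evp_rep unfolding k by metis
qed

text \<open>
  Successive approximation. Suppose that congruence modulo \<open>F\<^sub>k\<close> of the values of \<open>\<alpha>\<close> and \<open>\<beta>\<close> on two
  factors forces congruence modulo \<open>F\<^sub>k\<^sub>+\<^sub>1\<close> on their bracket, as it does for Lie morphisms
  and for derivations along a Lie morphism. Then congruence modulo \<open>F\<^sub>k\<close> spreads from the generators to
  all words, improves by one step on words that are proper brackets, and passes to the limit.
\<close>

lemma approximation_principle:
  fixes A :: "('a, 'm) cdgl_scheme"
  assumes A: "complete_dg_lie_algebra A"
    and \<alpha>: "cont_linear C A e \<alpha>" and \<beta>: "cont_linear C A e \<beta>"
    and k: "1 \<le> k"
    and product: "\<And>n m x y. \<lbrakk>x \<in> elts C n; y \<in> elts C m;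
        fcong A k (n + e) (\<alpha> n x) (\<beta> n x); fcong A k (m + e) (\<alpha> m y) (\<beta> m y)\<rbrakk> \<Longrightarrow>
      fcong A (Suc k) (n + m + e) (\<alpha> (n + m) (brk C n m x y)) (\<beta> (n + m) (brk C n m x y))"
    and generators: "\<And>g. g \<in> G \<Longrightarrow>
      fcong A k (deg g + e) (\<alpha> (deg g) (gen g)) (\<beta> (deg g) (gen g))"
  shows "\<xi> \<in> elts C n \<Longrightarrow> fcong A k (n + e) (\<alpha> n \<xi>) (\<beta> n \<xi>)"
    and "\<xi> \<in> fil C 2 n \<Longrightarrow> fcong A (Suc k) (n + e) (\<alpha> n \<xi>) (\<beta> n \<xi>)"
proof -
  interpret A: complete_dg_lie_algebra A by fact
  have la: "Q_linear (sp C n) (sp A (n + e)) (\<alpha> n)" and lb: "Q_linear (sp C n) (sp A (n + e)) (\<beta> n)" for n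
    using \<alpha> \<beta> by (simp_all add: cont_linear_def)
  let ?E = "ev C deg gen" and ?P = "evp C deg gen"
  have word: "fcong A k (wdeg deg u + e) (\<alpha> (wdeg deg u) (?E u)) (\<beta> (wdeg deg u) (?E u)) \<and>
      (2 \<le> wlen u \<longrightarrow> fcong A (Suc k) (wdeg deg u + e) (\<alpha> (wdeg deg u) (?E u)) (\<beta> (wdeg deg u) (?E u)))"
    if "set_word u \<subseteq> G" for u
    using that
  proof (induction u)
    case (Gen g)
    then show ?case using generators by simp
  next
    case (Br u v)
    then have "fcong A (Suc k) (wdeg deg u + wdeg deg v + e)
        (\<alpha> (wdeg deg u + wdeg deg v) (?E (Br u v))) (\<beta> (wdeg deg u + wdeg deg v) (?E (Br u v)))"
      using product[OF gv.ev_closed gv.ev_closed] by simp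
    then show ?case using A.fcong_mono[of k "Suc k"] k by simp
  qed
  have poly: "fcong A r (n + e) (\<alpha> n (?P n p)) (\<beta> n (?P n p))"
    if p: "p \<in> polys G deg j n" and r: "1 \<le> r"
      and w: "\<And>u. u \<in> words G deg j n \<Longrightarrow> fcong A r (n + e) (\<alpha> n (?E u)) (\<beta> n (?E u))" for r j n p
    using p
  proof (induction rule: poly_induct)
    case zero
    then show ?case
      using A.fcong_refl[OF r] Q_linear_zero[OF la sp_module A.sp_module] Q_linear_zero[OF lb sp_module A.sp_module]
      by simp
  next
    case (single u c)
    then show ?case
      using A.fcong_smult[OF r w[OF single], of c] gv.ev_words[OF single]
      by (simp add: gv.evp_single[OF single] Q_linear_smult[OF la] Q_linear_smult[OF lb])
  next
    case (add p q)
    then show ?case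
      using A.fcong_add[OF r add(3,4)] gv.evp_closed
      by (simp add: gv.evp_add[OF add(1,2)] Q_linear_add[OF la] Q_linear_add[OF lb])
  qed
  have limit: "fcong A r (n + e) (\<alpha> n \<xi>) (\<beta> n \<xi>)"
    if r: "1 \<le> r"
      and ap: "\<And>m. j \<le> m \<Longrightarrow> 1 \<le> m \<Longrightarrow> \<exists>p\<in>polys G deg j n. fcong C m n \<xi> (?P n p)"
      and w: "\<And>u. u \<in> words G deg j n \<Longrightarrow> fcong A r (n + e) (\<alpha> n (?E u)) (\<beta> n (?E u))" for r j n \<xi>
  proof -
    obtain m1 m2 where m: "1 \<le> m1" "\<And>n x y. fcong C m1 n x y \<Longrightarrow> fcong A r (n + e) (\<alpha> n x) (\<alpha> n y)"
      "1 \<le> m2" "\<And>n x y. fcong C m2 n x y \<Longrightarrow> fcong A r (n + e) (\<beta> n x) (\<beta> n y)"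
      using cont_linear_fcong[OF complete_dg_lie_algebra_axioms A \<alpha> r]
        cont_linear_fcong[OF complete_dg_lie_algebra_axioms A \<beta> r] by metis
    define M where "M = Max {m1, m2, j}"
    have M: "m1 \<le> M" "m2 \<le> M" "j \<le> M" "1 \<le> M" using m by (auto simp: M_def)
    obtain p where p: "p \<in> polys G deg j n" "fcong C M n \<xi> (?P n p)" using ap M by blast
    have "fcong A r (n + e) (\<alpha> n \<xi>) (\<alpha> n (?P n p))"
      using m(2)[OF fcong_mono[OF m(1) M(1) p(2)]] .
    moreover have "fcong A r (n + e) (\<beta> n (?P n p)) (\<beta> n \<xi>)"
      using A.fcong_sym[OF r m(4)[OF fcong_mono[OF m(3) M(2) p(2)]]] .
    ultimately show ?thesis using poly[OF p(1) r w] A.fcong_trans[OF r] by blast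
  qed
  show "fcong A k (n + e) (\<alpha> n \<xi>) (\<beta> n \<xi>)" if "\<xi> \<in> elts C n"
  proof (rule limit[OF k])
    show "\<exists>p\<in>polys G deg 0 n. fcong C m n \<xi> (?P n p)" if "1 \<le> m" for m
      by (rule ex_polynomial_approximation[OF \<open>\<xi> \<in> elts C n\<close> that])
    show "fcong A k (n + e) (\<alpha> n (?E u)) (\<beta> n (?E u))" if "u \<in> words G deg 0 n" for u
      using word[of u] that by (simp add: words_def)
  qed
  show "fcong A (Suc k) (n + e) (\<alpha> n \<xi>) (\<beta> n \<xi>)" if "\<xi> \<in> fil C 2 n"
  proof (rule limit)
    show "\<exists>p\<in>polys G deg 2 n. fcong C m n \<xi> (?P n p)" if "2 \<le> m" for m
      using ex_long_polynomial_approximation[of \<xi> 1 n m] \<open>\<xi> \<in> fil C 2 n\<close> that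
      by (simp add: numeral_2_eq_2)
    show "fcong A (Suc k) (n + e) (\<alpha> n (?E u)) (\<beta> n (?E u))" if "u \<in> words G deg 2 n" for u
      using word[of u] that by (simp add: words_def)
  qed simp
qed

lemma
  fixes A :: "('a, 'm) cdgl_scheme"
  assumes A: "complete_dg_lie_algebra A"
    and \<phi>: "lie_morphism C A \<phi>" and \<psi>: "lie_morphism C A \<psi>" and k: "1 \<le> k"
    and generators: "\<And>g. g \<in> G \<Longrightarrow> fcong A k (deg g) (\<phi> (deg g) (gen g)) (\<psi> (deg g) (gen g))"
  shows lie_morphism_fcong: "\<xi> \<in> elts C n \<Longrightarrow> fcong A k n (\<phi> n \<xi>) (\<psi> n \<xi>)"
    and lie_morphism_fcong_Suc: "\<xi> \<in> fil C 2 n \<Longrightarrow> fcong A (Suc k) n (\<phi> n \<xi>) (\<psi> n \<xi>)"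
proof -
  interpret A: complete_dg_lie_algebra A by fact
  have p: "fcong A (Suc k) (n + m + 0) (\<phi> (n + m) (brk C n m x y)) (\<psi> (n + m) (brk C n m x y))"
    if "x \<in> elts C n" "y \<in> elts C m" "fcong A k (n + 0) (\<phi> n x) (\<psi> n x)" "fcong A k (m + 0) (\<phi> m y) (\<psi> m y)"
    for n m x y
    using that A.fcong_brk[OF k] by (simp add: lie_morphism_brk[OF \<phi>] lie_morphism_brk[OF \<psi>])
  have g: "fcong A k (deg g + 0) (\<phi> (deg g) (gen g)) (\<psi> (deg g) (gen g))" if "g \<in> G" for g
    using generators[OF that] by simp
  note ap = approximation_principle[OF A lie_morphism_cont[OF \<phi>] lie_morphism_cont[OF \<psi>] k p g]
  show "\<xi> \<in> elts C n \<Longrightarrow> fcong A k n (\<phi> n \<xi>) (\<psi> n \<xi>)"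
    using ap(1)[of \<xi> n] by (simp only: add_0_right)
  show "\<xi> \<in> fil C 2 n \<Longrightarrow> fcong A (Suc k) n (\<phi> n \<xi>) (\<psi> n \<xi>)"
    using ap(2)[of \<xi> n] by (simp only: add_0_right)
qed

lemma lie_morphism_eqI:
  fixes A :: "('a, 'm) cdgl_scheme"
  assumes A: "complete_dg_lie_algebra A"
    and \<phi>: "lie_morphism C A \<phi>" and \<psi>: "lie_morphism C A \<psi>"
    and generators: "\<And>g. g \<in> G \<Longrightarrow> \<phi> (deg g) (gen g) = \<psi> (deg g) (gen g)"
    and \<xi>: "\<xi> \<in> elts C n"
  shows "\<phi> n \<xi> = \<psi> n \<xi>"
proof -
  interpret A: complete_dg_lie_algebra A by fact
  have "fcong A (Suc k) n (\<phi> n \<xi>) (\<psi> n \<xi>)" for k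
  proof (rule lie_morphism_fcong[OF A \<phi> \<psi> _ _ \<xi>])
    show "fcong A (Suc k) (deg g) (\<phi> (deg g) (gen g)) (\<psi> (deg g) (gen g))" if "g \<in> G" for g
      using A.fcong_refl[OF _ lie_morphism_closed[OF \<psi> gen_closed[OF that]]] generators[OF that] by simp
  qed simp
  then show ?thesis
    by (rule A.eq_if_fcong[OF lie_morphism_closed[OF \<phi> \<xi>] lie_morphism_closed[OF \<psi> \<xi>]])
qed

lemma
  fixes A :: "('a, 'm) cdgl_scheme"
  assumes A: "complete_dg_lie_algebra A" and \<phi>: "lie_morphism C A \<phi>" and k: "1 \<le> k"
    and generators: "\<And>g. g \<in> G \<Longrightarrow>
      fcong A k (deg g - 1) (\<phi> (deg g - 1) (dif C (deg g) (gen g))) (dif A (deg g) (\<phi> (deg g) (gen g)))"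
  shows dif_commute_fcong: "\<xi> \<in> elts C n \<Longrightarrow>
      fcong A k (n - 1) (\<phi> (n - 1) (dif C n \<xi>)) (dif A n (\<phi> n \<xi>))"
    and dif_commute_fcong_Suc: "\<xi> \<in> fil C 2 n \<Longrightarrow>
      fcong A (Suc k) (n - 1) (\<phi> (n - 1) (dif C n \<xi>)) (dif A n (\<phi> n \<xi>))"
proof -
  interpret A: complete_dg_lie_algebra A by fact
  let ?\<alpha> = "\<lambda>n x. \<phi> (n - 1) (dif C n x)" and ?\<beta> = "\<lambda>n x. dif A n (\<phi> n x)"
  note CC = complete_dg_lie_algebra_axioms
  have \<alpha>: "cont_linear C A (-1) ?\<alpha>"
    using cont_linear_comp[OF cont_linear_dif[OF CC] lie_morphism_cont[OF \<phi>]] by simp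
  have \<beta>: "cont_linear C A (-1) ?\<beta>"
    using cont_linear_comp[OF lie_morphism_cont[OF \<phi>] cont_linear_dif[OF A]] by simp
  have p: "fcong A (Suc k) (n + m + - 1) (?\<alpha> (n + m) (brk C n m x y)) (?\<beta> (n + m) (brk C n m x y))"
    if "x \<in> elts C n" "y \<in> elts C m"
      "fcong A k (n + - 1) (?\<alpha> n x) (?\<beta> n x)" "fcong A k (m + - 1) (?\<alpha> m y) (?\<beta> m y)" for n m x y
    using dif_commute_brk_fcong[OF CC A \<phi> k that(1,2)] that(3,4) by simp
  have g: "fcong A k (deg g + - 1) (?\<alpha> (deg g) (gen g)) (?\<beta> (deg g) (gen g))" if "g \<in> G" for g
    using generators[OF that] by simp
  note ap = approximation_principle[OF A \<alpha> \<beta> k p g]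
  show "\<xi> \<in> elts C n \<Longrightarrow> fcong A k (n - 1) (?\<alpha> n \<xi>) (?\<beta> n \<xi>)" using ap(1)[of \<xi> n] by simp
  show "\<xi> \<in> fil C 2 n \<Longrightarrow> fcong A (Suc k) (n - 1) (?\<alpha> n \<xi>) (?\<beta> n \<xi>)" using ap(2)[of \<xi> n] by simp
qed

lemma cdgl_morphismI:
  fixes A :: "('a, 'm) cdgl_scheme"
  assumes A: "complete_dg_lie_algebra A" and \<phi>: "lie_morphism C A \<phi>"
    and generators: "\<And>g. g \<in> G \<Longrightarrow>
      \<phi> (deg g - 1) (dif C (deg g) (gen g)) = dif A (deg g) (\<phi> (deg g) (gen g))"
  shows "cdgl_morphism C A \<phi>"
proof -
  interpret A: complete_dg_lie_algebra A by fact
  have "\<phi> (n - 1) (dif C n \<xi>) = dif A n (\<phi> n \<xi>)" if \<xi>: "\<xi> \<in> elts C n" for n \<xi>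
  proof (rule A.eq_if_fcong)
    show "fcong A (Suc k) (n - 1) (\<phi> (n - 1) (dif C n \<xi>)) (dif A n (\<phi> n \<xi>))" for k
      by (rule dif_commute_fcong[OF A \<phi> _ _ \<xi>])
        (use generators A.fcong_refl lie_morphism_closed[OF \<phi>] gen_closed in auto)
  qed (use \<xi> lie_morphism_closed[OF \<phi>] in auto)
  then show ?thesis using \<phi> by (simp add: cdgl_morphism_iff)
qed

end

lemma evp_fil:
  fixes A :: "('a, 'm) cdgl_scheme"
  assumes A: "complete_dg_lie_algebra A" and f: "\<And>g. g \<in> G \<Longrightarrow> f g \<in> elts A (deg g)"
    and p: "p \<in> polys G deg (Suc k) n"
  shows "evp A deg f n p \<in> fil A (Suc k) n"
proof -
  interpret A: complete_dg_lie_algebra A by fact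
  interpret gen_values A G deg f by unfold_locales (rule f)
  have word: "ev A deg f u \<in> fil A (wlen u) (wdeg deg u)" if "set_word u \<subseteq> G" for u
    using that
  proof (induction u)
    case (Gen g)
    then show ?case using f A.fil_one by simp
  next
    case (Br u v)
    then show ?case using A.fil_brk[OF wlen_pos wlen_pos] by simp
  qed
  have w: "ev A deg f u \<in> fil A (Suc k) n" if "u \<in> words G deg (Suc k) n" for u
    using that word[of u] A.fil_antimono[of "Suc k" "wlen u" n] by (auto simp: words_def)
  show ?thesis using p
  proof (induction rule: poly_induct)
    case zero
    then show ?case using A.fil_mem(1) by simp
  next
    case (single u c)
    then show ?case using A.fil_mem(5)[OF _ w] by (simp add: evp_single[OF single])
  next
    case (add p r)
    then show ?case using A.fil_mem(2) by (simp add: evp_add[OF add(1,2)])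
  qed
qed

text \<open>
  The universal property: the value at \<open>\<xi>\<close> is the limit of the values of the polynomials
  representing the entries of \<open>\<xi>\<close>. These values converge because two representatives of the \<open>k\<close>-th entry
  differ by relations, which evaluate to zero, and by words of length greater than \<open>k\<close>.
\<close>

lemma (in complete_free) ex_lie_morphism:
  fixes A :: "('a, 'm) cdgl_scheme"
  assumes A: "complete_dg_lie_algebra A" and f: "\<And>g. g \<in> G \<Longrightarrow> f g \<in> elts A (deg g)"
  shows "\<exists>\<phi>. lie_morphism C A \<phi> \<and> (\<forall>g\<in>G. \<phi> (deg g) (gen g) = f g)"
proof -
  interpret A: complete_dg_lie_algebra A by fact
  interpret F: gen_values A G deg f by unfold_locales (rule f)
  let ?P = "evp A deg f"
  have c: "?P n p \<in> elts A n" if "\<xi> \<in> elts C n" "p \<in> rep \<xi> k" for \<xi> n p k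
    using F.evp_closed[OF rep_in_polys[OF that]] .
  have wd: "fcong A (Suc k) n (?P n p) (?P n r)"
    if \<xi>: "\<xi> \<in> elts C n" and p: "p \<in> rep \<xi> k" and r: "r \<in> rep \<xi> k" for \<xi> n p r k
  proof -
    obtain q where q: "q \<in> polys G deg (Suc k) n" "lie_ideal G deg n (p - r - q)"
      using rep_diff[OF \<xi> p r] by blast
    have q0: "q \<in> polys G deg 0 n" using q(1) polys_antimono[of 0 "Suc k"] by blast
    have pr: "p \<in> polys G deg 0 n" "r \<in> polys G deg 0 n" using rep_in_polys[OF \<xi>] p r by auto
    have "?P n (p - r - q) = \<zero>\<^bsub>sp A n\<^esub>" by (rule F.evp_lie_ideal[OF q(2)])
    then have "(?P n p \<ominus>\<^bsub>sp A n\<^esub> ?P n r) \<ominus>\<^bsub>sp A n\<^esub> ?P n q = \<zero>\<^bsub>sp A n\<^esub>"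
      using pr q0 by (simp add: F.evp_diff[where m = 0] polys_closed)
    then have "?P n p \<ominus>\<^bsub>sp A n\<^esub> ?P n r = ?P n q"
      using A.sp.minus_decompose(4)[of "?P n p \<ominus>\<^bsub>sp A n\<^esub> ?P n r" n "?P n q"] pr q0 F.evp_closed by auto
    then show ?thesis using evp_fil[OF A f q(1)] pr F.evp_closed by (auto simp: fcong_def)
  qed
  have ex: "\<exists>l\<in>elts A n. \<forall>k. \<forall>p\<in>rep \<xi> k. fcong A (Suc k) n l (?P n p)"
    if \<xi>: "\<xi> \<in> elts C n" for \<xi> n
  proof -
    define q where "q = (\<lambda>k. SOME p. p \<in> rep \<xi> k)"
    have q: "q k \<in> rep \<xi> k" for k unfolding q_def using rep_nonempty[OF \<xi>] by (rule someI_ex)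
    have "fcong A (Suc k) n (?P n (q (Suc k))) (?P n (q k))" for k
      using wd[OF \<xi> _ q] q rep_Suc[OF \<xi>] by blast
    then obtain l where l: "l \<in> elts A n" "\<And>k. fcong A (Suc k) n l (?P n (q k))"
      using A.ex_fcong_limit[of n "\<lambda>k. ?P n (q k)"] by blast
    have "fcong A (Suc k) n l (?P n p)" if "p \<in> rep \<xi> k" for k p
      using A.fcong_trans[OF _ l(2) wd[OF \<xi> q that]] by simp
    with l(1) show ?thesis by blast
  qed
  define \<phi> where "\<phi> = (\<lambda>n \<xi>. SOME l. l \<in> elts A n \<and> (\<forall>k. \<forall>p\<in>rep \<xi> k. fcong A (Suc k) n l (?P n p)))"
  have \<phi>: "\<phi> n \<xi> \<in> elts A n \<and> (\<forall>k. \<forall>p\<in>rep \<xi> k. fcong A (Suc k) n (\<phi> n \<xi>) (?P n p))"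
    if "\<xi> \<in> elts C n" for \<xi> n
    unfolding \<phi>_def by (rule someI_ex) (use ex[OF that] in blast)
  have \<phi>1: "\<phi> n \<xi> \<in> elts A n" if "\<xi> \<in> elts C n" for \<xi> n
    using \<phi>[OF that] by simp
  have \<phi>2: "fcong A (Suc k) n (\<phi> n \<xi>) (?P n p)" if "\<xi> \<in> elts C n" "p \<in> rep \<xi> k" for \<xi> n p k
    using \<phi>[OF that(1)] that(2) by simp
  have unique: "\<phi> n \<xi> = l"
    if \<xi>: "\<xi> \<in> elts C n" and l: "l \<in> elts A n" and e: "\<And>k. \<exists>p\<in>rep \<xi> k. fcong A (Suc k) n l (?P n p)" for \<xi> n l
  proof (rule A.eq_if_fcong[OF \<phi>1[OF \<xi>] l])
    fix k
    obtain p where p: "p \<in> rep \<xi> k" "fcong A (Suc k) n l (?P n p)" using e by blast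
    show "fcong A (Suc k) n (\<phi> n \<xi>) l"
      using A.fcong_trans[OF _ \<phi>2[OF \<xi> p(1)] A.fcong_sym[OF _ p(2)]] by simp
  qed
  have linear: "Q_linear (sp C n) (sp A n) (\<phi> n)" for n
    unfolding Q_linear_def
  proof (intro conjI ballI allI)
    show "\<phi> n \<in> elts C n \<rightarrow> elts A n" using \<phi>1 by blast
  next
    fix x y assume x: "x \<in> elts C n" and y: "y \<in> elts C n"
    show "\<phi> n (x \<oplus>\<^bsub>sp C n\<^esub> y) = \<phi> n x \<oplus>\<^bsub>sp A n\<^esub> \<phi> n y"
    proof (rule unique)
      fix k
      obtain p r where p: "p \<in> rep x k" and r: "r \<in> rep y k" using rep_nonempty x y by metis
      have "?P n (p + r) = ?P n p \<oplus>\<^bsub>sp A n\<^esub> ?P n r"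
        by (rule F.evp_add[OF rep_in_polys[OF x p] rep_in_polys[OF y r]])
      then show "\<exists>p\<in>rep (x \<oplus>\<^bsub>sp C n\<^esub> y) k. fcong A (Suc k) n (\<phi> n x \<oplus>\<^bsub>sp A n\<^esub> \<phi> n y) (?P n p)"
        using rep_add[OF p r] A.fcong_add[OF _ \<phi>2[OF x p] \<phi>2[OF y r]] by (intro bexI[of _ "p + r"]) simp_all
    qed (use x y \<phi>1 in auto)
  next
    fix q x assume x: "x \<in> elts C n"
    show "\<phi> n (q \<odot>\<^bsub>sp C n\<^esub> x) = q \<odot>\<^bsub>sp A n\<^esub> \<phi> n x"
    proof (rule unique)
      fix k
      obtain p where p: "p \<in> rep x k" using rep_nonempty x by metis
      have "?P n (Poly_Mapping.map ((*) q) p) = q \<odot>\<^bsub>sp A n\<^esub> ?P n p"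
        by (rule F.evp_scale[OF rep_in_polys[OF x p]])
      then show "\<exists>p\<in>rep (q \<odot>\<^bsub>sp C n\<^esub> x) k. fcong A (Suc k) n (q \<odot>\<^bsub>sp A n\<^esub> \<phi> n x) (?P n p)"
        using rep_smult[OF p] A.fcong_smult[OF _ \<phi>2[OF x p]]
        by (intro bexI[of _ "Poly_Mapping.map ((*) q) p"]) simp_all
    qed (use x \<phi>1 in auto)
  qed
  have brackets: "\<phi> (n + m) (brk C n m x y) = brk A n m (\<phi> n x) (\<phi> m y)"
    if x: "x \<in> elts C n" and y: "y \<in> elts C m" for n m x y
  proof (rule unique)
    fix k
    obtain p r where p: "p \<in> rep x k" and r: "r \<in> rep y k" using rep_nonempty x y by metis
    have "?P (n + m) (wprod p r) = brk A n m (?P n p) (?P m r)"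
      by (rule F.evp_wprod[OF rep_in_polys[OF x p] rep_in_polys[OF y r]])
    moreover have "fcong A (Suc k) (n + m) (brk A n m (\<phi> n x) (\<phi> m y)) (brk A n m (?P n p) (?P m r))"
      using A.fcong_mono[OF _ _ A.fcong_brk[OF _ \<phi>2[OF x p] \<phi>2[OF y r]], of "Suc k"] by simp
    ultimately show "\<exists>p\<in>rep (brk C n m x y) k. fcong A (Suc k) (n + m) (brk A n m (\<phi> n x) (\<phi> m y)) (?P (n + m) p)"
      using rep_brk[OF p r] by (intro bexI[of _ "wprod p r"]) simp_all
  qed (use x y \<phi>1 in auto)
  have filtered: "\<phi> n ` fil C k n \<subseteq> fil A k n" if k: "1 \<le> k" for k n
  proof clarify
    fix x assume x: "x \<in> fil C k n"
    obtain j where j: "k = Suc j" using k by (cases k) auto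
    have xc: "x \<in> elts C n" using fil_subset[OF k] x by blast
    obtain p where p: "p \<in> rep x j" "p \<in> polys G deg (Suc j) n"
      using fil_long_rep[of x G deg dd j n j] x j by auto
    have 1: "fcong A k n (?P n p) \<zero>\<^bsub>sp A n\<^esub>"
      using evp_fil[OF A f p(2)] A.fil_iff_fcong c[OF xc p(1)] j by blast
    have "fcong A k n (\<phi> n x) \<zero>\<^bsub>sp A n\<^esub>"
      using A.fcong_trans[OF k _ 1] \<phi>2[OF xc p(1)] j by blast
    then show "\<phi> n x \<in> fil A k n" using A.fil_iff_fcong \<phi>1[OF xc] by blast
  qed
  have "\<exists>m\<ge>1. \<forall>n. \<phi> n ` fil C m n \<subseteq> fil A k n" if "1 \<le> k" for k
    using that filtered[OF that] by blast
  then have "lie_morphism C A \<phi>"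
    using linear brackets by (simp add: lie_morphism_def cont_linear_def)
  moreover have "\<phi> (deg g) (gen g) = f g" if "g \<in> G" for g
  proof (rule unique[OF gen_closed[OF that] f[OF that]])
    fix k
    have "Gen g \<in> words G deg 0 (deg g)" using that by (simp add: words_def)
    then have "?P (deg g) (Poly_Mapping.single (Gen g) 1) = f g"
      using f[OF that] by (simp add: F.evp_single)
    then show "\<exists>p\<in>rep (gen g) k. fcong A (Suc k) (deg g) (f g) (?P (deg g) p)"
      using rep_gen A.fcong_refl[OF _ f[OF that]] by (intro bexI[of _ "Poly_Mapping.single (Gen g) 1"]) simp_all
  qed
  ultimately show ?thesis by blast
qed

section \<open>Power series in an adjoint action and the gauge action\<close>

text \<open>
  The value \<open>F(ad\<^sub>x) v\<close> for \<open>v\<close> of degree \<open>-1\<close>.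
\<close>

definition ad_series :: "('a, 'm) cdgl_scheme \<Rightarrow> rat fps \<Rightarrow> 'a \<Rightarrow> 'a \<Rightarrow> 'a"
  where "ad_series L F x v =
    series L (-1) (\<lambda>i. fps_nth F i \<odot>\<^bsub>sp L (-1)\<^esub> (brk L 0 (-1) x ^^ i) v)"

text \<open>
  The power series \<open>(e\<^sup>t - 1) / t\<close> and its inverse \<open>t / (e\<^sup>t - 1)\<close>, the generating function of the numbers \<open>B\<^sub>n / n!\<close>.
\<close>

definition exp_quotient :: "rat fps"
  where "exp_quotient = Abs_fps (\<lambda>i. 1 / fact (Suc i))"

definition exp_quotient_inverse :: "rat fps"
  where "exp_quotient_inverse = fps_X / (fps_exp 1 - 1)"

lemma fps_X_exp_quotient: "fps_X * exp_quotient = fps_exp 1 - 1"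
  by (rule fps_ext) (auto simp: exp_quotient_def fps_X_mult_nth gr0_conv_Suc)

lemma exp_quotient_times_inverse: "exp_quotient * exp_quotient_inverse = 1"
proof -
  have e: "fps_nth exp_quotient 0 \<noteq> 0" by (simp add: exp_quotient_def)
  have "exp_quotient_inverse = (fps_X * 1) / (fps_X * exp_quotient)"
    by (simp add: exp_quotient_inverse_def fps_X_exp_quotient)
  also have "\<dots> = 1 / exp_quotient"
    by (rule div_mult_mult1) simp
  also have "\<dots> = inverse exp_quotient"
    using e by (simp add: fps_divide_unit)
  finally show ?thesis using inverse_mult_eq_1'[OF e] by simp
qed

lemma bernoulli_exp_quotient_inverse: "bernoulli n / fact n = fps_nth exp_quotient_inverse n"
  by (simp add: bernoulli_def exp_quotient_inverse_def)

lemma fps_decompose: "(F :: rat fps) = fps_const (fps_nth F 0) * 1 + fps_X * fps_shift 1 F"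
  by (rule fps_ext) (auto simp: fps_X_mult_nth)

text \<open>
  The formula for the differential of the edge of the interval: \<open>x\<close> is a path from \<open>b\<close> to \<open>a\<close>.
\<close>

definition path_relation :: "('a, 'm) cdgl_scheme \<Rightarrow> 'a \<Rightarrow> 'a \<Rightarrow> 'a \<Rightarrow> bool"
  where "path_relation L x a b \<longleftrightarrow>
    dif L 0 x = brk L 0 (-1) x b \<oplus>\<^bsub>sp L (-1)\<^esub>
      ad_series L exp_quotient_inverse x (b \<ominus>\<^bsub>sp L (-1)\<^esub> a)"

context complete_dg_lie_algebra
begin

abbreviation "partial_sum n s (m :: nat) \<equiv> finsum (sp L n) s {..<m}"

lemma partial_sum_Suc:
  assumes "\<And>i. s i \<in> elts L n"
  shows "partial_sum n s (Suc m) = s m \<oplus>\<^bsub>sp L n\<^esub> partial_sum n s m"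
  unfolding lessThan_Suc using assms by (intro sp.finsum_insert) auto

lemma partial_sum_closed:
  assumes "\<And>i. s i \<in> elts L n" shows "partial_sum n s m \<in> elts L n"
  using assms by (intro sp.finsum_closed) auto

text \<open>
  When the \<open>i\<close>-th term lies in \<open>F\<^sub>i\<^sub>+\<^sub>1\<close>, the sum of the first \<open>k\<close> terms determines the series modulo \<open>F\<^sub>k\<close>.
\<close>

lemma partial_sum_fcong:
  assumes s: "\<And>i. s i \<in> fil L (Suc i) n" and "Suc k \<le> m"
  shows "fcong L (Suc k) n (partial_sum n s m) (partial_sum n s (Suc k))"
proof -
  have c: "s i \<in> elts L n" for i using s[of i] fil_subset[of "Suc i" n] by auto
  show ?thesis using assms(2)
  proof (induction m)
    case (Suc m)
    show ?case
    proof (cases "m = k")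
      case False
      then have "fcong L (Suc k) n (s m) \<zero>\<^bsub>sp L n\<^esub>"
        using s[of m] fil_antimono[of "Suc k" "Suc m" n] Suc.prems fil_iff_fcong[OF c] by auto
      moreover have "fcong L (Suc k) n (partial_sum n s m) (partial_sum n s (Suc k))"
        using Suc False by simp
      ultimately have "fcong L (Suc k) n (s m \<oplus>\<^bsub>sp L n\<^esub> partial_sum n s m)
          (\<zero>\<^bsub>sp L n\<^esub> \<oplus>\<^bsub>sp L n\<^esub> partial_sum n s (Suc k))"
        by (intro fcong_add) auto
      then show ?thesis
        unfolding partial_sum_Suc[of s n m, OF c]
        using sp.l_zero[OF partial_sum_closed[of s n, OF c]] by simp
    qed (simp add: fcong_refl partial_sum_closed[OF c])
  qed simp
qed

lemma has_series_iff:
  assumes s: "\<And>i. s i \<in> fil L (Suc i) n"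
  shows "has_series L n s l \<longleftrightarrow>
    l \<in> elts L n \<and> (\<forall>k. fcong L (Suc k) n l (partial_sum n s (Suc k)))"
proof -
  have c: "s i \<in> elts L n" for i using s[of i] fil_subset[of "Suc i" n] by auto
  note pc = partial_sum_closed[of s n, OF c]
  have "has_series L n s l \<longleftrightarrow> l \<in> elts L n \<and>
      (\<forall>k\<ge>1. \<exists>N. \<forall>m\<ge>N. fcong L k n (partial_sum n s m) l)"
    using pc by (auto simp: has_series_def fcong_def)
  also have "\<dots> \<longleftrightarrow> l \<in> elts L n \<and> (\<forall>k. fcong L (Suc k) n l (partial_sum n s (Suc k)))"
  proof (intro conj_cong refl iffI allI impI)
    fix k assume "l \<in> elts L n" and l: "\<forall>k\<ge>1. \<exists>N. \<forall>m\<ge>N. fcong L k n (partial_sum n s m) l"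
    obtain N where "\<forall>m\<ge>N. fcong L (Suc k) n (partial_sum n s m) l" using l by auto
    then have "fcong L (Suc k) n (partial_sum n s (max N (Suc k))) l" by simp
    then have "fcong L (Suc k) n l (partial_sum n s (max N (Suc k)))" by (rule fcong_sym[rotated]) simp
    from fcong_trans[OF _ this partial_sum_fcong[OF s]]
    show "fcong L (Suc k) n l (partial_sum n s (Suc k))" by simp
  next
    fix k :: nat assume l: "l \<in> elts L n" "\<forall>k. fcong L (Suc k) n l (partial_sum n s (Suc k))" and "1 \<le> k"
    then obtain j where j: "k = Suc j" by (cases k) auto
    have "fcong L k n (partial_sum n s m) l" if "k \<le> m" for m
      unfolding j
      by (rule fcong_trans[OF _ partial_sum_fcong[OF s] fcong_sym[OF _ l(2)[rule_format]]])
        (use that j in simp_all)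
    then show "\<exists>N. \<forall>m\<ge>N. fcong L k n (partial_sum n s m) l" by blast
  qed
  finally show ?thesis .
qed

lemma series_eqI:
  assumes s: "\<And>i. s i \<in> fil L (Suc i) n" and l: "l \<in> elts L n"
    and e: "\<And>k. fcong L (Suc k) n l (partial_sum n s (Suc k))"
  shows "series L n s = l"
  unfolding series_def
proof (rule the_equality)
  show "has_series L n s l" using has_series_iff[OF s] l e by blast
  fix l' assume "has_series L n s l'"
  then have "l' \<in> elts L n" "\<And>k. fcong L (Suc k) n l' (partial_sum n s (Suc k))"
    using has_series_iff[OF s] by blast+
  then show "l' = l"
    using fcong_trans[OF _ _ fcong_sym[OF _ e]] l by (intro eq_if_fcong) auto
qed

lemma
  assumes s: "\<And>i. s i \<in> fil L (Suc i) n"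
  shows series_closed: "series L n s \<in> elts L n"
    and series_fcong: "fcong L (Suc k) n (series L n s) (partial_sum n s (Suc k))"
proof -
  have c: "s i \<in> elts L n" for i using s[of i] fil_subset[of "Suc i" n] by auto
  have "fcong L (Suc k) n (partial_sum n s (Suc (Suc k))) (partial_sum n s (Suc k))" for k
    by (rule partial_sum_fcong[OF s]) simp
  then obtain l where l: "l \<in> elts L n" "\<And>k. fcong L (Suc k) n l (partial_sum n s (Suc k))"
    using ex_fcong_limit[of n "\<lambda>k. partial_sum n s (Suc k)"] by blast
  have "series L n s = l" by (rule series_eqI[OF s l])
  then show "series L n s \<in> elts L n" "fcong L (Suc k) n (series L n s) (partial_sum n s (Suc k))"
    using l by simp_all
qed

lemma ad_closed [simp]: "\<lbrakk>x \<in> elts L 0; v \<in> elts L (-1)\<rbrakk> \<Longrightarrow> brk L 0 (-1) x v \<in> elts L (-1)"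
  using brk_closed[of x 0 v "-1"] by simp

lemma ad_power_fil: "\<lbrakk>x \<in> elts L 0; v \<in> elts L (-1)\<rbrakk> \<Longrightarrow> (brk L 0 (-1) x ^^ i) v \<in> fil L (Suc i) (-1)"
proof (induction i)
  case 0
  then show ?case using fil_one by simp
next
  case (Suc i)
  then have "x \<in> fil L 1 0" using fil_one by simp
  then show ?case using fil_brk[of 1 "Suc i" x 0 "(brk L 0 (-1) x ^^ i) v" "-1"] Suc by simp
qed

lemma ad_power_closed: "\<lbrakk>x \<in> elts L 0; v \<in> elts L (-1)\<rbrakk> \<Longrightarrow> (brk L 0 (-1) x ^^ i) v \<in> elts L (-1)"
  using subsetD[OF fil_subset ad_power_fil, of i] by simp

abbreviation "ad_term F x v i \<equiv> fps_nth F i \<odot>\<^bsub>sp L (-1)\<^esub> (brk L 0 (-1) x ^^ i) v"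

lemma ad_term_fil: "\<lbrakk>x \<in> elts L 0; v \<in> elts L (-1)\<rbrakk> \<Longrightarrow> ad_term F x v i \<in> fil L (Suc i) (-1)"
  using fil_mem(5)[OF _ ad_power_fil] by simp

lemma ad_term_closed: "\<lbrakk>x \<in> elts L 0; v \<in> elts L (-1)\<rbrakk> \<Longrightarrow> ad_term F x v i \<in> elts L (-1)"
  by (rule smult_closed[OF ad_power_closed])

lemma ad_series_closed [simp]: "\<lbrakk>x \<in> elts L 0; v \<in> elts L (-1)\<rbrakk> \<Longrightarrow> ad_series L F x v \<in> elts L (-1)"
  unfolding ad_series_def using series_closed ad_term_fil by simp

lemma ad_series_fcong:
  "\<lbrakk>x \<in> elts L 0; v \<in> elts L (-1)\<rbrakk> \<Longrightarrow>
    fcong L (Suc k) (-1) (ad_series L F x v) (partial_sum (-1) (ad_term F x v) (Suc k))"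
  unfolding ad_series_def using series_fcong ad_term_fil by simp

lemma ad_series_eqI:
  assumes "x \<in> elts L 0" "v \<in> elts L (-1)" "l \<in> elts L (-1)"
    and "\<And>k. fcong L (Suc k) (-1) l (partial_sum (-1) (ad_term F x v) (Suc k))"
  shows "ad_series L F x v = l"
  unfolding ad_series_def using assms ad_term_fil by (intro series_eqI) auto

lemma partial_sum_add:
  assumes "\<And>i. s i \<in> elts L n" "\<And>i. t i \<in> elts L n"
  shows "partial_sum n s m \<oplus>\<^bsub>sp L n\<^esub> partial_sum n t m = partial_sum n (\<lambda>i. s i \<oplus>\<^bsub>sp L n\<^esub> t i) m"
  using assms by (intro sp.finsum_addf[symmetric]) auto

lemma partial_sum_smult:
  assumes "\<And>i. s i \<in> elts L n"
  shows "q \<odot>\<^bsub>sp L n\<^esub> partial_sum n s m = partial_sum n (\<lambda>i. q \<odot>\<^bsub>sp L n\<^esub> s i) m"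
  by (rule sp.finsum_smult_ldistr) (use assms in auto)

context
  fixes x
  assumes x: "x \<in> elts L 0"
begin

lemma ad_series_add:
  assumes v: "v \<in> elts L (-1)"
  shows "ad_series L (F + H) x v = ad_series L F x v \<oplus>\<^bsub>sp L (-1)\<^esub> ad_series L H x v"
proof (rule ad_series_eqI[OF x v])
  note c = ad_term_closed[OF x v]
  fix k
  have "ad_term F x v i \<oplus>\<^bsub>sp L (-1)\<^esub> ad_term H x v i = ad_term (F + H) x v i" for i
    using smult_add_left[OF ad_power_closed[OF x v]] by simp
  then have "partial_sum (-1) (ad_term (F + H) x v) (Suc k) =
      partial_sum (-1) (ad_term F x v) (Suc k) \<oplus>\<^bsub>sp L (-1)\<^esub> partial_sum (-1) (ad_term H x v) (Suc k)"
    unfolding partial_sum_add[of "ad_term F x v" "-1" "ad_term H x v", OF c c] by simp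
  then show "fcong L (Suc k) (-1) (ad_series L F x v \<oplus>\<^bsub>sp L (-1)\<^esub> ad_series L H x v)
      (partial_sum (-1) (ad_term (F + H) x v) (Suc k))"
    using fcong_add[OF _ ad_series_fcong[OF x v] ad_series_fcong[OF x v]] by simp
qed (use x v in simp)

lemma ad_series_const:
  assumes v: "v \<in> elts L (-1)"
  shows "ad_series L (fps_const c * F) x v = c \<odot>\<^bsub>sp L (-1)\<^esub> ad_series L F x v"
proof (rule ad_series_eqI[OF x v])
  fix k
  have "c \<odot>\<^bsub>sp L (-1)\<^esub> ad_term F x v i = ad_term (fps_const c * F) x v i" for i
    using smult_smult[OF ad_power_closed[OF x v]] by simp
  then have "partial_sum (-1) (ad_term (fps_const c * F) x v) (Suc k) =
      c \<odot>\<^bsub>sp L (-1)\<^esub> partial_sum (-1) (ad_term F x v) (Suc k)"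
    unfolding partial_sum_smult[of "ad_term F x v" "-1", OF ad_term_closed[OF x v]] by simp
  then show "fcong L (Suc k) (-1) (c \<odot>\<^bsub>sp L (-1)\<^esub> ad_series L F x v)
      (partial_sum (-1) (ad_term (fps_const c * F) x v) (Suc k))"
    using fcong_smult[OF _ ad_series_fcong[OF x v]] by simp
qed (use x v in simp)

lemma ad_series_one:
  assumes v: "v \<in> elts L (-1)" shows "ad_series L 1 x v = v"
proof (rule ad_series_eqI[OF x v v])
  fix k
  have "partial_sum (-1) (ad_term 1 x v) (Suc k) = v"
  proof (induction k)
    case 0
    then show ?case using v partial_sum_Suc[of "ad_term 1 x v" "-1" 0, OF ad_term_closed[OF x v]] by simp
  next
    case (Suc k)
    then show ?case
      using v partial_sum_Suc[of "ad_term 1 x v" "-1" "Suc k", OF ad_term_closed[OF x v]]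
        ad_power_closed[OF x v, of "Suc k"] by simp
  qed
  then show "fcong L (Suc k) (-1) v (partial_sum (-1) (ad_term 1 x v) (Suc k))"
    using fcong_refl v by simp
qed

lemma ad_series_X:
  assumes v: "v \<in> elts L (-1)"
  shows "ad_series L (fps_X * F) x v = brk L 0 (-1) x (ad_series L F x v)"
proof (rule ad_series_eqI[OF x v])
  fix k
  let ?t = "ad_term F x v" and ?t' = "ad_term (fps_X * F) x v"
  have ps: "partial_sum (-1) ?t' (Suc m) = brk L 0 (-1) x (partial_sum (-1) ?t m)" for m
  proof (induction m)
    case 0
    then show ?case
      using v x partial_sum_Suc[of ?t' "-1" 0, OF ad_term_closed[OF x v]] brk_zero_right[OF x, of "-1"] by simp
  next
    case (Suc m)
    have "?t' (Suc m) = brk L 0 (-1) x (?t m)"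
      using brk_smult_right[OF x ad_power_closed[OF x v], of "fps_nth F m" m] by simp
    then show ?case
      using Suc partial_sum_Suc[of ?t' "-1" "Suc m", OF ad_term_closed[OF x v]]
        partial_sum_Suc[of ?t "-1" m, OF ad_term_closed[OF x v]]
        brk_add_right[OF x ad_term_closed[OF x v] partial_sum_closed[of ?t "-1", OF ad_term_closed[OF x v]]]
      by simp
  qed
  show "fcong L (Suc k) (-1) (brk L 0 (-1) x (ad_series L F x v)) (partial_sum (-1) ?t' (Suc k))"
  proof (cases k)
    case 0
    then show ?thesis
      using fcong_one[of _ "-1"] x v partial_sum_closed[of ?t' "-1", OF ad_term_closed[OF x v]] by simp
  next
    case (Suc j)
    then show ?thesis
      using fcong_brk[OF _ fcong_refl[OF _ x] ad_series_fcong[OF x v, of j F]] ps by simp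
  qed
qed (use x v in simp)

lemma ad_series_minus_right:
  assumes v: "v \<in> elts L (-1)" "w \<in> elts L (-1)"
  shows "ad_series L F x (v \<ominus>\<^bsub>sp L (-1)\<^esub> w) = ad_series L F x v \<ominus>\<^bsub>sp L (-1)\<^esub> ad_series L F x w"
proof -
  let ?M = "sp L (-1)"
  define u where "u = v \<ominus>\<^bsub>?M\<^esub> w"
  have u: "u \<in> elts L (-1)" "u \<oplus>\<^bsub>?M\<^esub> w = v" using v sp.minus_decompose(5)[of v "-1" w] by (auto simp: u_def)
  have pw: "(brk L 0 (-1) x ^^ i) (u \<oplus>\<^bsub>?M\<^esub> w) = (brk L 0 (-1) x ^^ i) u \<oplus>\<^bsub>?M\<^esub> (brk L 0 (-1) x ^^ i) w" for i
  proof (induction i)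
    case (Suc i)
    then show ?case
      using brk_add_right[OF x ad_power_closed[OF x u(1), of i] ad_power_closed[OF x v(2), of i]] by simp
  qed simp
  have "ad_series L F x v = ad_series L F x u \<oplus>\<^bsub>?M\<^esub> ad_series L F x w"
  proof (rule ad_series_eqI[OF x v(1)])
    fix k
    have "ad_term F x u i \<oplus>\<^bsub>?M\<^esub> ad_term F x w i = ad_term F x v i" for i
      using smult_add_right[OF ad_power_closed[OF x u(1)] ad_power_closed[OF x v(2)]] pw[of i] u(2) by simp
    then have "partial_sum (-1) (ad_term F x v) (Suc k) =
        partial_sum (-1) (ad_term F x u) (Suc k) \<oplus>\<^bsub>?M\<^esub> partial_sum (-1) (ad_term F x w) (Suc k)"
      unfolding partial_sum_add[of "ad_term F x u" "-1" "ad_term F x w",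
          OF ad_term_closed[OF x u(1)] ad_term_closed[OF x v(2)]] by simp
    then show "fcong L (Suc k) (-1) (ad_series L F x u \<oplus>\<^bsub>?M\<^esub> ad_series L F x w)
        (partial_sum (-1) (ad_term F x v) (Suc k))"
      using fcong_add[OF _ ad_series_fcong[OF x u(1)] ad_series_fcong[OF x v(2)]] by simp
  qed (use x u v in simp)
  then show ?thesis
    using sp.minus_decompose(6)[of "ad_series L F x u" "-1" "ad_series L F x w"] x u v
    unfolding u_def by simp
qed

text \<open>
  Composition of series corresponds to their product. Splitting the outer series as
  \<open>F = F\<^sub>0 + X F'\<close> reduces the claim modulo \<open>F\<^sub>k\<^sub>+\<^sub>1\<close> to the claim modulo \<open>F\<^sub>k\<close> for \<open>F'\<close>.
\<close>

lemma ad_series_mult: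
  assumes v: "v \<in> elts L (-1)"
  shows "ad_series L F x (ad_series L H x v) = ad_series L (F * H) x v"
proof (rule eq_if_fcong)
  let ?M = "sp L (-1)"
  let ?w = "ad_series L H x v"
  have w: "?w \<in> elts L (-1)" using x v by simp
  show "fcong L (Suc k) (-1) (ad_series L F x ?w) (ad_series L (F * H) x v)" for k
  proof (induction k arbitrary: F)
    case 0
    then show ?case using fcong_one[of _ "-1"] x v by simp
  next
    case (Suc k)
    let ?F = "fps_shift 1 F"
    have "ad_series L F x ?w = (fps_nth F 0) \<odot>\<^bsub>?M\<^esub> ?w \<oplus>\<^bsub>?M\<^esub> brk L 0 (-1) x (ad_series L ?F x ?w)"
      by (subst fps_decompose[of F]) (simp only: ad_series_add[OF w] ad_series_const[OF w] ad_series_one[OF w] ad_series_X[OF w])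
    moreover have "F * H = fps_const (fps_nth F 0) * H + fps_X * (?F * H)"
      by (subst fps_decompose[of F]) (simp add: algebra_simps)
    then have "ad_series L (F * H) x v = (fps_nth F 0) \<odot>\<^bsub>?M\<^esub> ?w \<oplus>\<^bsub>?M\<^esub> brk L 0 (-1) x (ad_series L (?F * H) x v)"
      by (simp only: ad_series_add[OF v] ad_series_const[OF v] ad_series_X[OF v])
    moreover have "fcong L (Suc (Suc k)) (-1) (brk L 0 (-1) x (ad_series L ?F x ?w)) (brk L 0 (-1) x (ad_series L (?F * H) x v))"
      using fcong_brk[OF _ fcong_refl[OF _ x] Suc.IH[of ?F]] by simp
    moreover have "fcong L (Suc (Suc k)) (-1) ((fps_nth F 0) \<odot>\<^bsub>?M\<^esub> ?w) ((fps_nth F 0) \<odot>\<^bsub>?M\<^esub> ?w)"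
      using fcong_refl w by simp
    ultimately show ?case using fcong_add[of "Suc (Suc k)" "-1"] by simp
  qed
qed (use x v in simp_all)

text \<open>
  Collecting terms with \<open>e\<^sup>t = 1 + t (e\<^sup>t - 1) / t\<close> brings the gauge action into a form with a single series.
\<close>

lemma gauge_eq:
  assumes b: "b \<in> elts L (-1)"
  shows "gauge L x b = b \<ominus>\<^bsub>sp L (-1)\<^esub>
    ad_series L exp_quotient x (dif L 0 x \<ominus>\<^bsub>sp L (-1)\<^esub> brk L 0 (-1) x b)"
proof -
  let ?M = "sp L (-1)" and ?E = "ad_series L exp_quotient x"
  have dx: "dif L 0 x \<in> elts L (-1)" using dif_closed[OF x] by simp
  have ab: "brk L 0 (-1) x b \<in> elts L (-1)" using x b by simp
  have "ad_series L fps_X x b = brk L 0 (-1) x b"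
    using ad_series_X[OF b, of 1] ad_series_one[OF b] by simp
  then have "?E (brk L 0 (-1) x b) = ad_series L (fps_X * exp_quotient) x b"
    using ad_series_mult[OF b, of exp_quotient fps_X] by (simp add: mult.commute)
  moreover have "fps_exp 1 = 1 + fps_X * exp_quotient" by (simp add: fps_X_exp_quotient)
  ultimately have "ad_series L (fps_exp 1) x b = b \<oplus>\<^bsub>?M\<^esub> ?E (brk L 0 (-1) x b)"
    using ad_series_add[OF b] ad_series_one[OF b] by simp
  moreover have "gauge L x b = ad_series L (fps_exp 1) x b \<ominus>\<^bsub>?M\<^esub> ?E (dif L 0 x)"
    by (simp add: gauge_def ad_series_def exp_quotient_def)
  moreover have "(b \<oplus>\<^bsub>?M\<^esub> p) \<ominus>\<^bsub>?M\<^esub> q = b \<ominus>\<^bsub>?M\<^esub> (q \<ominus>\<^bsub>?M\<^esub> p)"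
    if "p \<in> elts L (-1)" "q \<in> elts L (-1)" for p q
    using b that by (simp add: a_minus_def sp.minus_add sp.a_ac)
  ultimately show ?thesis
    using ad_series_minus_right[OF dx ab] x b dx ab by simp
qed

lemma gauge_closed: "b \<in> elts L (-1) \<Longrightarrow> gauge L x b \<in> elts L (-1)"
  using gauge_eq x dif_closed[OF x] by simp

text \<open>
  The formula for \<open>d x\<close> in the interval is the gauge relation solved for \<open>d x\<close>: the gauge action
  involves \<open>(e\<^sup>t - 1) / t\<close> and the formula involves its inverse power series.
\<close>

lemma gauge_iff_path:
  assumes a: "a \<in> elts L (-1)" and b: "b \<in> elts L (-1)"
  shows "gauge L x b = a \<longleftrightarrow> path_relation L x a b"
proof -
  let ?M = "sp L (-1)" and ?E = "ad_series L exp_quotient x" and ?I = "ad_series L exp_quotient_inverse x"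
  let ?u = "dif L 0 x \<ominus>\<^bsub>?M\<^esub> brk L 0 (-1) x b"
  have dx: "dif L 0 x \<in> elts L (-1)" using dif_closed[OF x] by simp
  have u: "?u \<in> elts L (-1)" using dx x b by simp
  have inv: "?E (?I v) = v" "?I (?E v) = v" if "v \<in> elts L (-1)" for v
    using ad_series_mult[OF that] ad_series_one[OF that] exp_quotient_times_inverse
    by (simp_all add: mult.commute)
  have "gauge L x b = a \<longleftrightarrow> b = a \<oplus>\<^bsub>?M\<^esub> ?E ?u"
    using gauge_eq[OF b] sp.minus_decompose(7)[of b "-1" "?E ?u" a "\<zero>\<^bsub>?M\<^esub>"] a b u x by simp
  also have "\<dots> \<longleftrightarrow> b \<ominus>\<^bsub>?M\<^esub> a = ?E ?u"
    using sp.minus_decompose(7)[of b "-1" a "?E ?u" "\<zero>\<^bsub>?M\<^esub>"] a b u x sp.a_comm[of a "-1" "?E ?u"] by auto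
  also have "\<dots> \<longleftrightarrow> ?u = ?I (b \<ominus>\<^bsub>?M\<^esub> a)"
    using inv u a b by (metis sp.minus_closed)
  also have "\<dots> \<longleftrightarrow> path_relation L x a b"
    unfolding path_relation_def
    using sp.minus_decompose(7)[of "dif L 0 x" "-1" "brk L 0 (-1) x b" "?I (b \<ominus>\<^bsub>?M\<^esub> a)" "\<zero>\<^bsub>?M\<^esub>"] x a b dx
      sp.a_comm[of "?I (b \<ominus>\<^bsub>?M\<^esub> a)" "-1" "brk L 0 (-1) x b"]
    by auto
  finally show ?thesis .
qed

end

lemma ad_series_minus_self:
  assumes x: "x \<in> elts L 0" and a: "a \<in> elts L (-1)"
  shows "ad_series L F x (a \<ominus>\<^bsub>sp L (-1)\<^esub> a) = \<zero>\<^bsub>sp L (-1)\<^esub>"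
  using ad_series_minus_right[OF x a a] sp.minus_decompose(4)[of _ "-1"] x a by simp

lemma path_relation_zero:
  assumes a: "a \<in> elts L (-1)" shows "path_relation L \<zero>\<^bsub>sp L 0\<^esub> a a"
  using ad_series_minus_self[OF _ a, of "\<zero>\<^bsub>sp L 0\<^esub>"] brk_zero_left[OF a, of 0] dif_zero[of 0]
  by (simp add: path_relation_def)

lemma path_relation_loop:
  assumes x: "x \<in> elts L 0" and a: "a \<in> elts L (-1)"
  shows "path_relation L x a a \<longleftrightarrow> dif L 0 x = brk L 0 (-1) x a"
  using ad_series_minus_self[OF x a] x a by (simp add: path_relation_def)

end

lemma lie_morphism_ad_series:
  assumes f: "lie_morphism A B f" and A: "complete_dg_lie_algebra A" and B: "complete_dg_lie_algebra B"
    and x: "x \<in> elts A 0" and v: "v \<in> elts A (-1)"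
  shows "f (-1) (ad_series A F x v) = ad_series B F (f 0 x) (f (-1) v)"
proof -
  interpret A: complete_dg_lie_algebra A by fact
  interpret B: complete_dg_lie_algebra B by fact
  have fx: "f 0 x \<in> elts B 0" and fv: "f (-1) v \<in> elts B (-1)"
    using lie_morphism_closed[OF f] x v by auto
  have pw: "f (-1) ((brk A 0 (-1) x ^^ i) v) = (brk B 0 (-1) (f 0 x) ^^ i) (f (-1) v)" for i
  proof (induction i)
    case (Suc i)
    then show ?case using lie_morphism_brk[OF f x A.ad_power_closed[OF x v], of i] by simp
  qed simp
  have tm: "f (-1) (A.ad_term F x v i) = B.ad_term F (f 0 x) (f (-1) v) i" for i
    using lie_morphism_ops(5)[OF f A B A.ad_power_closed[OF x v]] pw by simp
  have ps: "f (-1) (A.partial_sum (-1) (A.ad_term F x v) m) = B.partial_sum (-1) (B.ad_term F (f 0 x) (f (-1) v)) m" for m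
    using Q_linear_finsum[OF lie_morphism_linear[OF f] A.sp_module B.sp_module, of "{..<m}" "A.ad_term F x v" "-1"]
      A.ad_term_closed[OF x v] tm by simp
  have "fcong B (Suc k) (-1) (f (-1) (ad_series A F x v)) (B.partial_sum (-1) (B.ad_term F (f 0 x) (f (-1) v)) (Suc k))" for k
  proof -
    obtain m where m: "1 \<le> m" "\<And>n x y. fcong A m n x y \<Longrightarrow> fcong B (Suc k) n (f n x) (f n y)"
      using cont_linear_fcong[OF A B lie_morphism_cont[OF f], of "Suc k"] by auto
    define j where "j = max m k"
    have "fcong A m (-1) (ad_series A F x v) (A.partial_sum (-1) (A.ad_term F x v) (Suc j))"
      using A.fcong_mono[OF m(1) _ A.ad_series_fcong[OF x v, of j F]] by (simp add: j_def)
    from m(2)[OF this] have "fcong B (Suc k) (-1) (f (-1) (ad_series A F x v))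
        (B.partial_sum (-1) (B.ad_term F (f 0 x) (f (-1) v)) (Suc j))" unfolding ps .
    moreover have "fcong B (Suc k) (-1) (B.partial_sum (-1) (B.ad_term F (f 0 x) (f (-1) v)) (Suc j))
        (B.partial_sum (-1) (B.ad_term F (f 0 x) (f (-1) v)) (Suc k))"
      by (rule B.partial_sum_fcong[OF B.ad_term_fil[OF fx fv]]) (simp add: j_def)
    ultimately show ?thesis by (rule B.fcong_trans[rotated]) simp
  qed
  then show ?thesis
    by (rule B.ad_series_eqI[OF fx fv lie_morphism_closed[OF f A.ad_series_closed[OF x v]], symmetric])
qed

lemma lie_morphism_path_formula:
  assumes f: "lie_morphism A B f" and A: "complete_dg_lie_algebra A" and B: "complete_dg_lie_algebra B"
    and x: "x \<in> elts A 0" and a: "a \<in> elts A (-1)" and b: "b \<in> elts A (-1)"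
    and p: "path_relation A x a b"
  shows "path_relation B (f 0 x) (f (-1) a) (f (-1) b) \<longleftrightarrow> f (-1) (dif A 0 x) = dif B 0 (f 0 x)"
proof -
  interpret A: complete_dg_lie_algebra A by fact
  interpret B: complete_dg_lie_algebra B by fact
  have "f (-1) (dif A 0 x) = brk B 0 (-1) (f 0 x) (f (-1) b) \<oplus>\<^bsub>sp B (-1)\<^esub>
      ad_series B exp_quotient_inverse (f 0 x) (f (-1) b \<ominus>\<^bsub>sp B (-1)\<^esub> f (-1) a)"
    using p x a b lie_morphism_brk[OF f x b]
    by (simp add: path_relation_def lie_morphism_ops[OF f A B] lie_morphism_ad_series[OF f A B])
  then show ?thesis by (auto simp: path_relation_def)
qed

lemma cdgl_morphism_path:
  assumes "cdgl_morphism A B f" "complete_dg_lie_algebra A" "complete_dg_lie_algebra B"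
    and "x \<in> elts A 0" "a \<in> elts A (-1)" "b \<in> elts A (-1)" "path_relation A x a b"
  shows "path_relation B (f 0 x) (f (-1) a) (f (-1) b)"
  using lie_morphism_path_formula[OF cdgl_morphism_lie[OF assms(1)] assms(2-)]
    cdgl_morphism_dif[OF assms(1,4)] by simp

section \<open>Maurer-Cartan elements and the twisted differential\<close>

context complete_dg_lie_algebra
begin

lemma MC_closed: "a \<in> MC L \<Longrightarrow> a \<in> elts L (-1)"
  by (simp add: MC_def)

lemma brk_self_closed: "a \<in> elts L (-1) \<Longrightarrow> brk L (-1) (-1) a a \<in> elts L (-2)"
  using brk_closed[of a "-1" a "-1"] by simp

lemma MC_iff: "a \<in> elts L (-1) \<Longrightarrow>
    a \<in> MC L \<longleftrightarrow> dif L (-1) a = \<ominus>\<^bsub>sp L (-2)\<^esub> ((1/2) \<odot>\<^bsub>sp L (-2)\<^esub> brk L (-1) (-1) a a)"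
  using sp.minus_decompose(4)[of "dif L (-1) a" "-2" "\<ominus>\<^bsub>sp L (-2)\<^esub> ((1/2) \<odot>\<^bsub>sp L (-2)\<^esub> brk L (-1) (-1) a a)"
      "\<zero>\<^bsub>sp L (-2)\<^esub>" "\<zero>\<^bsub>sp L (-2)\<^esub>"]
    dif_closed[of a "-1"] smult_closed[OF brk_self_closed, of a "1/2"]
  by (simp add: MC_def a_minus_def sp.minus_minus)

lemma twisted_dif_closed:
  "\<lbrakk>a \<in> elts L (-1); x \<in> elts L n\<rbrakk> \<Longrightarrow> twisted_dif L a n x \<in> elts L (n - 1)"
  using brk_closed[of a "-1" x n] by (simp add: twisted_dif_def)

lemma twisted_dif_add:
  assumes "a \<in> elts L (-1)" "x \<in> elts L n" "y \<in> elts L n"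
  shows "twisted_dif L a n (x \<oplus>\<^bsub>sp L n\<^esub> y) = twisted_dif L a n x \<oplus>\<^bsub>sp L (n - 1)\<^esub> twisted_dif L a n y"
  using brk_closed[of a "-1" x n] brk_closed[of a "-1" y n] assms
  by (simp add: twisted_dif_def dif_add brk_add_right sp.a_ac)

lemma twisted_dif_zero: "a \<in> elts L (-1) \<Longrightarrow> twisted_dif L a n \<zero>\<^bsub>sp L n\<^esub> = \<zero>\<^bsub>sp L (n - 1)\<^esub>"
  using brk_zero_right[of a "-1" n] by (simp add: twisted_dif_def)

lemma twisted_dif_minus:
  assumes "a \<in> elts L (-1)" "x \<in> elts L n" "y \<in> elts L n"
  shows "twisted_dif L a n (x \<ominus>\<^bsub>sp L n\<^esub> y) = twisted_dif L a n x \<ominus>\<^bsub>sp L (n - 1)\<^esub> twisted_dif L a n y"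
  using brk_closed[of a "-1" x n] brk_closed[of a "-1" y n] assms brk_minus_right[of a "-1" x n y]
  by (simp add: twisted_dif_def dif_minus) (simp add: a_minus_def sp.minus_add sp.a_ac)

text \<open>
  The square of \<open>d + [a, -]\<close> is the bracket with \<open>d a + [a, a] / 2\<close>, since \<open>[a, [a, x]] = [[a, a], x] / 2\<close>
  for \<open>a\<close> of odd degree.
\<close>

lemma twisted_dif_square:
  assumes a: "a \<in> MC L" and x: "x \<in> elts L n"
  shows "twisted_dif L a (n - 1) (twisted_dif L a n x) = \<zero>\<^bsub>sp L (n - 2)\<^esub>"
proof -
  let ?M = "sp L (n - 2)"
  have ac: "a \<in> elts L (-1)" using MC_closed[OF a] .
  have dx: "dif L n x \<in> elts L (n - 1)" using x by simp
  have ax: "brk L (-1) n a x \<in> elts L (n - 1)" using brk_closed[OF ac x] by simp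
  have da: "dif L (-1) a \<in> elts L (-2)" using dif_closed[OF ac] by simp
  have adx: "brk L (-1) (n - 1) a (dif L n x) \<in> elts L (n - 2)" using brk_closed[OF ac dx] by simp
  have dax: "brk L (-2) n (dif L (-1) a) x \<in> elts L (n - 2)" using brk_closed[OF da x] by simp
  have aax: "brk L (-1) (n - 1) a (brk L (-1) n a x) \<in> elts L (n - 2)" using brk_closed[OF ac ax] by simp
  have aa: "brk L (-2) n (brk L (-1) (-1) a a) x \<in> elts L (n - 2)"
    using brk_closed[OF brk_self_closed[OF ac] x] by simp
  have 1: "dif L (n - 1) (brk L (-1) n a x) =
      brk L (-2) n (dif L (-1) a) x \<oplus>\<^bsub>?M\<^esub> \<ominus>\<^bsub>?M\<^esub> brk L (-1) (n - 1) a (dif L n x)"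
    using dif_derivation[OF ac x] smult_neg_1[OF adx] by simp
  let ?t = "brk L (-1) (n - 1) a (brk L (-1) n a x)"
  have "?t = brk L (-2) n (brk L (-1) (-1) a a) x \<oplus>\<^bsub>?M\<^esub> \<ominus>\<^bsub>?M\<^esub> ?t"
    using jacobi[OF ac ac x] smult_neg_1[OF aax] by simp
  then have "brk L (-2) n (brk L (-1) (-1) a a) x = ?t \<oplus>\<^bsub>?M\<^esub> ?t"
    using sp.minus_decompose(7)[OF aa aax aax aax] by (simp add: a_minus_def)
  also have "\<dots> = 2 \<odot>\<^bsub>?M\<^esub> ?t"
    using smult_add_left[OF aax, of 1 1] smult_1[OF aax] by simp
  finally have "(1/2) \<odot>\<^bsub>?M\<^esub> brk L (-2) n (brk L (-1) (-1) a a) x = ?t"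
    using smult_smult[OF aax, of "1/2" 2] smult_1[OF aax] by simp
  moreover have "brk L (-2) n (dif L (-1) a) x = \<ominus>\<^bsub>?M\<^esub> ((1/2) \<odot>\<^bsub>?M\<^esub> brk L (-2) n (brk L (-1) (-1) a a) x)"
  proof -
    have "dif L (-1) a = (- (1/2)) \<odot>\<^bsub>sp L (-2)\<^esub> brk L (-1) (-1) a a"
      using MC_iff[OF ac] a smult_neg_1[OF smult_closed[OF brk_self_closed[OF ac]], of "1/2"]
        smult_smult[OF brk_self_closed[OF ac], of "-1" "1/2"] by simp
    then show ?thesis
      using brk_smult_left[OF brk_self_closed[OF ac] x, of "- (1/2)"]
        smult_neg_1[OF smult_closed[OF aa], of "1/2"] smult_smult[OF aa, of "-1" "1/2"] by simp
  qed
  ultimately have 2: "brk L (-2) n (dif L (-1) a) x = \<ominus>\<^bsub>?M\<^esub> ?t" by simp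
  have "twisted_dif L a (n - 1) (twisted_dif L a n x) =
      (\<ominus>\<^bsub>?M\<^esub> ?t \<oplus>\<^bsub>?M\<^esub> \<ominus>\<^bsub>?M\<^esub> brk L (-1) (n - 1) a (dif L n x)) \<oplus>\<^bsub>?M\<^esub>
      (brk L (-1) (n - 1) a (dif L n x) \<oplus>\<^bsub>?M\<^esub> ?t)"
    using dif_add[OF dx ax] brk_add_right[OF ac dx ax] dif_dif[OF x] 1 2 aax adx
    by (simp add: twisted_dif_def)
  also have "\<dots> = \<zero>\<^bsub>?M\<^esub>"
    using aax adx by (simp add: sp.a_ac sp.r_neg sp.r_neg1 sp.r_neg2)
  finally show ?thesis .
qed

lemma dif_twisted_cycle:
  assumes "a \<in> elts L (-1)" "x \<in> elts L n" "twisted_dif L a n x = \<zero>\<^bsub>sp L (n - 1)\<^esub>"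
  shows "dif L n x = \<ominus>\<^bsub>sp L (n - 1)\<^esub> brk L (-1) n a x"
  using assms brk_closed[of a "-1" x n] dif_closed[of x n]
  by (intro sp.minus_equality[symmetric]) (auto simp: twisted_dif_def)

text \<open>
  The iterates from zero form a coherent sequence, and their limit is fixed.
\<close>

lemma contraction_fixed_point:
  assumes T: "\<And>s. s \<in> elts L n \<Longrightarrow> T s \<in> elts L n"
    and contraction: "\<And>k s t. \<lbrakk>1 \<le> k; fcong L k n s t\<rbrakk> \<Longrightarrow> fcong L (Suc k) n (T s) (T t)"
  shows "\<exists>s\<in>elts L n. T s = s"
proof -
  define s where "s k = (T ^^ k) \<zero>\<^bsub>sp L n\<^esub>" for k
  have sc: "s k \<in> elts L n" for k unfolding s_def by (induction k) (auto intro: T)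
  have "fcong L (Suc k) n (s (Suc k)) (s k)" for k
  proof (induction k)
    case 0
    then show ?case using fcong_one sc by simp
  next
    case (Suc k)
    then show ?case using contraction[of "Suc k"] by (simp add: s_def)
  qed
  then obtain l where l: "l \<in> elts L n" "\<And>k. fcong L (Suc k) n l (s k)"
    using ex_fcong_limit[of n s] by blast
  have "fcong L (Suc k) n (T l) l" for k
  proof -
    have "fcong L (Suc k) n (T l) (s (Suc k))"
      using fcong_mono[OF _ _ contraction[OF _ l(2)[of k]], of "Suc k"] by (simp add: s_def)
    moreover have "fcong L (Suc k) n (s (Suc k)) l"
      using fcong_mono[OF _ _ fcong_sym[OF _ l(2)[of "Suc k"]], of "Suc k"] by simp
    ultimately show ?thesis by (rule fcong_trans[rotated]) simp
  qed
  then have "T l = l" by (rule eq_if_fcong[OF T[OF l(1)] l(1)])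
  with l(1) show ?thesis by blast
qed

end

lemma lie_morphism_MC_iff:
  assumes f: "lie_morphism A B f" and A: "complete_dg_lie_algebra A" and B: "complete_dg_lie_algebra B"
    and a: "a \<in> MC A"
  shows "f (-1) a \<in> MC B \<longleftrightarrow> f (-2) (dif A (-1) a) = dif B (-1) (f (-1) a)"
proof -
  interpret A: complete_dg_lie_algebra A by fact
  interpret B: complete_dg_lie_algebra B by fact
  have ac: "a \<in> elts A (-1)" using A.MC_closed[OF a] .
  have "f (-2) (dif A (-1) a) = \<ominus>\<^bsub>sp B (-2)\<^esub> ((1/2) \<odot>\<^bsub>sp B (-2)\<^esub> brk B (-1) (-1) (f (-1) a) (f (-1) a))"
    using A.MC_iff[OF ac] a A.brk_self_closed[OF ac] lie_morphism_brk[OF f ac ac]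
    by (simp add: lie_morphism_ops[OF f A B])
  then show ?thesis using B.MC_iff[OF lie_morphism_closed[OF f ac]] by auto
qed

lemma cdgl_morphism_MC:
  assumes "cdgl_morphism A B f" "complete_dg_lie_algebra A" "complete_dg_lie_algebra B" "a \<in> MC A"
  shows "f (-1) a \<in> MC B"
proof -
  interpret A: complete_dg_lie_algebra A by fact
  show ?thesis
    using lie_morphism_MC_iff[OF cdgl_morphism_lie[OF assms(1)] assms(2-4)]
      cdgl_morphism_dif[OF assms(1) A.MC_closed[OF assms(4)]] by simp
qed

lemma cdgl_morphism_twisted_dif:
  assumes f: "cdgl_morphism A B f" and A: "complete_dg_lie_algebra A" and B: "complete_dg_lie_algebra B"
    and a: "a \<in> elts A (-1)" and x: "x \<in> elts A n"
  shows "f (n - 1) (twisted_dif A a n x) = twisted_dif B (f (-1) a) n (f n x)"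
proof -
  interpret A: complete_dg_lie_algebra A by fact
  interpret B: complete_dg_lie_algebra B by fact
  note l = cdgl_morphism_lie[OF f]
  have "brk A (-1) n a x \<in> elts A (n - 1)" using A.brk_closed[OF a x] by simp
  then show ?thesis
    using lie_morphism_brk[OF l a x] x
    by (simp add: twisted_dif_def lie_morphism_ops[OF l A B] cdgl_morphism_dif[OF f x])
qed

section \<open>Solving for the value on one generator\<close>

context complete_free
begin

text \<open>
  If an element \<open>q\<close> has linear part \<open>c g\<^sub>0 + l\<close> with \<open>c \<noteq> 0\<close>, then agreement at \<open>q\<close> and \<open>l\<close> determines the value at
  the generator \<open>g\<^sub>0\<close>: the contribution of the decomposable part \<open>r\<close> is always known one filtration step
  further than the value at \<open>g\<^sub>0\<close>.
\<close>

lemma generator_recovery: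
  fixes A :: "('a, 'm) cdgl_scheme"
  assumes A: "complete_dg_lie_algebra A"
    and \<alpha>: "cont_linear C A e \<alpha>" and \<beta>: "cont_linear C A e \<beta>"
    and g0: "g0 \<in> G" and l: "l \<in> elts C (deg g0)" and r: "r \<in> elts C (deg g0)" and c: "c \<noteq> 0"
    and q: "q = c \<odot>\<^bsub>sp C (deg g0)\<^esub> gen g0 \<oplus>\<^bsub>sp C (deg g0)\<^esub> (l \<oplus>\<^bsub>sp C (deg g0)\<^esub> r)"
    and eq: "\<alpha> (deg g0) l = \<beta> (deg g0) l" "\<alpha> (deg g0) q = \<beta> (deg g0) q"
    and step: "\<And>k. \<lbrakk>1 \<le> k; fcong A k (deg g0 + e) (\<alpha> (deg g0) (gen g0)) (\<beta> (deg g0) (gen g0))\<rbrakk> \<Longrightarrow>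
      fcong A (Suc k) (deg g0 + e) (\<alpha> (deg g0) r) (\<beta> (deg g0) r)"
  shows "\<alpha> (deg g0) (gen g0) = \<beta> (deg g0) (gen g0)"
proof -
  interpret A: complete_dg_lie_algebra A by fact
  let ?n = "deg g0" let ?N = "deg g0 + e"
  let ?M = "sp A ?N"
  have la: "Q_linear (sp C ?n) ?M (\<alpha> ?n)" and lb: "Q_linear (sp C ?n) ?M (\<beta> ?n)"
    using \<alpha> \<beta> by (simp_all add: cont_linear_def)
  have g: "gen g0 \<in> elts C ?n" using gen_closed[OF g0] .
  have gc: "\<alpha> ?n (gen g0) \<in> elts A ?N" "\<beta> ?n (gen g0) \<in> elts A ?N"
    using Q_linear_closed[OF la g] Q_linear_closed[OF lb g] by auto
  have solve: "\<gamma> ?n (gen g0) = (1 / c) \<odot>\<^bsub>?M\<^esub> (\<gamma> ?n q \<ominus>\<^bsub>?M\<^esub> (\<gamma> ?n l \<oplus>\<^bsub>?M\<^esub> \<gamma> ?n r))"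
    if lin: "Q_linear (sp C ?n) ?M (\<gamma> ?n)" for \<gamma>
  proof -
    have cl: "\<gamma> ?n (gen g0) \<in> elts A ?N" "\<gamma> ?n l \<in> elts A ?N" "\<gamma> ?n r \<in> elts A ?N"
      using Q_linear_closed[OF lin] g l r by auto
    have "\<gamma> ?n q = c \<odot>\<^bsub>?M\<^esub> \<gamma> ?n (gen g0) \<oplus>\<^bsub>?M\<^esub> (\<gamma> ?n l \<oplus>\<^bsub>?M\<^esub> \<gamma> ?n r)"
      unfolding q using g l r by (simp add: Q_linear_add[OF lin] Q_linear_smult[OF lin])
    then have "\<gamma> ?n q \<ominus>\<^bsub>?M\<^esub> (\<gamma> ?n l \<oplus>\<^bsub>?M\<^esub> \<gamma> ?n r) = c \<odot>\<^bsub>?M\<^esub> \<gamma> ?n (gen g0)"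
      using A.sp.minus_decompose(6)[of "c \<odot>\<^bsub>?M\<^esub> \<gamma> ?n (gen g0)" ?N "\<gamma> ?n l \<oplus>\<^bsub>?M\<^esub> \<gamma> ?n r" "\<zero>\<^bsub>?M\<^esub>" "\<zero>\<^bsub>?M\<^esub>"] cl
      by simp
    then show ?thesis using A.smult_smult[OF cl(1), of "1 / c" c] c cl(1) by simp
  qed
  have qc: "\<beta> ?n q \<in> elts A ?N" "\<beta> ?n l \<in> elts A ?N"
    using Q_linear_closed[OF lb] g l r by (auto simp: q)
  have "fcong A (Suc k) ?N (\<alpha> ?n (gen g0)) (\<beta> ?n (gen g0))" for k
  proof (induction k)
    case 0
    then show ?case using A.fcong_one gc by simp
  next
    case (Suc k)
    have "fcong A (Suc (Suc k)) ?N (\<alpha> ?n r) (\<beta> ?n r)" using step[OF _ Suc] by simp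
    then show ?case
      unfolding solve[of \<alpha>, OF la] solve[of \<beta>, OF lb] eq
      by (intro A.fcong_smult A.fcong_minus A.fcong_add A.fcong_refl qc) simp_all
  qed
  then show ?thesis by (rule A.eq_if_fcong[OF gc])
qed

lemma lie_morphism_generator_unique:
  fixes A :: "('a, 'm) cdgl_scheme"
  assumes A: "complete_dg_lie_algebra A"
    and \<phi>: "lie_morphism C A \<phi>" and \<psi>: "lie_morphism C A \<psi>"
    and g0: "g0 \<in> G" and l: "l \<in> elts C (deg g0)" and r: "r \<in> fil C 2 (deg g0)" and c: "c \<noteq> 0"
    and q: "q = c \<odot>\<^bsub>sp C (deg g0)\<^esub> gen g0 \<oplus>\<^bsub>sp C (deg g0)\<^esub> (l \<oplus>\<^bsub>sp C (deg g0)\<^esub> r)"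
    and eq: "\<phi> (deg g0) l = \<psi> (deg g0) l" "\<phi> (deg g0) q = \<psi> (deg g0) q"
    and gens: "\<And>g. \<lbrakk>g \<in> G; g \<noteq> g0\<rbrakk> \<Longrightarrow> \<phi> (deg g) (gen g) = \<psi> (deg g) (gen g)"
  shows "\<phi> (deg g0) (gen g0) = \<psi> (deg g0) (gen g0)"
proof (rule generator_recovery[OF A lie_morphism_cont[OF \<phi>] lie_morphism_cont[OF \<psi>] g0 l _ c q eq])
  interpret A: complete_dg_lie_algebra A by fact
  show "r \<in> elts C (deg g0)" using r fil_subset[of 2] by auto
  fix k :: nat assume k: "1 \<le> k"
    and h: "fcong A k (deg g0 + 0) (\<phi> (deg g0) (gen g0)) (\<psi> (deg g0) (gen g0))"
  have "fcong A k (deg g) (\<phi> (deg g) (gen g)) (\<psi> (deg g) (gen g))" if "g \<in> G" for g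
    using h gens[OF that] A.fcong_refl[OF k lie_morphism_closed[OF \<psi> gen_closed[OF that]]]
    by (cases "g = g0") simp_all
  from lie_morphism_fcong_Suc[OF A \<phi> \<psi> k this r]
  show "fcong A (Suc k) (deg g0 + 0) (\<phi> (deg g0) r) (\<psi> (deg g0) r)" by simp
qed

lemma dif_commute_last_generator:
  fixes A :: "('a, 'm) cdgl_scheme"
  assumes A: "complete_dg_lie_algebra A" and \<phi>: "lie_morphism C A \<phi>"
    and g0: "g0 \<in> G" and l: "l \<in> elts C (deg g0)" and r: "r \<in> fil C 2 (deg g0)" and c: "c \<noteq> 0"
    and q: "q = c \<odot>\<^bsub>sp C (deg g0)\<^esub> gen g0 \<oplus>\<^bsub>sp C (deg g0)\<^esub> (l \<oplus>\<^bsub>sp C (deg g0)\<^esub> r)"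
    and eq: "\<phi> (deg g0 - 1) (dif C (deg g0) l) = dif A (deg g0) (\<phi> (deg g0) l)"
      "\<phi> (deg g0 - 1) (dif C (deg g0) q) = dif A (deg g0) (\<phi> (deg g0) q)"
    and gens: "\<And>g. \<lbrakk>g \<in> G; g \<noteq> g0\<rbrakk> \<Longrightarrow>
      \<phi> (deg g - 1) (dif C (deg g) (gen g)) = dif A (deg g) (\<phi> (deg g) (gen g))"
  shows "\<phi> (deg g0 - 1) (dif C (deg g0) (gen g0)) = dif A (deg g0) (\<phi> (deg g0) (gen g0))"
proof -
  interpret A: complete_dg_lie_algebra A by fact
  let ?\<alpha> = "\<lambda>n x. \<phi> (n - 1) (dif C n x)" and ?\<beta> = "\<lambda>n x. dif A n (\<phi> n x)"
  note CC = complete_dg_lie_algebra_axioms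
  have \<alpha>: "cont_linear C A (-1) ?\<alpha>"
    using cont_linear_comp[OF cont_linear_dif[OF CC] lie_morphism_cont[OF \<phi>]] by simp
  have \<beta>: "cont_linear C A (-1) ?\<beta>"
    using cont_linear_comp[OF lie_morphism_cont[OF \<phi>] cont_linear_dif[OF A]] by simp
  have rc: "r \<in> elts C (deg g0)" using r fil_subset[of 2] by auto
  have step: "fcong A (Suc k) (deg g0 + - 1) (?\<alpha> (deg g0) r) (?\<beta> (deg g0) r)"
    if k: "1 \<le> k" and h: "fcong A k (deg g0 + - 1) (?\<alpha> (deg g0) (gen g0)) (?\<beta> (deg g0) (gen g0))" for k
  proof -
    have "fcong A k (deg g - 1) (?\<alpha> (deg g) (gen g)) (?\<beta> (deg g) (gen g))" if "g \<in> G" for g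
      using h gens[OF that] A.fcong_refl[OF k A.dif_closed[OF lie_morphism_closed[OF \<phi> gen_closed[OF that]]]]
      by (cases "g = g0") simp_all
    from dif_commute_fcong_Suc[OF A \<phi> k this r] show ?thesis by simp
  qed
  show ?thesis
    by (rule generator_recovery[OF A \<alpha> \<beta> g0 l rc c q eq step])
qed

text \<open>
  An equation \<open>\<phi> q = 0\<close> can be solved for the value \<open>s\<close> at \<open>g\<^sub>0\<close>: it reads \<open>s = - (\<phi> l + \<phi> r) / c\<close>, and the
  right-hand side depends on \<open>s\<close> in a contracting way.
\<close>

lemma ex_lie_morphism_solving:
  fixes A :: "('a, 'm) cdgl_scheme"
  assumes A: "complete_dg_lie_algebra A"
    and f: "\<And>g. \<lbrakk>g \<in> G; g \<noteq> g0\<rbrakk> \<Longrightarrow> f g \<in> elts A (deg g)"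
    and g0: "g0 \<in> G" and l: "l \<in> elts C (deg g0)" and r: "r \<in> fil C 2 (deg g0)" and c: "c \<noteq> 0"
    and q: "q = c \<odot>\<^bsub>sp C (deg g0)\<^esub> gen g0 \<oplus>\<^bsub>sp C (deg g0)\<^esub> (l \<oplus>\<^bsub>sp C (deg g0)\<^esub> r)"
    and l_indep: "\<And>\<phi> \<psi>. \<lbrakk>lie_morphism C A \<phi>; lie_morphism C A \<psi>;
        \<And>g. \<lbrakk>g \<in> G; g \<noteq> g0\<rbrakk> \<Longrightarrow> \<phi> (deg g) (gen g) = \<psi> (deg g) (gen g)\<rbrakk> \<Longrightarrow>
      \<phi> (deg g0) l = \<psi> (deg g0) l"
  shows "\<exists>\<phi>. lie_morphism C A \<phi> \<and> (\<forall>g\<in>G. g \<noteq> g0 \<longrightarrow> \<phi> (deg g) (gen g) = f g) \<and>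
    \<phi> (deg g0) q = \<zero>\<^bsub>sp A (deg g0)\<^esub>"
proof -
  interpret A: complete_dg_lie_algebra A by fact
  let ?n = "deg g0" let ?M = "sp A (deg g0)"
  have rc: "r \<in> elts C ?n" using r fil_subset[of 2] by auto
  have g0c: "gen g0 \<in> elts C ?n" by (rule gen_closed[OF g0])
  define \<Phi> where "\<Phi> s = (SOME \<phi>. lie_morphism C A \<phi> \<and> (\<forall>g\<in>G. \<phi> (deg g) (gen g) = (f(g0 := s)) g))" for s
  have \<Phi>: "lie_morphism C A (\<Phi> s) \<and> (\<forall>g\<in>G. \<Phi> s (deg g) (gen g) = (f(g0 := s)) g)"
    if s: "s \<in> elts A ?n" for s
  proof -
    have "(f(g0 := s)) g \<in> elts A (deg g)" if "g \<in> G" for g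
      using f[OF that] s by simp
    from someI_ex[OF ex_lie_morphism[OF A this]] show ?thesis unfolding \<Phi>_def .
  qed
  have \<Phi>m: "lie_morphism C A (\<Phi> s)" and \<Phi>g: "\<And>g. g \<in> G \<Longrightarrow> g \<noteq> g0 \<Longrightarrow> \<Phi> s (deg g) (gen g) = f g"
    and \<Phi>0: "\<Phi> s ?n (gen g0) = s" if "s \<in> elts A ?n" for s
    using \<Phi>[OF that] g0 by auto
  let ?T = "\<lambda>s. (- (1 / c)) \<odot>\<^bsub>?M\<^esub> (\<Phi> s ?n l \<oplus>\<^bsub>?M\<^esub> \<Phi> s ?n r)"
  have Tc: "\<Phi> s ?n l \<in> elts A ?n" "\<Phi> s ?n r \<in> elts A ?n" if "s \<in> elts A ?n" for s
    using lie_morphism_closed[OF \<Phi>m[OF that]] l rc by auto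
  have "\<exists>s\<in>elts A ?n. ?T s = s"
  proof (rule A.contraction_fixed_point)
    show "?T s \<in> elts A ?n" if "s \<in> elts A ?n" for s using Tc[OF that] by simp
    fix k :: nat and s t assume k: "1 \<le> k" and st: "fcong A k ?n s t"
    then have s: "s \<in> elts A ?n" and t: "t \<in> elts A ?n" using A.fcong_closed by blast+
    have "fcong A k (deg g) (\<Phi> s (deg g) (gen g)) (\<Phi> t (deg g) (gen g))" if "g \<in> G" for g
      using \<Phi>0[OF s] \<Phi>0[OF t] \<Phi>g[OF s that] \<Phi>g[OF t that] st A.fcong_refl[OF k f[OF that]]
      by (cases "g = g0") simp_all
    from lie_morphism_fcong_Suc[OF A \<Phi>m[OF s] \<Phi>m[OF t] k this r]
    have "fcong A (Suc k) ?n (\<Phi> s ?n r) (\<Phi> t ?n r)" .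
    moreover have "\<Phi> s ?n l = \<Phi> t ?n l"
      using l_indep[OF \<Phi>m[OF s] \<Phi>m[OF t]] \<Phi>g[OF s] \<Phi>g[OF t] by simp
    then have "fcong A (Suc k) ?n (\<Phi> s ?n l) (\<Phi> t ?n l)" using A.fcong_refl Tc[OF t] by simp
    ultimately show "fcong A (Suc k) ?n (?T s) (?T t)"
      by (intro A.fcong_smult A.fcong_add) simp_all
  qed
  then obtain s where s: "s \<in> elts A ?n" "?T s = s" by blast
  have "\<Phi> s ?n q = c \<odot>\<^bsub>?M\<^esub> s \<oplus>\<^bsub>?M\<^esub> (\<Phi> s ?n l \<oplus>\<^bsub>?M\<^esub> \<Phi> s ?n r)"
    unfolding q using l rc g0c \<Phi>0[OF s(1)]
    by (simp add: lie_morphism_ops[OF \<Phi>m[OF s(1)] complete_dg_lie_algebra_axioms A])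
  moreover have "c \<odot>\<^bsub>?M\<^esub> s = \<ominus>\<^bsub>?M\<^esub> (\<Phi> s ?n l \<oplus>\<^bsub>?M\<^esub> \<Phi> s ?n r)"
    using arg_cong[OF s(2), of "\<lambda>s. c \<odot>\<^bsub>?M\<^esub> s"] c Tc[OF s(1)]
    by (simp add: A.smult_smult A.smult_neg_1)
  ultimately have "\<Phi> s ?n q = \<zero>\<^bsub>?M\<^esub>" using Tc[OF s(1)] by (simp add: A.sp.l_neg)
  then show ?thesis using \<Phi>m[OF s(1)] \<Phi>g[OF s(1)] by blast
qed

end

section \<open>Paths and triangles in a complete dgl\<close>

lemma Q_linear_eq_finsum:
  assumes "Q_linear M N \<alpha>" "Q_linear M N \<beta>" "Module.module QQ M" "Module.module QQ N"
    and "finite I" "\<And>i. i \<in> I \<Longrightarrow> g i \<in> carrier M" "\<And>i. i \<in> I \<Longrightarrow> \<alpha> (g i) = \<beta> (g i)"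
  shows "\<alpha> (finsum M g I) = \<beta> (finsum M g I)"
proof -
  interpret N: Module.module QQ N by fact
  have "finsum N (\<lambda>i. \<alpha> (g i)) I = finsum N (\<lambda>i. \<beta> (g i)) I"
    using assms Q_linear_closed[OF assms(2)] by (intro N.finsum_cong') auto
  then show ?thesis
    using Q_linear_finsum[OF assms(1,3,4,5,6)] Q_linear_finsum[OF assms(2,3,4,5,6)] by simp
qed

lemma faces_iff: "I \<in> faces n \<longleftrightarrow> I \<noteq> {} \<and> I \<subseteq> {..n}"
  by (simp add: faces_def)

lemma face_deg_simps [simp]:
  "face_deg {i} = -1" "i \<noteq> j \<Longrightarrow> face_deg {i, j} = 0" "face_deg {..n} = int n - 1"
  by (simp_all add: face_deg_def)

lemma face_deg_remove: "\<lbrakk>finite I; i \<in> I\<rbrakk> \<Longrightarrow> face_deg (I - {i}) = face_deg I - 1"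
  using card_gt_0_iff[of I] by (auto simp: face_deg_def card_Diff_singleton of_nat_diff)

lemma faces_1: "I \<in> faces 1 \<Longrightarrow> I = {0} \<or> I = {1} \<or> I = {0, 1}"
proof -
  assume "I \<in> faces 1"
  then have "I \<subseteq> {0, 1}" "I \<noteq> {}" by (auto simp: faces_iff)
  then show ?thesis by blast
qed

lemma edges_2: "{..2} - {0} = {1, 2 :: nat}" "{..2} - {1} = {0, 2 :: nat}" "{..2} - {2} = {0, 1 :: nat}"
  "{..2} - {Suc 0} = {0, 2 :: nat}"
  by auto

lemma less_eq_2_cases: "i \<le> 2 \<Longrightarrow> i = 0 \<or> i = 1 \<or> i = (2 :: nat)"
  by auto

lemma faces_2:
  assumes "I \<in> faces 2"
  shows "(\<exists>i\<le>2. I = {i}) \<or> (\<exists>i\<le>2. I = {..2} - {i}) \<or> I = {..2}"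
proof -
  have "{..2} = {0, 1, 2 :: nat}" by auto
  then have "I \<subseteq> {0, 1, 2}" "I \<noteq> {}" using assms by (auto simp: faces_iff)
  then have "I = {0} \<or> I = {1} \<or> I = {2} \<or> I = {1, 2} \<or> I = {0, 2} \<or> I = {0, 1} \<or> I = {0, 1, 2}" by blast
  moreover have "\<exists>i\<le>2. I = {..2} - {i}" if "I = {1, 2} \<or> I = {0, 2} \<or> I = {0, 1}"
    using that edges_2(1-3)[symmetric] by (elim disjE) (blast intro: le0 one_le_numeral order_refl)+
  ultimately show ?thesis using \<open>{..2} = {0, 1, 2 :: nat}\<close> by auto
qed

lemma face_deg_edge_2: "i \<le> 2 \<Longrightarrow> face_deg ({..2} - {i}) = 0"
  using face_deg_remove[of "{..2}" i] by simp

context cosimplicial_simplex_cdgl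
begin

abbreviation "S \<equiv> simplex_cdgl d"

lemma complete_free_simplex: "complete_free (faces n) face_deg (d n)"
  using complete_dgl[of n] by (simp add: complete_free_def simplex_cdgl_def)

lemmas simplex_gen_closed = complete_free.gen_closed[OF complete_free_simplex, folded simplex_cdgl_def[of d] face_gen_def]
lemmas simplex_ex_lie_morphism =
  complete_free.ex_lie_morphism[OF complete_free_simplex, folded simplex_cdgl_def[of d] face_gen_def]
lemmas simplex_lie_morphism_eqI =
  complete_free.lie_morphism_eqI[OF complete_free_simplex, folded simplex_cdgl_def[of d] face_gen_def]
lemmas simplex_cdgl_morphismI =
  complete_free.cdgl_morphismI[OF complete_free_simplex, folded simplex_cdgl_def[of d] face_gen_def]
lemmas simplex_generator_unique =
  complete_free.lie_morphism_generator_unique[OF complete_free_simplex, folded simplex_cdgl_def[of d] face_gen_def]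
lemmas simplex_dif_commute_last_generator =
  complete_free.dif_commute_last_generator[OF complete_free_simplex, folded simplex_cdgl_def[of d] face_gen_def]
lemmas simplex_ex_lie_morphism_solving =
  complete_free.ex_lie_morphism_solving[OF complete_free_simplex, folded simplex_cdgl_def[of d] face_gen_def]

text \<open>
  The differential of a generator with the contribution of one facet singled out. That \<open>l\<close> is a combination of the
  other facets is expressed by its only use: linear maps that agree on those facets agree on \<open>l\<close>.
\<close>

lemma linear_part_isolated:
  assumes I: "I \<in> faces n" "2 \<le> card I" and i: "i \<in> I"
  defines "M \<equiv> sp (S n) (face_deg I - 1)"
  shows "\<exists>c l r. c \<noteq> 0 \<and> l \<in> carrier M \<and> r \<in> fil (S n) 2 (face_deg I - 1) \<and>
    dif (S n) (face_deg I) (face_gen n I) = c \<odot>\<^bsub>M\<^esub> face_gen n (I - {i}) \<oplus>\<^bsub>M\<^esub> (l \<oplus>\<^bsub>M\<^esub> r) \<and>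
    (\<forall>(N :: (rat, 'b) module) \<alpha> \<beta>. Module.module QQ N \<and> Q_linear M N \<alpha> \<and> Q_linear M N \<beta> \<and>
      (\<forall>m\<in>I - {i}. \<alpha> (face_gen n (I - {m})) = \<beta> (face_gen n (I - {m}))) \<longrightarrow> \<alpha> l = \<beta> l)"
proof -
  interpret C: complete_dg_lie_algebra "S n" by (rule complete_dgl)
  let ?t = "\<lambda>m. ((-1) ^ card {j\<in>I. j < m}) \<odot>\<^bsub>M\<^esub> face_gen n (I - {m})"
  have fin: "finite I" using I by (auto simp: faces_iff intro: finite_subset)
  have f: "I - {m} \<in> faces n" if "m \<in> I" for m
  proof -
    have "card (I - {m}) \<noteq> 0" using I(2) that by (simp add: card_Diff_singleton)
    then have "I - {m} \<noteq> {}" by (metis card.empty)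
    then show ?thesis using I(1) by (auto simp: faces_iff)
  qed
  have t: "?t m \<in> elts (S n) (face_deg I - 1)" if "m \<in> I" for m
    using simplex_gen_closed[OF f[OF that]] fin that by (simp add: M_def face_deg_remove)
  have l: "finsum M ?t (I - {i}) \<in> elts (S n) (face_deg I - 1)"
    unfolding M_def by (rule C.sp.finsum_closed) (use t M_def in auto)
  have s: "finsum M ?t I = ?t i \<oplus>\<^bsub>M\<^esub> finsum M ?t (I - {i})"
  proof -
    have "finsum M ?t (insert i (I - {i})) = ?t i \<oplus>\<^bsub>M\<^esub> finsum M ?t (I - {i})"
      unfolding M_def by (rule C.sp.finsum_insert) (use fin t i M_def in auto)
    then show ?thesis using i by (simp add: insert_absorb)
  qed
  define r where "r = dif (S n) (face_deg I) (face_gen n I) \<ominus>\<^bsub>M\<^esub> finsum M ?t I"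
  have r: "r \<in> fil (S n) 2 (face_deg I - 1)"
    using linear_part[OF I] by (simp add: Let_def r_def M_def)
  have rc: "r \<in> elts (S n) (face_deg I - 1)" using r C.fil_subset[of 2] by auto
  have dc: "dif (S n) (face_deg I) (face_gen n I) \<in> elts (S n) (face_deg I - 1)"
    using simplex_gen_closed[OF I(1)] by simp
  have sc: "finsum M ?t I \<in> elts (S n) (face_deg I - 1)" unfolding s using l t[OF i] by (simp add: M_def)
  have "dif (S n) (face_deg I) (face_gen n I) = r \<oplus>\<^bsub>M\<^esub> finsum M ?t I"
    using C.sp.minus_decompose(5)[OF dc sc dc dc] by (simp add: r_def M_def)
  also have "\<dots> = ?t i \<oplus>\<^bsub>M\<^esub> (finsum M ?t (I - {i}) \<oplus>\<^bsub>M\<^esub> r)"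
    unfolding s using rc l t[OF i] by (simp add: M_def C.sp.a_ac)
  finally have dec: "dif (S n) (face_deg I) (face_gen n I) = ?t i \<oplus>\<^bsub>M\<^esub> (finsum M ?t (I - {i}) \<oplus>\<^bsub>M\<^esub> r)" .
  have "\<alpha> (finsum M ?t (I - {i})) = \<beta> (finsum M ?t (I - {i}))"
    if N: "Module.module QQ N" and \<alpha>: "Q_linear M N \<alpha>" and \<beta>: "Q_linear M N \<beta>"
      and e: "\<forall>m\<in>I - {i}. \<alpha> (face_gen n (I - {m})) = \<beta> (face_gen n (I - {m}))"
    for N :: "(rat, 'b) module" and \<alpha> \<beta>
  proof (rule Q_linear_eq_finsum[OF \<alpha> \<beta> _ N])
    show "Module.module QQ M" unfolding M_def by (rule C.sp_module)
    fix m assume m: "m \<in> I - {i}"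
    then show "?t m \<in> carrier M" using t M_def by simp
    have "face_gen n (I - {m}) \<in> carrier M"
      using simplex_gen_closed[OF f] m fin by (simp add: M_def face_deg_remove)
    then show "\<alpha> (?t m) = \<beta> (?t m)" using e m by (simp add: Q_linear_smult[OF \<alpha>] Q_linear_smult[OF \<beta>])
  qed (use fin in simp)
  moreover have "finsum M ?t (I - {i}) \<in> carrier M" using l by (simp add: M_def)
  moreover have "(-1) ^ card {j\<in>I. j < i} \<noteq> (0 :: rat)" by simp
  ultimately show ?thesis
    using dec r
    by - (rule exI[of _ "(-1) ^ card {j\<in>I. j < i}"], rule exI[of _ "finsum M ?t (I - {i})"],
        rule exI[of _ r], blast)
qed

lemma interval_path: "path_relation (S 1) (face_gen 1 {0, 1}) (face_gen 1 {0}) (face_gen 1 {1})"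
  using interval by (simp add: Let_def path_relation_def ad_series_def bernoulli_exp_quotient_inverse)

text \<open>
  The gauge action preserves Maurer-Cartan elements. Send the generators of the interval to \<open>x\<close>, \<open>a\<close> and
  the result of the action. The formula for \<open>d x\<close> makes the resulting Lie morphism commute with \<open>d\<close> at the
  edge and at one vertex; since \<open>d d = 0\<close> at the edge, it does so at the other vertex.
\<close>

lemma gauge_MC:
  fixes A :: "('a, 'm) cdgl_scheme"
  assumes A: "complete_dg_lie_algebra A" and x: "x \<in> elts A 0" and a: "a \<in> MC A"
  shows "gauge A x a \<in> MC A"
proof -
  interpret A: complete_dg_lie_algebra A by fact
  interpret C: complete_dg_lie_algebra "S 1" by (rule complete_dgl)
  have ac: "a \<in> elts A (-1)" using A.MC_closed[OF a] .
  define a0 where "a0 = gauge A x a"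
  have a0: "a0 \<in> elts A (-1)" unfolding a0_def by (rule A.gauge_closed[OF x ac])
  have path: "path_relation A x a0 a" using A.gauge_iff_path[OF x a0 ac] by (simp add: a0_def)
  define f where "f I = (if I = {0} then a0 else if I = {1} then a else x)" for I :: "nat set"
  have "f I \<in> elts A (face_deg I)" if "I \<in> faces 1" for I
    using faces_1[OF that] x a0 ac by (auto simp: f_def)
  then obtain \<phi> where \<phi>: "lie_morphism (S 1) A \<phi>"
    and \<phi>g: "\<And>I. I \<in> faces 1 \<Longrightarrow> \<phi> (face_deg I) (face_gen 1 I) = f I"
    using simplex_ex_lie_morphism[OF A, of 1 f] by metis
  have F: "{0} \<in> faces 1" "{1} \<in> faces 1" "{0, 1} \<in> faces 1" by (auto simp: faces_iff)
  have g: "\<phi> (-1) (face_gen 1 {0}) = a0" "\<phi> (-1) (face_gen 1 {1}) = a" "\<phi> 0 (face_gen 1 {0, 1}) = x"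
    using \<phi>g[OF F(1)] \<phi>g[OF F(2)] \<phi>g[OF F(3)] by (auto simp: f_def)
  have gc: "face_gen 1 {0} \<in> elts (S 1) (-1)" "face_gen 1 {1} \<in> elts (S 1) (-1)" "face_gen 1 {0, 1} \<in> elts (S 1) 0"
    using simplex_gen_closed[OF F(1)] simplex_gen_closed[OF F(2)] simplex_gen_closed[OF F(3)] by simp_all
  have e: "\<phi> (-1) (dif (S 1) 0 (face_gen 1 {0, 1})) = dif A 0 x"
    using lie_morphism_path_formula[OF \<phi> C.complete_dg_lie_algebra_axioms A gc(3,1,2) interval_path] g path by simp
  have v1: "\<phi> (-2) (dif (S 1) (-1) (face_gen 1 {1})) = dif A (-1) a"
    using lie_morphism_MC_iff[OF \<phi> C.complete_dg_lie_algebra_axioms A vertex_MC[of 1 1]] g(2) a by simp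
  let ?q = "dif (S 1) 0 (face_gen 1 {0, 1})"
  have q: "\<phi> (-2) (dif (S 1) (-1) ?q) = dif A (-1) (\<phi> (-1) ?q)"
    using C.dif_dif[OF gc(3)] A.dif_dif[OF x] lie_morphism_ops(1)[OF \<phi> C.complete_dg_lie_algebra_axioms A, of "-2"]
    unfolding e by simp
  let ?M = "sp (S 1) (-1)"
  have diff: "{0, 1} - {1} = {0 :: nat}" "{0, 1} - {0} = {1 :: nat}" by auto
  obtain c l r where c: "c \<noteq> 0" and l: "l \<in> elts (S 1) (-1)" and r: "r \<in> fil (S 1) 2 (-1)"
    and dec: "?q = c \<odot>\<^bsub>?M\<^esub> face_gen 1 {0} \<oplus>\<^bsub>?M\<^esub> (l \<oplus>\<^bsub>?M\<^esub> r)"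
    and li: "\<And>(N :: (rat, 'a) module) \<alpha> \<beta>. \<lbrakk>Module.module QQ N; Q_linear ?M N \<alpha>; Q_linear ?M N \<beta>;
      \<alpha> (face_gen 1 {1}) = \<beta> (face_gen 1 {1})\<rbrakk> \<Longrightarrow> \<alpha> l = \<beta> l"
    using linear_part_isolated[of "{0, 1}" 1 1, where 'b = 'a] F(3) unfolding diff by (auto simp: diff)
  have ql: "Q_linear ?M (sp A (-2)) (\<lambda>x. \<phi> (-2) (dif (S 1) (-1) x))"
    "Q_linear ?M (sp A (-2)) (\<lambda>x. dif A (-1) (\<phi> (-1) x))"
    using Q_linear_comp[OF C.dif_linear[of "-1"] lie_morphism_linear[OF \<phi>, of "-1 - 1"]]
      Q_linear_comp[OF lie_morphism_linear[OF \<phi>, of "-1"] A.dif_linear[of "-1"]] by simp_all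
  have lc: "\<phi> (-2) (dif (S 1) (-1) l) = dif A (-1) (\<phi> (-1) l)"
    by (rule li[OF A.sp_module ql]) (use v1 g(2) in simp)
  have "\<phi> (face_deg {0} - 1) (dif (S 1) (face_deg {0}) (face_gen 1 {0})) =
      dif A (face_deg {0}) (\<phi> (face_deg {0}) (face_gen 1 {0}))"
  proof (rule simplex_dif_commute_last_generator[OF A \<phi> F(1), of l r c ?q])
    fix I :: "nat set" assume I: "I \<in> faces 1" "I \<noteq> {0}"
    then have "I = {1} \<or> I = {0, 1}" using faces_1[of I] by auto
    then show "\<phi> (face_deg I - 1) (dif (S 1) (face_deg I) (face_gen 1 I)) =
        dif A (face_deg I) (\<phi> (face_deg I) (face_gen 1 I))"
      using e v1 g by auto
  qed (use c l r dec lc q in \<open>simp_all only: face_deg_simps diff_numeral_simps diff_self\<close>, simp_all)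
  then have "\<phi> (-1) (face_gen 1 {0}) \<in> MC A"
    using lie_morphism_MC_iff[OF \<phi> C.complete_dg_lie_algebra_axioms A vertex_MC[of 0 1]] by simp
  then show ?thesis using g(1) a0_def by simp
qed

lemma coface_edge: "i \<le> 2 \<Longrightarrow> coface_map i ` {0, 1} = {..2} - {i}"
  using less_eq_2_cases[of i] by (auto simp: coface_map_def)

lemma triangle_faces:
  assumes "i \<le> 2"
  shows "{i} \<in> faces 2" "{..2} - {i} \<in> faces 2" "{..2} \<in> faces 2"
  using assms less_eq_2_cases[of i] by (auto simp: faces_iff edges_2)

lemma triangle_edge_path:
  assumes "i \<le> 2"
  shows "path_relation (S 2) (face_gen 2 ({..2} - {i}))
    (face_gen 2 {coface_map i 0}) (face_gen 2 {coface_map i 1})"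
proof -
  have F: "{0} \<in> faces 1" "{1} \<in> faces 1" "{0, 1} \<in> faces 1" by (auto simp: faces_iff)
  have gc: "face_gen 1 {0} \<in> elts (S 1) (-1)" "face_gen 1 {1} \<in> elts (S 1) (-1)" "face_gen 1 {0, 1} \<in> elts (S 1) 0"
    using simplex_gen_closed[OF F(1)] simplex_gen_closed[OF F(2)] simplex_gen_closed[OF F(3)] by simp_all
  have m: "cdgl_morphism (S 1) (S 2) (cf 1 i)"
    using coface_morphism[of i 1] assms by (simp add: numeral_2_eq_2)
  have "cf 1 i (-1) (face_gen 1 {0}) = face_gen 2 {coface_map i 0}"
    "cf 1 i (-1) (face_gen 1 {1}) = face_gen 2 {coface_map i 1}"
    "cf 1 i 0 (face_gen 1 {0, 1}) = face_gen 2 ({..2} - {i})"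
    using coface_gen[of i 1, OF _ F(1)] coface_gen[of i 1, OF _ F(2)] coface_gen[of i 1, OF _ F(3)]
      coface_edge[OF assms] assms by (simp_all add: numeral_2_eq_2)
  then show ?thesis
    using cdgl_morphism_path[OF m complete_dgl complete_dgl gc(3,1,2) interval_path] by simp
qed

text \<open>
  A triangle with vertices \<open>a 0\<close>, \<open>a 1\<close>, \<open>a 2\<close>, with the path \<open>x i\<close> opposite to the \<open>i\<close>-th vertex, and with a trivial
  filling: the edge \<open>x 1\<close> plays the part of the Baker-Campbell-Hausdorff product of the other two.
\<close>

definition triangle :: "('a, 'm) cdgl_scheme \<Rightarrow> (nat \<Rightarrow> 'a) \<Rightarrow> (nat \<Rightarrow> 'a) \<Rightarrow> bool"
  where "triangle A a x \<longleftrightarrow> (\<exists>\<phi>. cdgl_morphism (S 2) A \<phi> \<and>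
    (\<forall>i\<le>2. \<phi> (-1) (face_gen 2 {i}) = a i) \<and>
    (\<forall>i\<le>2. \<phi> 0 (face_gen 2 ({..2} - {i})) = x i) \<and>
    \<phi> 1 (face_gen 2 {..2}) = \<zero>\<^bsub>sp A 1\<^esub>)"

lemma triangle_gens:
  assumes "i \<le> 2"
  shows "face_gen 2 {i} \<in> elts (S 2) (-1)" "face_gen 2 ({..2} - {i}) \<in> elts (S 2) 0"
    "face_gen 2 {..2} \<in> elts (S 2) 1"
  using simplex_gen_closed[OF triangle_faces(1)[OF assms]] simplex_gen_closed[OF triangle_faces(2)[OF assms]]
    simplex_gen_closed[OF triangle_faces(3)[OF assms]] face_deg_edge_2[OF assms] by simp_all

lemma triangle_map:
  assumes t: "triangle A a x" and p: "cdgl_morphism A B p"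
    and A: "complete_dg_lie_algebra A" and B: "complete_dg_lie_algebra B"
  shows "triangle B (\<lambda>i. p (-1) (a i)) (\<lambda>i. p 0 (x i))"
proof -
  obtain \<phi> where \<phi>: "cdgl_morphism (S 2) A \<phi>" "\<forall>i\<le>2. \<phi> (-1) (face_gen 2 {i}) = a i"
    "\<forall>i\<le>2. \<phi> 0 (face_gen 2 ({..2} - {i})) = x i" "\<phi> 1 (face_gen 2 {..2}) = \<zero>\<^bsub>sp A 1\<^esub>"
    using t by (auto simp: triangle_def)
  show ?thesis
    unfolding triangle_def
    using cdgl_morphism_comp[OF \<phi>(1) p] \<phi>(2-4) lie_morphism_ops(1)[OF cdgl_morphism_lie[OF p] A B]
    by (intro exI[of _ "\<lambda>n x. p n (\<phi> n x)"]) simp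
qed

lemma triangle_path:
  assumes t: "triangle A a x" and A: "complete_dg_lie_algebra A" and i: "i \<le> 2"
  shows "x i \<in> elts A 0" "path_relation A (x i) (a (coface_map i 0)) (a (coface_map i 1))"
proof -
  obtain \<phi> where \<phi>: "cdgl_morphism (S 2) A \<phi>" "\<forall>i\<le>2. \<phi> (-1) (face_gen 2 {i}) = a i"
    "\<forall>i\<le>2. \<phi> 0 (face_gen 2 ({..2} - {i})) = x i" "\<phi> 1 (face_gen 2 {..2}) = \<zero>\<^bsub>sp A 1\<^esub>"
    using t by (auto simp: triangle_def)
  have v: "coface_map i 0 \<le> 2" "coface_map i 1 \<le> 2" by (auto simp: coface_map_def)
  show "x i \<in> elts A 0"
    using lie_morphism_closed[OF cdgl_morphism_lie[OF \<phi>(1)] triangle_gens(2)[OF i]] \<phi>(3) i by simp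
  show "path_relation A (x i) (a (coface_map i 0)) (a (coface_map i 1))"
    using cdgl_morphism_path[OF \<phi>(1) complete_dgl A triangle_gens(2)[OF i] triangle_gens(1)[OF v(1)]
        triangle_gens(1)[OF v(2)] triangle_edge_path[OF i]] \<phi>(2,3) i v by simp
qed

text \<open>
  The twisted differential of the top generator of the triangle: it has linear part
  \<open>a\<^sub>1\<^sub>2 - a\<^sub>0\<^sub>2 + a\<^sub>0\<^sub>1\<close>, so every edge can be isolated in it.
\<close>

definition triangle_relation :: "simp_elt"
  where "triangle_relation = twisted_dif (S 2) (face_gen 2 {0}) 1 (face_gen 2 {..2})"

lemma triangle_relation_isolated:
  assumes i: "i \<le> 2"
  shows "\<exists>c l r. c \<noteq> 0 \<and> l \<in> elts (S 2) 0 \<and> r \<in> fil (S 2) 2 0 \<and>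
    triangle_relation = c \<odot>\<^bsub>sp (S 2) 0\<^esub> face_gen 2 ({..2} - {i}) \<oplus>\<^bsub>sp (S 2) 0\<^esub> (l \<oplus>\<^bsub>sp (S 2) 0\<^esub> r) \<and>
    (\<forall>(N :: (rat, 'b) module) \<alpha> \<beta>. Module.module QQ N \<and> Q_linear (sp (S 2) 0) N \<alpha> \<and> Q_linear (sp (S 2) 0) N \<beta> \<and>
      (\<forall>m\<le>2. m \<noteq> i \<longrightarrow> \<alpha> (face_gen 2 ({..2} - {m})) = \<beta> (face_gen 2 ({..2} - {m}))) \<longrightarrow> \<alpha> l = \<beta> l)"
proof -
  interpret C: complete_dg_lie_algebra "S 2" by (rule complete_dgl)
  let ?M = "sp (S 2) 0"
  obtain c l r where c: "c \<noteq> 0" and l: "l \<in> elts (S 2) 0" and r: "r \<in> fil (S 2) 2 0"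
    and dec: "dif (S 2) 1 (face_gen 2 {..2}) = c \<odot>\<^bsub>?M\<^esub> face_gen 2 ({..2} - {i}) \<oplus>\<^bsub>?M\<^esub> (l \<oplus>\<^bsub>?M\<^esub> r)"
    and li: "\<forall>(N :: (rat, 'b) module) \<alpha> \<beta>. Module.module QQ N \<and> Q_linear ?M N \<alpha> \<and> Q_linear ?M N \<beta> \<and>
      (\<forall>m\<in>{..2} - {i}. \<alpha> (face_gen 2 ({..2} - {m})) = \<beta> (face_gen 2 ({..2} - {m}))) \<longrightarrow> \<alpha> l = \<beta> l"
    using linear_part_isolated[of "{..2}" 2 i, where 'b = 'b] triangle_faces(3)[OF i] i by auto
  let ?b = "brk (S 2) (-1) 1 (face_gen 2 {0}) (face_gen 2 {..2})"
  have b: "?b \<in> fil (S 2) 2 0"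
    using C.fil_brk[of 1 1 "face_gen 2 {0}" "-1" "face_gen 2 {..2}" 1] C.fil_one triangle_gens[of 0]
    by (simp add: numeral_2_eq_2)
  have rb: "r \<oplus>\<^bsub>?M\<^esub> ?b \<in> fil (S 2) 2 0" using C.fil_mem(2)[OF _ r b] by simp
  have "triangle_relation = dif (S 2) 1 (face_gen 2 {..2}) \<oplus>\<^bsub>?M\<^esub> ?b"
    by (simp add: triangle_relation_def twisted_dif_def)
  also have "\<dots> = c \<odot>\<^bsub>?M\<^esub> face_gen 2 ({..2} - {i}) \<oplus>\<^bsub>?M\<^esub> (l \<oplus>\<^bsub>?M\<^esub> (r \<oplus>\<^bsub>?M\<^esub> ?b))"
    unfolding dec using l subsetD[OF C.fil_subset r] subsetD[OF C.fil_subset b] triangle_gens(2)[OF i]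
    by (simp add: C.sp.a_assoc)
  finally have dec': "triangle_relation = c \<odot>\<^bsub>?M\<^esub> face_gen 2 ({..2} - {i}) \<oplus>\<^bsub>?M\<^esub> (l \<oplus>\<^bsub>?M\<^esub> (r \<oplus>\<^bsub>?M\<^esub> ?b))" .
  have li': "\<forall>(N :: (rat, 'b) module) \<alpha> \<beta>. Module.module QQ N \<and> Q_linear ?M N \<alpha> \<and> Q_linear ?M N \<beta> \<and>
      (\<forall>m\<le>2. m \<noteq> i \<longrightarrow> \<alpha> (face_gen 2 ({..2} - {m})) = \<beta> (face_gen 2 ({..2} - {m}))) \<longrightarrow> \<alpha> l = \<beta> l"
  proof (intro allI impI)
    fix N :: "(rat, 'b) module" and \<alpha> \<beta>
    assume "Module.module QQ N \<and> Q_linear ?M N \<alpha> \<and> Q_linear ?M N \<beta> \<and>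
      (\<forall>m\<le>2. m \<noteq> i \<longrightarrow> \<alpha> (face_gen 2 ({..2} - {m})) = \<beta> (face_gen 2 ({..2} - {m})))"
    then show "\<alpha> l = \<beta> l"
      by (intro li[THEN spec, THEN spec, THEN spec, THEN mp, of N \<alpha> \<beta>]) auto
  qed
  show ?thesis
    by (rule exI[of _ c], rule exI[of _ l], rule exI[of _ "r \<oplus>\<^bsub>?M\<^esub> ?b"]) (intro conjI c l rb dec' li')
qed

lemma triangle_relation_vanishes:
  assumes \<phi>: "cdgl_morphism (S 2) A \<phi>" and A: "complete_dg_lie_algebra A"
    and top: "\<phi> 1 (face_gen 2 {..2}) = \<zero>\<^bsub>sp A 1\<^esub>"
  shows "\<phi> 0 triangle_relation = \<zero>\<^bsub>sp A 0\<^esub>"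
proof -
  interpret A: complete_dg_lie_algebra A by fact
  have v: "\<phi> (-1) (face_gen 2 {0}) \<in> elts A (-1)"
    using lie_morphism_closed[OF cdgl_morphism_lie[OF \<phi>] triangle_gens(1)[of 0]] by simp
  then show ?thesis
    using cdgl_morphism_twisted_dif[OF \<phi> complete_dgl A triangle_gens(1,3)[of 0]] top
      A.twisted_dif_zero[OF v, of 1] by (simp add: triangle_relation_def)
qed

text \<open>
  Both morphisms vanish on the relation, in which the edge in question can be isolated.
\<close>

lemma triangle_unique:
  fixes A :: "('a, 'm) cdgl_scheme"
  assumes t: "triangle A a x" and u: "triangle A a y" and A: "complete_dg_lie_algebra A" and i: "i \<le> 2"
    and eq: "\<And>m. \<lbrakk>m \<le> 2; m \<noteq> i\<rbrakk> \<Longrightarrow> x m = y m"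
  shows "x i = y i"
proof -
  interpret A: complete_dg_lie_algebra A by fact
  obtain \<phi> where \<phi>: "cdgl_morphism (S 2) A \<phi>" "\<forall>i\<le>2. \<phi> (-1) (face_gen 2 {i}) = a i"
    "\<forall>i\<le>2. \<phi> 0 (face_gen 2 ({..2} - {i})) = x i" "\<phi> 1 (face_gen 2 {..2}) = \<zero>\<^bsub>sp A 1\<^esub>"
    using t by (auto simp: triangle_def)
  obtain \<psi> where \<psi>: "cdgl_morphism (S 2) A \<psi>" "\<forall>i\<le>2. \<psi> (-1) (face_gen 2 {i}) = a i"
    "\<forall>i\<le>2. \<psi> 0 (face_gen 2 ({..2} - {i})) = y i" "\<psi> 1 (face_gen 2 {..2}) = \<zero>\<^bsub>sp A 1\<^esub>"
    using u by (auto simp: triangle_def)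
  note l = cdgl_morphism_lie[OF \<phi>(1)] cdgl_morphism_lie[OF \<psi>(1)]
  have gens: "\<phi> (face_deg I) (face_gen 2 I) = \<psi> (face_deg I) (face_gen 2 I)"
    if "I \<in> faces 2" "I \<noteq> {..2} - {i}" for I
    using faces_2[OF that(1)] that(2) \<phi>(2-4) \<psi>(2-4) eq by (elim disjE exE conjE) (auto simp: face_deg_edge_2)
  let ?E = "{..2} - {i}" let ?M = "sp (S 2) 0"
  obtain c l r where c: "c \<noteq> 0" and lc: "l \<in> elts (S 2) 0" and r: "r \<in> fil (S 2) 2 0"
    and dec: "triangle_relation = c \<odot>\<^bsub>?M\<^esub> face_gen 2 ?E \<oplus>\<^bsub>?M\<^esub> (l \<oplus>\<^bsub>?M\<^esub> r)"
    and li: "\<And>(N :: (rat, 'a) module) \<alpha> \<beta>. \<lbrakk>Module.module QQ N; Q_linear ?M N \<alpha>; Q_linear ?M N \<beta>;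
      \<And>m. \<lbrakk>m \<le> 2; m \<noteq> i\<rbrakk> \<Longrightarrow> \<alpha> (face_gen 2 ({..2} - {m})) = \<beta> (face_gen 2 ({..2} - {m}))\<rbrakk> \<Longrightarrow> \<alpha> l = \<beta> l"
    using triangle_relation_isolated[OF i, where 'b = 'a] by blast
  have "\<phi> 0 l = \<psi> 0 l"
    by (rule li[OF A.sp_module lie_morphism_linear[OF l(1)] lie_morphism_linear[OF l(2)]])
      (use \<phi>(3) \<psi>(3) eq in simp)
  moreover have "\<phi> 0 triangle_relation = \<psi> 0 triangle_relation"
    using triangle_relation_vanishes[OF \<phi>(1) A \<phi>(4)] triangle_relation_vanishes[OF \<psi>(1) A \<psi>(4)] by simp
  ultimately have "\<phi> (face_deg ?E) (face_gen 2 ?E) = \<psi> (face_deg ?E) (face_gen 2 ?E)"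
    using c lc r dec
    by (intro simplex_generator_unique[OF A l triangle_faces(2)[OF i], of l r c triangle_relation] gens)
      (simp_all only: face_deg_edge_2[OF i] not_False_eq_True)
  then show ?thesis using \<phi>(3) \<psi>(3) i by (simp add: face_deg_edge_2[OF i])
qed

text \<open>
  Horns can be filled: solve the relation of the triangle for the missing edge, with the top generator sent
  to zero. The twisted differential of the relation vanishes identically, so the resulting Lie morphism commutes
  with \<open>d\<close> at the relation and hence also at the missing edge.
\<close>

lemma triangle_horn:
  fixes A :: "('a, 'm) cdgl_scheme"
  assumes A: "complete_dg_lie_algebra A" and i: "i \<le> 2"
    and a: "\<And>m. m \<le> 2 \<Longrightarrow> a m \<in> MC A"
    and x: "\<And>m. \<lbrakk>m \<le> 2; m \<noteq> i\<rbrakk> \<Longrightarrow> x m \<in> elts A 0"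
    and path: "\<And>m. \<lbrakk>m \<le> 2; m \<noteq> i\<rbrakk> \<Longrightarrow>
      path_relation A (x m) (a (coface_map m 0)) (a (coface_map m 1))"
  shows "\<exists>s. triangle A a (x(i := s))"
proof -
  interpret A: complete_dg_lie_algebra A by fact
  interpret C: complete_dg_lie_algebra "S 2" by (rule complete_dgl)
  let ?E = "{..2} - {i}" let ?M = "sp (S 2) 0"
  define f where "f I = (if \<exists>m\<le>2. I = {m} then a (the_elem I) else if I = {..2} then \<zero>\<^bsub>sp A 1\<^esub>
      else x (THE m. m \<le> 2 \<and> I = {..2} - {m}))" for I :: "nat set"
  have no_edge: "{..2} - {m} \<noteq> {k}" "{..2} \<noteq> {k}" "{..2} - {m} \<noteq> {..2}" if m: "m \<le> 2" for m k :: nat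
  proof -
    have neq: "X \<noteq> Y" if "card X \<noteq> card Y" for X Y :: "nat set" using that by auto
    show "{..2} - {m} \<noteq> {k}" "{..2} \<noteq> {k}" "{..2} - {m} \<noteq> {..2}"
      using m by (intro neq; simp)+
  qed
  have the: "(THE k. k \<le> 2 \<and> {..2} - {m} = {..2} - {k}) = m" if "m \<le> 2" for m :: nat
    using that by (intro the_equality) auto
  have fv: "f {m} = a m" if "m \<le> 2" for m using that by (auto simp: f_def)
  have fe: "f ({..2} - {m}) = x m" if "m \<le> 2" for m using no_edge[OF that] the[OF that] by (simp add: f_def)
  have ft: "f {..2} = \<zero>\<^bsub>sp A 1\<^esub>" using no_edge[of 0] by (auto simp: f_def)
  have fc: "f I \<in> elts A (face_deg I)" if I: "I \<in> faces 2" "I \<noteq> ?E" for I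
  proof -
    consider m where "m \<le> 2" "I = {m}" | m where "m \<le> 2" "m \<noteq> i" "I = {..2} - {m}" | "I = {..2}"
      using faces_2[OF I(1)] I(2) by blast
    then show ?thesis
      by cases (simp_all add: fv fe ft A.MC_closed a x face_deg_edge_2)
  qed
  obtain c l r where c: "c \<noteq> 0" and lc: "l \<in> elts (S 2) 0" and r: "r \<in> fil (S 2) 2 0"
    and dec: "triangle_relation = c \<odot>\<^bsub>?M\<^esub> face_gen 2 ?E \<oplus>\<^bsub>?M\<^esub> (l \<oplus>\<^bsub>?M\<^esub> r)"
    and li: "\<And>(N :: (rat, 'a) module) \<alpha> \<beta>. \<lbrakk>Module.module QQ N; Q_linear ?M N \<alpha>; Q_linear ?M N \<beta>;
      \<And>m. \<lbrakk>m \<le> 2; m \<noteq> i\<rbrakk> \<Longrightarrow> \<alpha> (face_gen 2 ({..2} - {m})) = \<beta> (face_gen 2 ({..2} - {m}))\<rbrakk> \<Longrightarrow> \<alpha> l = \<beta> l"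
    using triangle_relation_isolated[OF i, where 'b = 'a] by blast
  have E: "?E \<in> faces 2" "{..2} \<in> faces 2" using triangle_faces[OF i] by auto
  note d0 = face_deg_edge_2[OF i]
  obtain \<phi> where \<phi>: "lie_morphism (S 2) A \<phi>"
    and \<phi>f: "\<And>I. I \<in> faces 2 \<Longrightarrow> I \<noteq> ?E \<Longrightarrow> \<phi> (face_deg I) (face_gen 2 I) = f I"
    and \<phi>P: "\<phi> 0 triangle_relation = \<zero>\<^bsub>sp A 0\<^esub>"
  proof -
    have "\<exists>\<phi>. lie_morphism (S 2) A \<phi> \<and> (\<forall>g\<in>faces 2. g \<noteq> ?E \<longrightarrow> \<phi> (face_deg g) (face_gen 2 g) = f g) \<and>
        \<phi> (face_deg ?E) triangle_relation = \<zero>\<^bsub>sp A (face_deg ?E)\<^esub>"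
    proof (rule simplex_ex_lie_morphism_solving[OF A fc E(1), of l r c])
      fix \<phi> \<psi> assume \<phi>: "lie_morphism (S 2) A \<phi>" and \<psi>: "lie_morphism (S 2) A \<psi>"
        and e: "\<And>g. \<lbrakk>g \<in> faces 2; g \<noteq> ?E\<rbrakk> \<Longrightarrow> \<phi> (face_deg g) (face_gen 2 g) = \<psi> (face_deg g) (face_gen 2 g)"
      have "\<phi> 0 (face_gen 2 ({..2} - {m})) = \<psi> 0 (face_gen 2 ({..2} - {m}))" if "m \<le> 2" "m \<noteq> i" for m
        using e[OF triangle_faces(2)[OF that(1)]] that i face_deg_edge_2[OF that(1)] by auto
      then show "\<phi> (face_deg ?E) l = \<psi> (face_deg ?E) l"
        unfolding d0 by (intro li[OF A.sp_module lie_morphism_linear[OF \<phi>] lie_morphism_linear[OF \<psi>]])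
    qed (use c lc r dec in \<open>simp_all only: d0 not_False_eq_True\<close>)
    then show ?thesis using that unfolding d0 by blast
  qed
  have \<phi>v: "\<phi> (-1) (face_gen 2 {m}) = a m" if "m \<le> 2" for m
    using \<phi>f[OF triangle_faces(1)[OF that]] no_edge(1)[OF i, of m] fv[OF that] by auto
  have \<phi>e: "\<phi> 0 (face_gen 2 ({..2} - {m})) = x m" if "m \<le> 2" "m \<noteq> i" for m
    using \<phi>f[OF triangle_faces(2)[OF that(1)]] that i fe[OF that(1)] face_deg_edge_2[OF that(1)] by auto
  have \<phi>t: "\<phi> 1 (face_gen 2 {..2}) = \<zero>\<^bsub>sp A 1\<^esub>"
    using \<phi>f[OF E(2)] no_edge(3)[OF i] ft by auto
  note g = triangle_gens[OF i]
  have v0: "face_gen 2 {0} \<in> elts (S 2) (-1)" "face_gen 2 {0} \<in> MC (S 2)"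
    using triangle_gens(1)[of 0] vertex_MC[of 0 2] by auto
  note ops = lie_morphism_ops[OF \<phi> C.complete_dg_lie_algebra_axioms A]
  have cv: "\<phi> (-2) (dif (S 2) (-1) (face_gen 2 {m})) = dif A (-1) (\<phi> (-1) (face_gen 2 {m}))" if m: "m \<le> 2" for m
    using lie_morphism_MC_iff[OF \<phi> C.complete_dg_lie_algebra_axioms A vertex_MC[OF m]] \<phi>v[OF m] a[OF m] by simp
  have ce: "\<phi> (-1) (dif (S 2) 0 (face_gen 2 ({..2} - {m}))) = dif A 0 (\<phi> 0 (face_gen 2 ({..2} - {m})))"
    if m: "m \<le> 2" "m \<noteq> i" for m
  proof -
    have v: "coface_map m 0 \<le> 2" "coface_map m 1 \<le> 2" by (auto simp: coface_map_def)
    show ?thesis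
      using lie_morphism_path_formula[OF \<phi> C.complete_dg_lie_algebra_axioms A triangle_gens(2)[OF m(1)]
          triangle_gens(1)[OF v(1)] triangle_gens(1)[OF v(2)] triangle_edge_path[OF m(1)]]
        path[OF m] \<phi>e[OF m] \<phi>v[OF v(1)] \<phi>v[OF v(2)] by simp
  qed
  let ?b = "brk (S 2) (-1) 1 (face_gen 2 {0}) (face_gen 2 {..2})"
  have b: "?b \<in> elts (S 2) 0" using C.brk_closed[OF v0(1) g(3)] by simp
  have dt: "dif (S 2) 1 (face_gen 2 {..2}) \<in> elts (S 2) 0" using C.dif_closed[OF g(3)] by simp
  have \<phi>b: "\<phi> 0 ?b = \<zero>\<^bsub>sp A 0\<^esub>"
    using lie_morphism_brk[OF \<phi> v0(1) g(3)] \<phi>t A.brk_zero_right[OF lie_morphism_closed[OF \<phi> v0(1)], of 1] by simp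
  have ct: "\<phi> 0 (dif (S 2) 1 (face_gen 2 {..2})) = dif A 1 (\<phi> 1 (face_gen 2 {..2}))"
  proof -
    have "\<phi> 0 (dif (S 2) 1 (face_gen 2 {..2})) \<oplus>\<^bsub>sp A 0\<^esub> \<phi> 0 ?b = \<zero>\<^bsub>sp A 0\<^esub>"
      using \<phi>P dt b by (simp add: triangle_relation_def twisted_dif_def ops)
    then show ?thesis using \<phi>b \<phi>t lie_morphism_closed[OF \<phi> dt] A.dif_zero[of 1] by simp
  qed
  have P: "triangle_relation \<in> elts (S 2) 0"
    unfolding triangle_relation_def using C.twisted_dif_closed[OF v0(1) g(3)] by simp
  have "twisted_dif (S 2) (face_gen 2 {0}) 0 triangle_relation = \<zero>\<^bsub>sp (S 2) (-1)\<^esub>"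
    using C.twisted_dif_square[OF v0(2) g(3)] by (simp add: triangle_relation_def)
  then have dP: "dif (S 2) 0 triangle_relation = \<ominus>\<^bsub>sp (S 2) (-1)\<^esub> brk (S 2) (-1) 0 (face_gen 2 {0}) triangle_relation"
    using C.dif_twisted_cycle[OF v0(1) P] by simp
  have "brk (S 2) (-1) 0 (face_gen 2 {0}) triangle_relation \<in> elts (S 2) (-1)"
    using C.brk_closed[OF v0(1) P] by simp
  then have "\<phi> (-1) (dif (S 2) 0 triangle_relation) = \<zero>\<^bsub>sp A (-1)\<^esub>"
    unfolding dP using lie_morphism_brk[OF \<phi> v0(1) P] \<phi>P
      A.brk_zero_right[OF lie_morphism_closed[OF \<phi> v0(1)], of 0] by (simp add: ops)
  then have cP: "\<phi> (-1) (dif (S 2) 0 triangle_relation) = dif A 0 (\<phi> 0 triangle_relation)"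
    using \<phi>P A.dif_zero[of 0] by simp
  have ql: "Q_linear ?M (sp A (-1)) (\<lambda>x. \<phi> (-1) (dif (S 2) 0 x))"
    "Q_linear ?M (sp A (-1)) (\<lambda>x. dif A 0 (\<phi> 0 x))"
    using Q_linear_comp[OF C.dif_linear[of 0] lie_morphism_linear[OF \<phi>, of "0 - 1"]]
      Q_linear_comp[OF lie_morphism_linear[OF \<phi>, of 0] A.dif_linear[of 0]] by simp_all
  have cl: "\<phi> (-1) (dif (S 2) 0 l) = dif A 0 (\<phi> 0 l)"
    by (rule li[OF A.sp_module ql]) (rule ce)
  have other: "\<phi> (face_deg I - 1) (dif (S 2) (face_deg I) (face_gen 2 I)) = dif A (face_deg I) (\<phi> (face_deg I) (face_gen 2 I))"
    if I: "I \<in> faces 2" "I \<noteq> ?E" for I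
  proof -
    consider m where "m \<le> 2" "I = {m}" | m where "m \<le> 2" "m \<noteq> i" "I = {..2} - {m}" | "I = {..2}"
      using faces_2[OF I(1)] I(2) by blast
    then show ?thesis
      by cases (simp_all add: cv ce ct face_deg_edge_2)
  qed
  have "\<phi> (face_deg ?E - 1) (dif (S 2) (face_deg ?E) (face_gen 2 ?E)) = dif A (face_deg ?E) (\<phi> (face_deg ?E) (face_gen 2 ?E))"
    by (rule simplex_dif_commute_last_generator[OF A \<phi> E(1), of l r c triangle_relation, OF _ _ c _ _ _ other])
      (use lc r dec cl cP in \<open>simp_all add: d0\<close>)
  with other have "cdgl_morphism (S 2) A \<phi>"
    by (intro simplex_cdgl_morphismI[OF A \<phi>]) metis
  moreover have "\<forall>m\<le>2. \<phi> 0 (face_gen 2 ({..2} - {m})) = (x(i := \<phi> 0 (face_gen 2 ?E))) m"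
    using \<phi>e by simp
  ultimately show ?thesis using \<phi>v \<phi>t unfolding triangle_def by blast
qed

text \<open>
  Families indexed by the vertices of the triangle; a family of edges is indexed by the opposite vertices.
\<close>

definition three :: "'b \<Rightarrow> 'b \<Rightarrow> 'b \<Rightarrow> nat \<Rightarrow> 'b"
  where "three p q r m = (if m = 0 then p else if m = 1 then q else r)"

lemma three_simps [simp]:
  "three p q r 0 = p" "three p q r (Suc 0) = q" "three p q r 2 = r"
  "(three p q r)(0 := s) = three s q r" "(three p q r)(Suc 0 := s) = three p s r"
  "coface_map 0 0 = Suc 0" "coface_map 0 (Suc 0) = 2" "coface_map (Suc 0) 0 = 0"
  "coface_map (Suc 0) (Suc 0) = 2" "coface_map 2 0 = 0" "coface_map 2 (Suc 0) = Suc 0"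
  by (auto simp: three_def coface_map_def fun_eq_iff)

lemma triangle_cong:
  assumes "triangle A a x" "\<And>i. i \<le> 2 \<Longrightarrow> x i = y i" shows "triangle A a y"
  using assms unfolding triangle_def by metis

lemma triangle_three_path:
  assumes "triangle A (three a0 a1 a2) (three x0 x1 x2)" "complete_dg_lie_algebra A"
  shows "x0 \<in> elts A 0" "path_relation A x0 a1 a2"
    and "x1 \<in> elts A 0" "path_relation A x1 a0 a2"
    and "x2 \<in> elts A 0" "path_relation A x2 a0 a1"
  using triangle_path[OF assms, of 0] triangle_path[OF assms, of 1] triangle_path[OF assms, of 2] by simp_all

lemma triangle_three_horn:
  assumes A: "complete_dg_lie_algebra A" and a: "a0 \<in> MC A" "a1 \<in> MC A" "a2 \<in> MC A"
  shows "\<lbrakk>x1 \<in> elts A 0; path_relation A x1 a0 a2; x2 \<in> elts A 0; path_relation A x2 a0 a1\<rbrakk> \<Longrightarrow>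
      \<exists>s. triangle A (three a0 a1 a2) (three s x1 x2)"
    and "\<lbrakk>x0 \<in> elts A 0; path_relation A x0 a1 a2; x2 \<in> elts A 0; path_relation A x2 a0 a1\<rbrakk> \<Longrightarrow>
      \<exists>s. triangle A (three a0 a1 a2) (three x0 s x2)"
    and "\<lbrakk>x0 \<in> elts A 0; path_relation A x0 a1 a2; x1 \<in> elts A 0; path_relation A x1 a0 a2\<rbrakk> \<Longrightarrow>
      \<exists>s. triangle A (three a0 a1 a2) (three x0 x1 s)"
proof -
  have M: "three a0 a1 a2 m \<in> MC A" if "m \<le> 2" for m
    using less_eq_2_cases[OF that] a by auto
  { assume h: "x1 \<in> elts A 0" "path_relation A x1 a0 a2" "x2 \<in> elts A 0" "path_relation A x2 a0 a1"
    have "\<exists>s. triangle A (three a0 a1 a2) ((three x1 x1 x2)(0 := s))"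
    proof (rule triangle_horn[OF A _ M])
      fix m :: nat assume "m \<le> 2" "m \<noteq> 0"
      then have "m = 1 \<or> m = 2" by auto
      then show "three x1 x1 x2 m \<in> elts A 0"
        "path_relation A (three x1 x1 x2 m) (three a0 a1 a2 (coface_map m 0)) (three a0 a1 a2 (coface_map m 1))"
        using h by auto
    qed simp_all
    then show "\<exists>s. triangle A (three a0 a1 a2) (three s x1 x2)" by simp }
  { assume h: "x0 \<in> elts A 0" "path_relation A x0 a1 a2" "x2 \<in> elts A 0" "path_relation A x2 a0 a1"
    have "\<exists>s. triangle A (three a0 a1 a2) ((three x0 x0 x2)(Suc 0 := s))"
    proof (rule triangle_horn[OF A _ M])
      fix m :: nat assume "m \<le> 2" "m \<noteq> Suc 0"
      then have "m = 0 \<or> m = 2" by auto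
      then show "three x0 x0 x2 m \<in> elts A 0"
        "path_relation A (three x0 x0 x2 m) (three a0 a1 a2 (coface_map m 0)) (three a0 a1 a2 (coface_map m 1))"
        using h by auto
    qed simp_all
    then show "\<exists>s. triangle A (three a0 a1 a2) (three x0 s x2)" by simp }
  { assume h: "x0 \<in> elts A 0" "path_relation A x0 a1 a2" "x1 \<in> elts A 0" "path_relation A x1 a0 a2"
    have "\<exists>s. triangle A (three a0 a1 a2) ((three x0 x1 x1)(2 := s))"
    proof (rule triangle_horn[OF A _ M])
      fix m :: nat assume "m \<le> 2" "m \<noteq> 2"
      then have "m = 0 \<or> m = 1" by auto
      then show "three x0 x1 x1 m \<in> elts A 0"
        "path_relation A (three x0 x1 x1 m) (three a0 a1 a2 (coface_map m 0)) (three a0 a1 a2 (coface_map m 1))"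
        using h by auto
    qed simp_all
    then obtain s where "triangle A (three a0 a1 a2) ((three x0 x1 x1)(2 := s))" ..
    then have "triangle A (three a0 a1 a2) (three x0 x1 s)"
      by (rule triangle_cong) (auto simp: three_def)
    then show "\<exists>s. triangle A (three a0 a1 a2) (three x0 x1 s)" .. }
qed

section \<open>Gauge orbits\<close>

text \<open>Filling horns shows that gauge equivalence is transitive and symmetric.\<close>

lemma gauge_orbit_iff:
  assumes "complete_dg_lie_algebra A" "a \<in> MC A"
  shows "b \<in> gauge_orbit A a \<longleftrightarrow> b \<in> MC A \<and> (\<exists>x\<in>elts A 0. path_relation A x b a)"
proof -
  interpret A: complete_dg_lie_algebra A by fact
  note ac = A.MC_closed[OF assms(2)]
  show ?thesis
  proof
    assume "b \<in> gauge_orbit A a"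
    then obtain x where x: "x \<in> elts A 0" "b = gauge A x a" by (auto simp: gauge_orbit_def)
    then show "b \<in> MC A \<and> (\<exists>x\<in>elts A 0. path_relation A x b a)"
      using gauge_MC[OF assms(1) x(1) assms(2)] A.gauge_iff_path[OF x(1) A.gauge_closed[OF x(1) ac] ac] by auto
  next
    assume "b \<in> MC A \<and> (\<exists>x\<in>elts A 0. path_relation A x b a)"
    then show "b \<in> gauge_orbit A a"
      using A.gauge_iff_path[OF _ A.MC_closed ac] by (auto simp: gauge_orbit_def)
  qed
qed

lemma gauge_orbit_self:
  assumes "complete_dg_lie_algebra A" "a \<in> MC A" shows "a \<in> gauge_orbit A a"
proof -
  interpret A: complete_dg_lie_algebra A by fact
  show ?thesis
    using A.path_relation_zero[OF A.MC_closed[OF assms(2)]] gauge_orbit_iff[OF assms] assms(2) by blast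
qed

lemma gauge_orbit_eq:
  assumes A: "complete_dg_lie_algebra A" and a: "a \<in> MC A" and b: "b \<in> gauge_orbit A a"
  shows "gauge_orbit A b = gauge_orbit A a"
proof -
  obtain u where bM: "b \<in> MC A" and u: "u \<in> elts A 0" "path_relation A u b a"
    using b unfolding gauge_orbit_iff[OF A a] by blast
  have "c \<in> gauge_orbit A a" if hc: "c \<in> gauge_orbit A b" for c
  proof -
    obtain v where cM: "c \<in> MC A" and v: "v \<in> elts A 0" "path_relation A v c b"
      using hc unfolding gauge_orbit_iff[OF A bM] by blast
    obtain s where "triangle A (three c b a) (three u s v)"
      using triangle_three_horn(2)[OF A cM bM a u v] by blast
    then show ?thesis
      using triangle_three_path(3,4)[OF _ A] cM unfolding gauge_orbit_iff[OF A a] by blast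
  qed
  moreover have "c \<in> gauge_orbit A b" if hc: "c \<in> gauge_orbit A a" for c
  proof -
    obtain v where cM: "c \<in> MC A" and v: "v \<in> elts A 0" "path_relation A v c a"
      using hc unfolding gauge_orbit_iff[OF A a] by blast
    obtain s where "triangle A (three c b a) (three u v s)"
      using triangle_three_horn(3)[OF A cM bM a u v] by blast
    then show ?thesis
      using triangle_three_path(5,6)[OF _ A] cM unfolding gauge_orbit_iff[OF A bM] by blast
  qed
  ultimately show ?thesis by blast
qed

lemma MC_orbits_map_orbit:
  assumes A: "complete_dg_lie_algebra A" and B: "complete_dg_lie_algebra B"
    and f: "cdgl_morphism A B f" and a: "a \<in> MC A"
  shows "MC_orbits_map B f (gauge_orbit A a) = gauge_orbit B (f (-1) a)"
proof -
  interpret A: complete_dg_lie_algebra A by fact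
  have "gauge_orbit B (f (-1) c) = gauge_orbit B (f (-1) a)" if hc: "c \<in> gauge_orbit A a" for c
  proof (rule gauge_orbit_eq[OF B cdgl_morphism_MC[OF f A B a]])
    obtain x where x: "c \<in> MC A" "x \<in> elts A 0" "path_relation A x c a"
      using hc unfolding gauge_orbit_iff[OF A a] by blast
    then show "f (-1) c \<in> gauge_orbit B (f (-1) a)"
      using gauge_orbit_iff[OF B cdgl_morphism_MC[OF f A B a]] cdgl_morphism_MC[OF f A B x(1)]
        cdgl_morphism_path[OF f A B x(2) A.MC_closed[OF x(1)] A.MC_closed[OF a] x(3)]
        lie_morphism_closed[OF cdgl_morphism_lie[OF f] x(2)] by blast
  qed
  then show ?thesis
    unfolding MC_orbits_map_def by (intro UN_constant_eq[OF gauge_orbit_self[OF A a]]) blast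
qed

end

section \<open>Lifting along trivial fibrations\<close>

context complete_dg_lie_algebra
begin

lemma twisted_dif_linear:
  assumes a: "a \<in> elts L (-1)" shows "Q_linear (sp L n) (sp L (n - 1)) (twisted_dif L a n)"
proof -
  have "twisted_dif L a n (q \<odot>\<^bsub>sp L n\<^esub> x) = q \<odot>\<^bsub>sp L (n - 1)\<^esub> twisted_dif L a n x" if "x \<in> elts L n" for q x
    using brk_closed[OF a that] that brk_smult_right[OF a that, of q]
    by (simp add: twisted_dif_def dif_smult smult_add_right)
  then show ?thesis
    using twisted_dif_closed[OF a] twisted_dif_add[OF a] by (simp add: Q_linear_def)
qed

abbreviation "twisted_boundaries a n \<equiv> twisted_dif L a (n + 1) ` elts L (n + 1)"
abbreviation "twisted_cycles a n \<equiv> {x \<in> elts L n. twisted_dif L a n x = \<zero>\<^bsub>sp L (n - 1)\<^esub>}"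

lemma twisted_boundaries_subgroup:
  assumes a: "a \<in> elts L (-1)" shows "abelian_subgroup (twisted_boundaries a n) (sp L n)"
proof (rule submodule_abelian_subgroup[OF sp.module_abelian_group])
  have l: "Q_linear (sp L (n + 1)) (sp L n) (twisted_dif L a (n + 1))"
    using twisted_dif_linear[OF a, of "n + 1"] by simp
  show "submodule (twisted_boundaries a n) QQ (sp L n)"
  proof (rule sp.submoduleI)
    show "twisted_boundaries a n \<subseteq> elts L n" using Q_linear_closed[OF l] by blast
    show "\<zero>\<^bsub>sp L n\<^esub> \<in> twisted_boundaries a n"
      using Q_linear_zero[OF l sp_module sp_module] by (metis imageI sp.zero_closed)
    fix x assume "x \<in> twisted_boundaries a n"
    then obtain h where h: "h \<in> elts L (n + 1)" "x = twisted_dif L a (n + 1) h" by blast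
    show "\<ominus>\<^bsub>sp L n\<^esub> x \<in> twisted_boundaries a n"
      unfolding h(2) using Q_linear_uminus[OF l sp_module sp_module h(1)] h(1) by (metis imageI sp.a_inv_closed)
    show "q \<odot>\<^bsub>sp L n\<^esub> x \<in> twisted_boundaries a n" for q
      unfolding h(2) using Q_linear_smult[OF l h(1), of q] h(1) by (metis imageI smult_closed)
    fix y assume "y \<in> twisted_boundaries a n"
    then obtain k where k: "k \<in> elts L (n + 1)" "y = twisted_dif L a (n + 1) k" by blast
    show "x \<oplus>\<^bsub>sp L n\<^esub> y \<in> twisted_boundaries a n"
      unfolding h(2) k(2) using Q_linear_add[OF l h(1) k(1)] h(1) k(1) by (metis imageI sp.a_closed)
  qed
qed

text \<open>
  In non-negative degrees the truncation of the component shows neither in its boundaries nor in its cycles, since all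
  elements of degree 0 of the component are cycles.
\<close>

lemma component_homology:
  assumes "0 \<le> n"
  shows "boundaries (component L a) n = twisted_boundaries a n"
    and "carrier (homology (component L a) n) = (\<lambda>z. twisted_boundaries a n +>\<^bsub>sp L n\<^esub> z) ` twisted_cycles a n"
    and "homology_map (component L a) f n X = (\<Union>x\<in>X. twisted_boundaries a n +>\<^bsub>sp L n\<^esub> f n x)"
proof -
  have nn: "\<not> n < 0" "\<not> n + 1 < 0" "n + 1 \<noteq> 0" using assms by auto
  show b: "boundaries (component L a) n = twisted_boundaries a n"
    using nn by (simp add: boundaries_def component_def)
  have cy: "cycles (component L a) n = twisted_cycles a n"
    using nn by (cases "n = 0") (auto simp: cycles_def component_def)
  have add: "H +>\<^bsub>(sp (component L a) n)\<lparr>carrier := Z\<rparr>\<^esub> z = H +>\<^bsub>sp L n\<^esub> z" "H +>\<^bsub>sp (component L a) n\<^esub> z = H +>\<^bsub>sp L n\<^esub> z" for H Z z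
    using nn by (simp_all add: component_def a_r_coset_def')
  show "carrier (homology (component L a) n) = (\<lambda>z. twisted_boundaries a n +>\<^bsub>sp L n\<^esub> z) ` twisted_cycles a n"
    by (auto simp: homology_def A_RCOSETS_def' b cy add)
  show "homology_map (component L a) f n X = (\<Union>x\<in>X. twisted_boundaries a n +>\<^bsub>sp L n\<^esub> f n x)"
    by (simp add: homology_map_def b add)
qed

end

locale trivial_fibration =
  A: complete_dg_lie_algebra A + B: complete_dg_lie_algebra B
  for A :: "('a, 'm) cdgl_scheme" and B :: "('b, 'k) cdgl_scheme" +
  fixes p :: "int \<Rightarrow> 'a \<Rightarrow> 'b"
  assumes fib: "fibration A B p" and weq: "weak_equivalence A B p"
begin

lemma p_morphism: "cdgl_morphism A B p"
  using fib by (simp add: fibration_def)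

lemma p_closed: "x \<in> elts A n \<Longrightarrow> p n x \<in> elts B n"
  using lie_morphism_closed[OF cdgl_morphism_lie[OF p_morphism]] .

lemmas p_ops = lie_morphism_ops[OF cdgl_morphism_lie[OF p_morphism]
    A.complete_dg_lie_algebra_axioms B.complete_dg_lie_algebra_axioms]

lemma p_surj: "\<lbrakk>0 \<le> n; y \<in> elts B n\<rbrakk> \<Longrightarrow> \<exists>x\<in>elts A n. p n x = y"
proof -
  assume "0 \<le> n" "y \<in> elts B n"
  then have "y \<in> p n ` elts A n" using fib by (simp add: fibration_def)
  then show ?thesis by blast
qed

lemma p_twisted_dif:
  "\<lbrakk>a \<in> MC A; x \<in> elts A n\<rbrakk> \<Longrightarrow> p (n - 1) (twisted_dif A a n x) = twisted_dif B (p (-1) a) n (p n x)"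
  by (rule cdgl_morphism_twisted_dif[OF p_morphism A.complete_dg_lie_algebra_axioms
        B.complete_dg_lie_algebra_axioms A.MC_closed])

lemma p_MC: "a \<in> MC A \<Longrightarrow> p (-1) a \<in> MC B"
  by (rule cdgl_morphism_MC[OF p_morphism A.complete_dg_lie_algebra_axioms B.complete_dg_lie_algebra_axioms])

lemma homology_bij:
  "a \<in> MC A \<Longrightarrow> bij_betw (homology_map (component B (p (-1) a)) p n)
    (carrier (homology (component A a) n)) (carrier (homology (component B (p (-1) a)) n))"
  using weq by (simp add: weak_equivalence_def quasi_iso_def)

text \<open>
  Injectivity on homology: the classes of \<open>z\<close> and of zero have the same image.
\<close>

lemma lift_boundary:
  assumes a: "a \<in> MC A" and n: "0 \<le> n" and z: "z \<in> elts A n" "twisted_dif A a n z = \<zero>\<^bsub>sp A (n - 1)\<^esub>"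
    and e: "e \<in> elts B (n + 1)" "p n z = twisted_dif B (p (-1) a) (n + 1) e"
  shows "\<exists>u\<in>elts A (n + 1). z = twisted_dif A a (n + 1) u"
proof -
  let ?b = "p (-1) a"
  let ?BA = "A.twisted_boundaries a n" and ?BB = "B.twisted_boundaries ?b n"
  note ac = A.MC_closed[OF a] and bc = B.MC_closed[OF p_MC[OF a]]
  interpret SA: abelian_subgroup ?BA "sp A n" by (rule A.twisted_boundaries_subgroup[OF ac])
  interpret SB: abelian_subgroup ?BB "sp B n" by (rule B.twisted_boundaries_subgroup[OF bc])
  note zA = additive_subgroup.zero_closed[OF SA.is_additive_subgroup]
  have map: "homology_map (component B ?b) p n (?BA +>\<^bsub>sp A n\<^esub> y) = ?BB"
    if y: "y \<in> elts A n" "p n y \<in> ?BB" for y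
    unfolding B.component_homology(3)[OF n]
  proof (rule UN_constant_eq)
    show "y \<in> ?BA +>\<^bsub>sp A n\<^esub> y" by (rule SA.a_rcos_self[OF y(1)])
    show "\<forall>x\<in>?BA +>\<^bsub>sp A n\<^esub> y. ?BB +>\<^bsub>sp B n\<^esub> p n x = ?BB"
    proof
      fix x assume "x \<in> ?BA +>\<^bsub>sp A n\<^esub> y"
      then obtain h where h: "h \<in> elts A (n + 1)" "x = twisted_dif A a (n + 1) h \<oplus>\<^bsub>sp A n\<^esub> y"
        by (auto simp: a_r_coset_def')
      have "twisted_dif A a (n + 1) h \<in> elts A n" using A.twisted_dif_closed[OF ac h(1)] by simp
      then have "p n x = twisted_dif B ?b (n + 1) (p (n + 1) h) \<oplus>\<^bsub>sp B n\<^esub> p n y"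
        using p_twisted_dif[OF a h(1)] y(1) by (simp add: h(2) p_ops)
      then have "p n x \<in> ?BB"
        using additive_subgroup.a_closed[OF SB.is_additive_subgroup] p_closed[OF h(1)] y(2) by simp
      then show "?BB +>\<^bsub>sp B n\<^esub> p n x = ?BB"
        using B.sp.a_coset_join2[of "p n x" n ?BB] SB.a_subgroup SB.a_subset by blast
    qed
  qed
  have "?BA +>\<^bsub>sp A n\<^esub> z = ?BA +>\<^bsub>sp A n\<^esub> \<zero>\<^bsub>sp A n\<^esub>"
  proof (rule inj_onD[OF bij_betw_imp_inj_on[OF homology_bij[OF a, of n]]])
    have "\<zero>\<^bsub>sp B n\<^esub> \<in> ?BB" by (rule additive_subgroup.zero_closed[OF SB.is_additive_subgroup])
    then show "homology_map (component B ?b) p n (?BA +>\<^bsub>sp A n\<^esub> z) =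
        homology_map (component B ?b) p n (?BA +>\<^bsub>sp A n\<^esub> \<zero>\<^bsub>sp A n\<^esub>)"
      using map[OF z(1)] map[of "\<zero>\<^bsub>sp A n\<^esub>"] e by (simp add: p_ops)
  qed (use z A.twisted_dif_zero[OF ac, of n] in \<open>auto simp: A.component_homology(2)[OF n]\<close>)
  then have "z \<in> ?BA +>\<^bsub>sp A n\<^esub> \<zero>\<^bsub>sp A n\<^esub>" using SA.a_rcos_self[OF z(1)] by simp
  then have "z \<in> ?BA" unfolding A.sp.a_coset_add_zero[OF SA.a_subset] .
  then show ?thesis by blast
qed

text \<open>
  Surjectivity on homology gives a cycle whose image differs from \<open>w\<close> by a boundary; a lift of a primitive of that
  boundary corrects it.
\<close>

lemma lift_cycle:
  assumes a: "a \<in> MC A" and n: "0 \<le> n" and w: "w \<in> elts B n" "twisted_dif B (p (-1) a) n w = \<zero>\<^bsub>sp B (n - 1)\<^esub>"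
  shows "\<exists>c\<in>elts A n. twisted_dif A a n c = \<zero>\<^bsub>sp A (n - 1)\<^esub> \<and> p n c = w"
proof -
  let ?b = "p (-1) a"
  let ?BA = "A.twisted_boundaries a n" and ?BB = "B.twisted_boundaries ?b n"
  note ac = A.MC_closed[OF a] and bc = B.MC_closed[OF p_MC[OF a]]
  interpret SA: abelian_subgroup ?BA "sp A n" by (rule A.twisted_boundaries_subgroup[OF ac])
  interpret SB: abelian_subgroup ?BB "sp B n" by (rule B.twisted_boundaries_subgroup[OF bc])
  have "?BB +>\<^bsub>sp B n\<^esub> w \<in> carrier (homology (component B ?b) n)"
    using w by (auto simp: B.component_homology(2)[OF n])
  then obtain X where X: "X \<in> carrier (homology (component A a) n)"
    "homology_map (component B ?b) p n X = ?BB +>\<^bsub>sp B n\<^esub> w"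
    unfolding bij_betw_imp_surj_on[OF homology_bij[OF a, of n], symmetric] by (elim imageE) simp
  obtain c where c: "c \<in> elts A n" "twisted_dif A a n c = \<zero>\<^bsub>sp A (n - 1)\<^esub>" "X = ?BA +>\<^bsub>sp A n\<^esub> c"
    using X(1) by (auto simp: A.component_homology(2)[OF n])
  have "p n c \<in> homology_map (component B ?b) p n X"
    unfolding B.component_homology(3)[OF n] c(3)
    using SA.a_rcos_self[OF c(1)] SB.a_rcos_self[OF p_closed[OF c(1)]] by blast
  then obtain e where e: "e \<in> elts B (n + 1)" "p n c = twisted_dif B ?b (n + 1) e \<oplus>\<^bsub>sp B n\<^esub> w"
    unfolding X(2) by (auto simp: a_r_coset_def')
  obtain e' where e': "e' \<in> elts A (n + 1)" "p (n + 1) e' = e" using p_surj[of "n + 1" e] n e(1) by auto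
  let ?t = "twisted_dif A a (n + 1) e'"
  have t: "?t \<in> elts A n" "p n ?t = twisted_dif B ?b (n + 1) e"
    using A.twisted_dif_closed[OF ac e'(1)] p_twisted_dif[OF a e'(1)] e'(2) by simp_all
  have te: "twisted_dif B ?b (n + 1) e \<in> elts B n" using B.twisted_dif_closed[OF bc e(1)] by simp
  have "p n (c \<ominus>\<^bsub>sp A n\<^esub> ?t) = w"
    using B.sp.minus_decompose(6)[OF w(1) te te te] e(2) c(1) t w(1) te
    by (simp add: p_ops B.sp.a_comm)
  moreover have "twisted_dif A a n ?t = \<zero>\<^bsub>sp A (n - 1)\<^esub>"
    using A.twisted_dif_square[OF a e'(1)] by simp
  then have "twisted_dif A a n (c \<ominus>\<^bsub>sp A n\<^esub> ?t) = \<zero>\<^bsub>sp A (n - 1)\<^esub>"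
    using A.twisted_dif_minus[OF ac c(1) t(1)] c(2) by (simp add: a_minus_def)
  ultimately show ?thesis using c(1) t(1) by (intro bexI[of _ "c \<ominus>\<^bsub>sp A n\<^esub> ?t"]) auto
qed

end

lemma cont_linear_eq_closure:
  assumes C: "complete_dg_lie_algebra C" and A: "complete_dg_lie_algebra A"
    and \<alpha>: "cont_linear C A e \<alpha>" and \<beta>: "cont_linear C A e \<beta>" and x: "x \<in> elts C n"
    and approx: "\<And>k. 1 \<le> k \<Longrightarrow> \<exists>y. fcong C k n x y \<and> \<alpha> n y = \<beta> n y"
  shows "\<alpha> n x = \<beta> n x"
proof -
  interpret A: complete_dg_lie_algebra A by fact
  interpret C: complete_dg_lie_algebra C by fact
  have "Q_linear (sp C n) (sp A (n + e)) (\<alpha> n)" "Q_linear (sp C n) (sp A (n + e)) (\<beta> n)"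
    using \<alpha> \<beta> by (simp_all add: cont_linear_def)
  then have c: "\<alpha> n x \<in> elts A (n + e)" "\<beta> n x \<in> elts A (n + e)" using Q_linear_closed x by metis+
  have "fcong A (Suc k) (n + e) (\<alpha> n x) (\<beta> n x)" for k
  proof -
    obtain m1 m2 where m: "1 \<le> m1" "\<And>n x y. fcong C m1 n x y \<Longrightarrow> fcong A (Suc k) (n + e) (\<alpha> n x) (\<alpha> n y)"
      "1 \<le> m2" "\<And>n x y. fcong C m2 n x y \<Longrightarrow> fcong A (Suc k) (n + e) (\<beta> n x) (\<beta> n y)"
      using cont_linear_fcong[OF C A \<alpha>, of "Suc k"] cont_linear_fcong[OF C A \<beta>, of "Suc k"] by auto
    obtain y where y: "fcong C (max m1 m2) n x y" "\<alpha> n y = \<beta> n y" using approx[of "max m1 m2"] m(1) by (auto simp: le_max_iff_disj)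
    have "fcong A (Suc k) (n + e) (\<alpha> n x) (\<alpha> n y)" using m(2)[OF C.fcong_mono[OF m(1) _ y(1)]] by simp
    moreover have "fcong A (Suc k) (n + e) (\<alpha> n y) (\<beta> n x)"
      unfolding y(2) by (rule A.fcong_sym[OF _ m(4)[OF C.fcong_mono[OF m(3) _ y(1)]]]) simp_all
    ultimately show ?thesis by (rule A.fcong_trans[rotated]) simp
  qed
  then show ?thesis by (rule A.eq_if_fcong[OF c])
qed

lemma dif_commute_brk:
  assumes C: "complete_dg_lie_algebra C" and A: "complete_dg_lie_algebra A" and \<phi>: "lie_morphism C A \<phi>"
    and x: "x \<in> elts C n" "\<phi> (n - 1) (dif C n x) = dif A n (\<phi> n x)"
    and y: "y \<in> elts C m" "\<phi> (m - 1) (dif C m y) = dif A m (\<phi> m y)"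
  shows "\<phi> (n + m - 1) (dif C (n + m) (brk C n m x y)) = dif A (n + m) (\<phi> (n + m) (brk C n m x y))"
proof -
  interpret A: complete_dg_lie_algebra A by fact
  interpret C: complete_dg_lie_algebra C by fact
  note c = lie_morphism_closed[OF \<phi>]
  have b: "brk C n m x y \<in> elts C (n + m)" using x(1) y(1) by (rule C.brk_closed)
  have "fcong A (Suc k) (n + m - 1) (\<phi> (n + m - 1) (dif C (n + m) (brk C n m x y)))
      (dif A (n + m) (\<phi> (n + m) (brk C n m x y)))" for k
  proof (rule A.fcong_mono[OF _ _ dif_commute_brk_fcong[OF C A \<phi> _ x(1) y(1), of "Suc k"]])
    show "fcong A (Suc k) (n - 1) (\<phi> (n - 1) (dif C n x)) (dif A n (\<phi> n x))"
      unfolding x(2) by (rule A.fcong_refl) (use c x(1) in auto)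
    show "fcong A (Suc k) (m - 1) (\<phi> (m - 1) (dif C m y)) (dif A m (\<phi> m y))"
      unfolding y(2) by (rule A.fcong_refl) (use c y(1) in auto)
  qed simp_all
  then show ?thesis by (rule A.eq_if_fcong[OF c[OF C.dif_closed[OF b]] A.dif_closed[OF c[OF b]]])
qed

lemma proper_face:
  assumes "I \<in> faces (Suc m)" "i \<le> Suc m" "i \<notin> I"
  shows "\<exists>J\<in>faces m. I = coface_map i ` J"
proof (rule bexI)
  let ?J = "codegeneracy_map i ` I"
  have "coface_map i (codegeneracy_map i k) = k" if "k \<in> I" for k
    using assms(3) that by (cases "k = i") (auto simp: coface_map_def codegeneracy_map_def)
  then show "I = coface_map i ` ?J" by (force simp: image_image)
  have "codegeneracy_map i k \<le> m" if "k \<in> I" for k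
    using assms that by (cases "k = i") (auto simp: codegeneracy_map_def faces_iff)
  then show "?J \<in> faces m" using assms(1) by (auto simp: faces_iff)
qed

lemma proper_face_missing: "\<lbrakk>I \<in> faces n; I \<noteq> {..n}\<rbrakk> \<Longrightarrow> \<exists>i\<le>n. i \<notin> I"
  by (auto simp: faces_iff)

lemma coface_map_inj: "inj (coface_map i)"
  by (auto simp: inj_def coface_map_def split: if_splits)

lemma coface_map_faces: "\<lbrakk>i \<le> Suc m; J \<in> faces m\<rbrakk> \<Longrightarrow> coface_map i ` J \<in> faces (Suc m)"
  by (auto simp: faces_iff coface_map_def)

lemma coface_map_proper: "coface_map i ` J \<noteq> {..Suc m} \<or> Suc m < i"
  by (auto simp: coface_map_def set_eq_iff image_iff not_less intro!: exI[of _ i])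

lemma face_deg_coface: "face_deg (coface_map i ` J) = face_deg J"
  using card_image[OF inj_on_subset[OF coface_map_inj subset_UNIV], of i J] by (simp add: face_deg_def)

context cosimplicial_simplex_cdgl
begin

text \<open>
  The elements on which \<open>\<phi>\<close> and \<open>\<psi>\<close> agree and commute with the differential form a complete sub-dgl, hence contain
  the boundary of the simplex as soon as they contain its proper faces.
\<close>

lemma boundary_agreement:
  assumes A: "complete_dg_lie_algebra A" and \<phi>: "lie_morphism (S n) A \<phi>" and \<psi>: "lie_morphism (S n) A \<psi>"
    and agree: "\<And>I. \<lbrakk>I \<in> faces n; I \<noteq> {..n}\<rbrakk> \<Longrightarrow>
      \<phi> (face_deg I) (face_gen n I) = \<psi> (face_deg I) (face_gen n I)"
    and \<phi>d: "\<And>I. \<lbrakk>I \<in> faces n; I \<noteq> {..n}\<rbrakk> \<Longrightarrow>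
      \<phi> (face_deg I - 1) (dif (S n) (face_deg I) (face_gen n I)) = dif A (face_deg I) (\<phi> (face_deg I) (face_gen n I))"
    and \<psi>d: "\<And>I. \<lbrakk>I \<in> faces n; I \<noteq> {..n}\<rbrakk> \<Longrightarrow>
      \<psi> (face_deg I - 1) (dif (S n) (face_deg I) (face_gen n I)) = dif A (face_deg I) (\<psi> (face_deg I) (face_gen n I))"
    and x: "x \<in> boundary_cdgl d n m"
  shows "\<phi> m x = \<psi> m x" "\<phi> (m - 1) (dif (S n) m x) = dif A m (\<phi> m x)"
proof -
  interpret A: complete_dg_lie_algebra A by fact
  interpret C: complete_dg_lie_algebra "S n" by (rule complete_dgl)
  note CC = C.complete_dg_lie_algebra_axioms
  define H where "H k = {x \<in> elts (S n) k. \<phi> (k - 1) (dif (S n) k x) = dif A k (\<phi> k x) \<and>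
    \<psi> (k - 1) (dif (S n) k x) = dif A k (\<psi> k x) \<and> \<phi> k x = \<psi> k x}" for k
  note cl = lie_morphism_closed[OF \<phi>] lie_morphism_closed[OF \<psi>]
  note ops = lie_morphism_ops[OF \<phi> CC A] lie_morphism_ops[OF \<psi> CC A]
  have "sub_cdgl (S n) H"
    unfolding sub_cdgl_def
  proof (intro conjI allI ballI impI)
    fix k
    show "submodule (H k) QQ (sp (S n) k)"
      by (rule C.sp.submoduleI)
        (auto simp: H_def ops cl C.dif_add A.dif_add C.dif_smult A.dif_smult C.dif_uminus A.dif_uminus)
  next
    fix k j x y assume x: "x \<in> H k" and y: "y \<in> H j"
    then have c: "x \<in> elts (S n) k" "y \<in> elts (S n) j" by (auto simp: H_def)
    show "brk (S n) k j x y \<in> H (k + j)"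
      using dif_commute_brk[OF CC A \<phi> c(1) _ c(2)] dif_commute_brk[OF CC A \<psi> c(1) _ c(2)]
        lie_morphism_brk[OF \<phi> c] lie_morphism_brk[OF \<psi> c] x y C.brk_closed[OF c]
      by (simp add: H_def)
  next
    fix k x assume x: "x \<in> H k"
    then have c: "x \<in> elts (S n) k" by (simp add: H_def)
    have "dif (S n) (k - 1) (dif (S n) k x) = \<zero>\<^bsub>sp (S n) (k - 1 - 1)\<^esub>" using C.dif_dif[OF c] by simp
    moreover have "dif A (k - 1) (dif A k (\<phi> k x)) = \<zero>\<^bsub>sp A (k - 1 - 1)\<^esub>"
      using A.dif_dif[OF cl(1)[OF c]] by simp
    ultimately show "dif (S n) k x \<in> H (k - 1)"
      using x c C.dif_closed[OF c] ops(1)[of "k - 1 - 1"] ops(6)[of "k - 1 - 1"] by (simp add: H_def)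
  next
    fix k x assume x: "x \<in> elts (S n) k"
      and ap: "\<forall>j\<ge>1. \<exists>y\<in>H k. x \<ominus>\<^bsub>sp (S n) k\<^esub> y \<in> fil (S n) j k"
    have ap': "\<exists>y. fcong (S n) j k x y \<and> y \<in> H k" if "1 \<le> j" for j
      using ap that x by (auto simp: fcong_def H_def)
    have comp: "cont_linear (S n) A (-1) (\<lambda>k x. \<chi> (k - 1) (dif (S n) k x))"
      "cont_linear (S n) A (-1) (\<lambda>k x. dif A k (\<chi> k x))" if "lie_morphism (S n) A \<chi>" for \<chi>
      using cont_linear_comp[OF cont_linear_dif[OF CC] lie_morphism_cont[OF that]]
        cont_linear_comp[OF lie_morphism_cont[OF that] cont_linear_dif[OF A]] by simp_all
    have "\<phi> (k - 1) (dif (S n) k x) = dif A k (\<phi> k x)"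
      by (rule cont_linear_eq_closure[OF CC A comp[OF \<phi>] x]) (use ap' in \<open>auto simp: H_def\<close>)
    moreover have "\<psi> (k - 1) (dif (S n) k x) = dif A k (\<psi> k x)"
      by (rule cont_linear_eq_closure[OF CC A comp[OF \<psi>] x]) (use ap' in \<open>auto simp: H_def\<close>)
    moreover have "\<phi> k x = \<psi> k x"
      by (rule cont_linear_eq_closure[OF CC A lie_morphism_cont[OF \<phi>] lie_morphism_cont[OF \<psi>] x])
        (use ap' in \<open>auto simp: H_def\<close>)
    ultimately show "x \<in> H k" using x by (simp add: H_def)
  qed
  moreover have "{face_gen n I | I. I \<in> faces n \<and> I \<noteq> {..n} \<and> face_deg I = k} \<subseteq> H k" for k
  proof clarify
    fix I assume I: "I \<in> faces n" "I \<noteq> {..n}"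
    show "face_gen n I \<in> H (face_deg I)"
      unfolding H_def using simplex_gen_closed[OF I(1)] agree[OF I] \<phi>d[OF I] \<psi>d[OF I]
      by (intro CollectI conjI)
  qed
  ultimately have "boundary_cdgl d n m \<subseteq> H m"
    unfolding boundary_cdgl_def generated_sub_cdgl_def by blast
  then have "x \<in> H m" using x by blast
  then show "\<phi> m x = \<psi> m x" "\<phi> (m - 1) (dif (S n) m x) = dif A m (\<phi> m x)"
    by (simp_all add: H_def)
qed

end

locale lifting_setup = cosimplicial_simplex_cdgl d cf cd + trivial_fibration A B p
  for d cf cd and A :: "('a, 'm) cdgl_scheme" and B :: "('b, 'k) cdgl_scheme" and p
begin

lemmas AA = A.complete_dg_lie_algebra_axioms
lemmas BB = B.complete_dg_lie_algebra_axioms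

lemma p_path:
  "\<lbrakk>x \<in> elts A 0; a \<in> MC A; b \<in> MC A; path_relation A x a b\<rbrakk> \<Longrightarrow>
    path_relation B (p 0 x) (p (-1) a) (p (-1) b)"
  by (rule cdgl_morphism_path[OF p_morphism AA BB _ A.MC_closed A.MC_closed])

lemma path_end_unique:
  assumes "complete_dg_lie_algebra L" "x \<in> elts L 0" "a \<in> elts L (-1)" "a' \<in> elts L (-1)" "b \<in> elts L (-1)"
    "path_relation L x a b" "path_relation L x a' b"
  shows "a = a'"
proof -
  interpret L: complete_dg_lie_algebra L by fact
  show ?thesis using L.gauge_iff_path assms(2-) by metis
qed

text \<open>
  A Maurer-Cartan element is gauge equivalent to one in the image because \<open>p\<close> is surjective on orbits; moving a
  preimage along a lift of the gauge corrects it.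
\<close>

lemma lift_MC:
  assumes b: "b \<in> MC B" shows "\<exists>a\<in>MC A. p (-1) a = b"
proof -
  have "gauge_orbit B b \<in> MC_orbits_map B p ` MC_orbits A"
    using weq b by (auto simp: weak_equivalence_def bij_betw_def MC_orbits_def)
  then obtain a where a: "a \<in> MC A" "gauge_orbit B b = gauge_orbit B (p (-1) a)"
    using MC_orbits_map_orbit[OF AA BB p_morphism] by (auto simp: MC_orbits_def)
  have "b \<in> gauge_orbit B (p (-1) a)" using gauge_orbit_self[OF BB b] a(2) by simp
  then obtain y where y: "y \<in> elts B 0" "path_relation B y b (p (-1) a)"
    unfolding gauge_orbit_iff[OF BB p_MC[OF a(1)]] by blast
  obtain x where x: "x \<in> elts A 0" "p 0 x = y" using p_surj[of 0 y] y(1) by auto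
  define a' where "a' = gauge A x a"
  have a': "a' \<in> MC A" unfolding a'_def by (rule gauge_MC[OF AA x(1) a(1)])
  have "path_relation A x a' a"
    using A.gauge_iff_path[OF x(1) A.MC_closed[OF a'] A.MC_closed[OF a(1)]] a'_def by simp
  then have "path_relation B y (p (-1) a') (p (-1) a)" using p_path[OF x(1) a' a(1)] x(2) by simp
  then have "p (-1) a' = b"
    using path_end_unique[OF BB y(1)] y(2) B.MC_closed p_MC a' a(1) b by blast
  with a' show ?thesis by blast
qed

text \<open>
  To lift a path \<open>y\<close> from \<open>p a\<^sub>1\<close> to \<open>p a\<^sub>0\<close>, lift \<open>y\<close> to some \<open>y'\<close>, which leads from \<open>a\<^sub>1\<close> to a point \<open>a'\<close> over \<open>p a\<^sub>0\<close>. By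
  injectivity on orbits there is a path \<open>z\<close> from \<open>a'\<close> to \<open>a\<^sub>0\<close>; its image \<open>w\<close> is a loop, i.e. a cycle of degree zero, and
  so lifts to a loop \<open>c\<close> at \<open>a'\<close>. The path \<open>z c\<^sup>-\<^sup>1 y'\<close>, formed with two triangles, has image \<open>w w\<^sup>-\<^sup>1 y = y\<close>.
\<close>

lemma lift_path:
  assumes a: "a0 \<in> MC A" "a1 \<in> MC A" and y: "y \<in> elts B 0"
    and path: "path_relation B y (p (-1) a0) (p (-1) a1)"
  shows "\<exists>x\<in>elts A 0. p 0 x = y \<and> path_relation A x a0 a1"
proof -
  let ?b0 = "p (-1) a0" and ?b1 = "p (-1) a1"
  note b = p_MC[OF a(1)] p_MC[OF a(2)]
  obtain y' where y': "y' \<in> elts A 0" "p 0 y' = y" using p_surj[of 0 y] y by auto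
  define a' where "a' = gauge A y' a1"
  have a': "a' \<in> MC A" unfolding a'_def by (rule gauge_MC[OF AA y'(1) a(2)])
  have y'path: "path_relation A y' a' a1"
    using A.gauge_iff_path[OF y'(1) A.MC_closed[OF a'] A.MC_closed[OF a(2)]] a'_def by simp
  have "path_relation B y (p (-1) a') ?b1" using p_path[OF y'(1) a' a(2) y'path] y'(2) by simp
  then have pa': "p (-1) a' = ?b0"
    using path_end_unique[OF BB y _ _ _ _ path] B.MC_closed b p_MC[OF a'] by blast
  have "gauge_orbit A a' = gauge_orbit A a0"
  proof (rule inj_onD[of "MC_orbits_map B p" "MC_orbits A"])
    show "inj_on (MC_orbits_map B p) (MC_orbits A)"
      using weq by (simp add: weak_equivalence_def bij_betw_def)
  qed (use a a' pa' MC_orbits_map_orbit[OF AA BB p_morphism] in \<open>auto simp: MC_orbits_def\<close>)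
  then have "a0 \<in> gauge_orbit A a'" using gauge_orbit_self[OF AA a(1)] by simp
  then obtain z where z: "z \<in> elts A 0" "path_relation A z a0 a'"
    unfolding gauge_orbit_iff[OF AA a'] by blast
  let ?w = "p 0 z"
  have w: "?w \<in> elts B 0" by (rule p_closed[OF z(1)])
  have wpath: "path_relation B ?w ?b0 ?b0" using p_path[OF z(1) a(1) a' z(2)] pa' by simp
  have loop: "path_relation L x c c \<longleftrightarrow> twisted_dif L c 0 x = \<zero>\<^bsub>sp L (-1)\<^esub>"
    if "complete_dg_lie_algebra L" "x \<in> elts L 0" "c \<in> elts L (-1)" for L :: "('c, 'd) cdgl_scheme" and x c
  proof -
    interpret L: complete_dg_lie_algebra L by fact
    have bc: "brk L 0 (-1) x c \<in> elts L (-1)" using that by simp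
    have "brk L (-1) 0 c x = \<ominus>\<^bsub>sp L (-1)\<^esub> brk L 0 (-1) x c"
      using L.antisymmetry[OF that(3,2)] L.smult_neg_1[OF bc] by simp
    then have "twisted_dif L c 0 x = dif L 0 x \<ominus>\<^bsub>sp L (-1)\<^esub> brk L 0 (-1) x c"
      by (simp add: twisted_dif_def a_minus_def)
    then show ?thesis
      using L.path_relation_loop[OF that(2,3)] L.sp.minus_decompose(4)[of "dif L 0 x" "-1" "brk L 0 (-1) x c"]
        L.dif_closed[OF that(2)] bc by simp
  qed
  have "twisted_dif B (p (-1) a') 0 ?w = \<zero>\<^bsub>sp B (0 - 1)\<^esub>"
    using loop[OF BB w B.MC_closed[OF b(1)]] wpath pa' by simp
  then obtain c where c: "c \<in> elts A 0" "twisted_dif A a' 0 c = \<zero>\<^bsub>sp A (0 - 1)\<^esub>" "p 0 c = ?w"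
    using lift_cycle[OF a' _ w] by auto
  have cpath: "path_relation A c a' a'" using loop[OF AA c(1) A.MC_closed[OF a']] c(2) by simp
  obtain s where s: "triangle A (three a' a' a1) (three s y' c)"
    using triangle_three_horn(1)[OF AA a' a' a(2) y'(1) y'path c(1) cpath] by blast
  obtain x where x: "triangle A (three a0 a' a1) (three s x z)"
    using triangle_three_horn(2)[OF AA a(1) a' a(2) triangle_three_path(1,2)[OF s AA] z] by blast
  have "(\<lambda>i. p (-1) (three a' a' a1 i)) = three ?b0 ?b0 ?b1" "(\<lambda>i. p (-1) (three a0 a' a1 i)) = three ?b0 ?b0 ?b1"
    "(\<lambda>i. p 0 (three s y' c i)) = three (p 0 s) y ?w" "(\<lambda>i. p 0 (three s x z i)) = three (p 0 s) (p 0 x) ?w"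
    using pa' y'(2) c(3) by (auto simp: three_def)
  then have "triangle B (three ?b0 ?b0 ?b1) (three (p 0 s) y ?w)"
    "triangle B (three ?b0 ?b0 ?b1) (three (p 0 s) (p 0 x) ?w)"
    using triangle_map[OF s p_morphism AA BB] triangle_map[OF x p_morphism AA BB] by simp_all
  from triangle_unique[OF this BB, of 1]
  have "p 0 x = y" using less_eq_2_cases by (force simp: three_def)
  then show ?thesis using triangle_three_path(3,4)[OF x AA] by blast
qed

text \<open>
  To lift the top generator of a simplex of dimension at least two, compare the cycle that the lifted boundary
  prescribes as its twisted differential with its image: the cycle bounds in \<open>B\<close>, hence in \<open>A\<close>, and a primitive can be
  corrected by a lift of the difference cycle.
\<close>

lemma lift_primitive:
  assumes a: "a \<in> MC A" and n: "0 \<le> n" and z: "z \<in> elts A n" "twisted_dif A a n z = \<zero>\<^bsub>sp A (n - 1)\<^esub>"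
    and e: "e \<in> elts B (n + 1)" "p n z = twisted_dif B (p (-1) a) (n + 1) e"
  shows "\<exists>u\<in>elts A (n + 1). z = twisted_dif A a (n + 1) u \<and> p (n + 1) u = e"
proof -
  note ac = A.MC_closed[OF a] and bc = B.MC_closed[OF p_MC[OF a]]
  obtain u where u: "u \<in> elts A (n + 1)" "z = twisted_dif A a (n + 1) u"
    using lift_boundary[OF assms] by blast
  let ?w = "e \<ominus>\<^bsub>sp B (n + 1)\<^esub> p (n + 1) u"
  note pu = p_closed[OF u(1)]
  have "twisted_dif B (p (-1) a) (n + 1) (p (n + 1) u) = p n z"
    using p_twisted_dif[OF a u(1)] u(2) by simp
  then have "twisted_dif B (p (-1) a) (n + 1) ?w = \<zero>\<^bsub>sp B (n + 1 - 1)\<^esub>"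
    using B.twisted_dif_minus[OF bc e(1) pu] e(2) p_closed[OF z(1)] B.sp.minus_decompose(4)[of "p n z" n "p n z"]
    by simp
  then obtain c where c: "c \<in> elts A (n + 1)" "twisted_dif A a (n + 1) c = \<zero>\<^bsub>sp A (n + 1 - 1)\<^esub>" "p (n + 1) c = ?w"
    using lift_cycle[OF a, of "n + 1" ?w] n e(1) pu by auto
  have "p (n + 1) (c \<oplus>\<^bsub>sp A (n + 1)\<^esub> u) = e"
    using B.sp.minus_decompose(5)[OF e(1) pu pu pu] c u by (simp add: p_ops)
  moreover have "twisted_dif A a (n + 1) (c \<oplus>\<^bsub>sp A (n + 1)\<^esub> u) = z"
    using A.twisted_dif_add[OF ac c(1) u(1)] c(2) u(2) z(1) by simp
  ultimately show ?thesis using c(1) u(1) by (intro bexI[of _ "c \<oplus>\<^bsub>sp A (n + 1)\<^esub> u"]) auto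
qed

end

context lifting_setup
begin

text \<open>
  Lifts on the facets of a simplex that agree on overlaps extend to a lift on the simplex. Compatibility with the
  differential at the proper faces is inherited from the facets; it remains to choose the top generator.
\<close>

lemma extend_over_simplex:
  assumes v: "cdgl_morphism (S (Suc m)) B v"
    and \<kappa>: "\<And>i. i \<le> Suc m \<Longrightarrow> cdgl_morphism (S m) A (\<kappa> i)"
    and p\<kappa>: "\<And>i J. \<lbrakk>i \<le> Suc m; J \<in> faces m\<rbrakk> \<Longrightarrow>
      p (face_deg J) (\<kappa> i (face_deg J) (face_gen m J)) = v (face_deg J) (face_gen (Suc m) (coface_map i ` J))"
    and compat: "\<And>i j J J'. \<lbrakk>i \<le> Suc m; j \<le> Suc m; J \<in> faces m; J' \<in> faces m; coface_map i ` J = coface_map j ` J'\<rbrakk> \<Longrightarrow>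
      \<kappa> i (face_deg J) (face_gen m J) = \<kappa> j (face_deg J') (face_gen m J')"
  shows "\<exists>\<phi>. cdgl_morphism (S (Suc m)) A \<phi> \<and>
    (\<forall>i\<le>Suc m. \<forall>J\<in>faces m. \<phi> (face_deg J) (face_gen (Suc m) (coface_map i ` J)) = \<kappa> i (face_deg J) (face_gen m J)) \<and>
    (\<forall>I\<in>faces (Suc m). p (face_deg I) (\<phi> (face_deg I) (face_gen (Suc m) I)) = v (face_deg I) (face_gen (Suc m) I))"
proof -
  let ?n = "Suc m"
  let ?top = "{..?n}"
  let ?C = "S ?n"
  interpret C: complete_dg_lie_algebra "?C" by (rule complete_dgl)
  note CC = C.complete_dg_lie_algebra_axioms
  define f where "f I = (SOME a. \<exists>i\<le>?n. \<exists>J\<in>faces m. I = coface_map i ` J \<and> a = \<kappa> i (face_deg J) (face_gen m J))" for I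
  have f: "f (coface_map i ` J) = \<kappa> i (face_deg J) (face_gen m J)" if iJ: "i \<le> ?n" "J \<in> faces m" for i J
    unfolding f_def
  proof (rule some_equality)
    show "\<exists>i'\<le>?n. \<exists>J'\<in>faces m. coface_map i ` J = coface_map i' ` J' \<and>
        \<kappa> i (face_deg J) (face_gen m J) = \<kappa> i' (face_deg J') (face_gen m J')" using iJ by blast
    fix a assume "\<exists>i'\<le>?n. \<exists>J'\<in>faces m. coface_map i ` J = coface_map i' ` J' \<and>
        a = \<kappa> i' (face_deg J') (face_gen m J')"
    then obtain i' J' where "i' \<le> ?n" "J' \<in> faces m" "coface_map i ` J = coface_map i' ` J'"
      "a = \<kappa> i' (face_deg J') (face_gen m J')" by blast
    then show "a = \<kappa> i (face_deg J) (face_gen m J)" using compat[OF iJ(1) _ iJ(2)] by simp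
  qed
  have proper: "\<exists>i\<le>?n. \<exists>J\<in>faces m. I = coface_map i ` J" if I: "I \<in> faces ?n" "I \<noteq> ?top" for I
    using proper_face_missing[OF I] proper_face[OF I(1)] by blast
  have fc: "f I \<in> elts A (face_deg I)" if I: "I \<in> faces ?n" "I \<noteq> ?top" for I
  proof -
    obtain i J where iJ: "i \<le> ?n" "J \<in> faces m" "I = coface_map i ` J" using proper[OF I] by blast
    show ?thesis unfolding iJ(3) f[OF iJ(1,2)] face_deg_coface
      by (rule lie_morphism_closed[OF cdgl_morphism_lie[OF \<kappa>[OF iJ(1)]] simplex_gen_closed[OF iJ(2)]])
  qed
  have pf: "p (face_deg I) (f I) = v (face_deg I) (face_gen ?n I)" if I: "I \<in> faces ?n" "I \<noteq> ?top" for I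
  proof -
    obtain i J where iJ: "i \<le> ?n" "J \<in> faces m" "I = coface_map i ` J" using proper[OF I] by blast
    show ?thesis unfolding iJ(3) f[OF iJ(1,2)] face_deg_coface by (rule p\<kappa>[OF iJ(1,2)])
  qed
  have top: "?top \<in> faces ?n" "face_deg ?top = int m" by (auto simp: faces_iff)
  have ex: "\<exists>\<phi>. lie_morphism ?C A \<phi> \<and> (\<forall>I\<in>faces ?n. I \<noteq> ?top \<longrightarrow> \<phi> (face_deg I) (face_gen ?n I) = f I) \<and>
      \<phi> (int m) (face_gen ?n ?top) = t" if t: "t \<in> elts A (int m)" for t
  proof -
    have "(f(?top := t)) I \<in> elts A (face_deg I)" if "I \<in> faces ?n" for I
      using fc[OF that] t top(2) by simp
    from simplex_ex_lie_morphism[OF AA this] obtain \<phi> where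
      "lie_morphism ?C A \<phi>" "\<forall>I\<in>faces ?n. \<phi> (face_deg I) (face_gen ?n I) = (f(?top := t)) I" by blast
    then show ?thesis using top by (intro exI[of _ \<phi>]) auto
  qed
  \<comment> \<open>On a facet the Lie morphism coincides with the given lift, which commutes with \<open>d\<close>.\<close>
  have facet: "\<phi> (face_deg I - 1) (dif ?C (face_deg I) (face_gen ?n I)) = dif A (face_deg I) (\<phi> (face_deg I) (face_gen ?n I))"
    if \<phi>: "lie_morphism ?C A \<phi>" and g: "\<forall>I\<in>faces ?n. I \<noteq> ?top \<longrightarrow> \<phi> (face_deg I) (face_gen ?n I) = f I"
      and I: "I \<in> faces ?n" "I \<noteq> ?top" for \<phi> I
  proof -
    obtain i J where iJ: "i \<le> ?n" "J \<in> faces m" "I = coface_map i ` J" using proper[OF I] by blast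
    note cm = coface_morphism[OF iJ(1)]
    interpret D: complete_dg_lie_algebra "S m" by (rule complete_dgl)
    have gJ: "face_gen m J \<in> elts (S m) (face_deg J)" by (rule simplex_gen_closed[OF iJ(2)])
    have "\<phi> n (cf m i n x) = \<kappa> i n x" if x: "x \<in> elts (S m) n" for n x
    proof (rule simplex_lie_morphism_eqI[OF AA lie_morphism_comp[OF cdgl_morphism_lie[OF cm] \<phi>]
          cdgl_morphism_lie[OF \<kappa>[OF iJ(1)]] _ x])
      fix K assume K: "K \<in> faces m"
      have "coface_map i ` K \<noteq> ?top" using coface_map_proper[of i K m] iJ(1) by auto
      then show "\<phi> (face_deg K) (cf m i (face_deg K) (face_gen m K)) = \<kappa> i (face_deg K) (face_gen m K)"
        using g coface_map_faces[OF iJ(1) K] f[OF iJ(1) K] coface_gen[OF iJ(1) K] face_deg_coface[of i K] by metis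
    qed
    from this[OF D.dif_closed[OF gJ]]
    have "\<phi> (face_deg J - 1) (dif ?C (face_deg J) (cf m i (face_deg J) (face_gen m J))) =
        dif A (face_deg J) (\<kappa> i (face_deg J) (face_gen m J))"
      using cdgl_morphism_dif[OF cm gJ] cdgl_morphism_dif[OF \<kappa>[OF iJ(1)] gJ] by simp
    moreover have "\<phi> (face_deg J) (face_gen ?n I) = f I"
      using g[rule_format, OF I] unfolding iJ(3) face_deg_coface .
    ultimately show ?thesis
      using f[OF iJ(1,2)] coface_gen[OF iJ(1,2)] unfolding iJ(3) face_deg_coface by simp
  qed
  have "\<exists>\<phi>. cdgl_morphism ?C A \<phi> \<and> (\<forall>I\<in>faces ?n. I \<noteq> ?top \<longrightarrow> \<phi> (face_deg I) (face_gen ?n I) = f I) \<and>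
      p (int m) (\<phi> (int m) (face_gen ?n ?top)) = v (int m) (face_gen ?n ?top)"
  proof -
    have v0: "{0} \<in> faces ?n" "{0} \<noteq> ?top" by (auto simp: faces_iff)
    have gt: "face_gen ?n ?top \<in> elts ?C (int m)" using simplex_gen_closed[OF top(1)] top(2) by simp
    have "{0 :: nat} \<in> faces m" by (auto simp: faces_iff)
    have MC0: "f {0} \<in> MC A"
    proof -
      have "coface_map 1 ` {0} = {0}" by (simp add: coface_map_def)
      then have "f {0} = \<kappa> 1 (-1) (face_gen m {0})" using f[of 1 "{0}"] \<open>{0} \<in> faces m\<close> by simp
      then show ?thesis
        using cdgl_morphism_MC[OF \<kappa>[of 1] complete_dgl AA vertex_MC[of 0 m]] by simp
    qed
    show ?thesis
    proof (cases m)
      case 0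
      have MC1: "f {1} \<in> MC A"
      proof -
        have "coface_map 0 ` {0} = {1}" by (simp add: coface_map_def)
        then have "f {1} = \<kappa> 0 (-1) (face_gen m {0})" using f[of 0 "{0}"] \<open>{0} \<in> faces m\<close> by simp
        then show ?thesis
          using cdgl_morphism_MC[OF \<kappa>[of 0] complete_dgl AA vertex_MC[of 0 m]] by simp
      qed
      have top1: "?top = {0, 1}" using 0 by auto
      have F: "{0} \<in> faces ?n" "{1} \<in> faces ?n" "{1} \<noteq> ?top" by (auto simp: faces_iff)
      have gc: "face_gen ?n {0} \<in> elts ?C (-1)" "face_gen ?n {1} \<in> elts ?C (-1)" "face_gen ?n ?top \<in> elts ?C 0"
        using simplex_gen_closed[OF F(1)] simplex_gen_closed[OF F(2)] gt 0 by simp_all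
      have ip: "path_relation ?C (face_gen ?n ?top) (face_gen ?n {0}) (face_gen ?n {1})"
        using interval_path 0 unfolding top1 by simp
      have "path_relation B (v 0 (face_gen ?n ?top)) (p (-1) (f {0})) (p (-1) (f {1}))"
        using cdgl_morphism_path[OF v CC BB gc(3,1,2) ip] pf[OF v0] pf[OF F(2,3)] by simp
      then obtain x where x: "x \<in> elts A 0" "p 0 x = v 0 (face_gen ?n ?top)" "path_relation A x (f {0}) (f {1})"
        using lift_path[OF MC0 MC1] lie_morphism_closed[OF cdgl_morphism_lie[OF v] gc(3)] by blast
      obtain \<phi> where \<phi>: "lie_morphism ?C A \<phi>"
        "\<forall>I\<in>faces ?n. I \<noteq> ?top \<longrightarrow> \<phi> (face_deg I) (face_gen ?n I) = f I" "\<phi> 0 (face_gen ?n ?top) = x"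
        using ex[of x] x(1) 0 by auto
      have g: "\<phi> (-1) (face_gen ?n {0}) = f {0}" "\<phi> (-1) (face_gen ?n {1}) = f {1}"
        using \<phi>(2) v0 F by auto
      have "\<phi> (-1) (dif ?C 0 (face_gen ?n ?top)) = dif A 0 (\<phi> 0 (face_gen ?n ?top))"
        using lie_morphism_path_formula[OF \<phi>(1) CC AA gc(3,1,2) ip] g \<phi>(3) x(3) by simp
      then have "cdgl_morphism ?C A \<phi>"
        using facet[OF \<phi>(1,2)] top 0 by (intro simplex_cdgl_morphismI[OF AA \<phi>(1)]) (metis diff_0 of_nat_0)
      then show ?thesis using \<phi> x(2) 0 by auto
    next
      case (Suc m')
      let ?a = "f {0}" and ?g0 = "face_gen ?n {0}" and ?gt = "face_gen ?n ?top"
      have g0: "?g0 \<in> MC ?C" "?g0 \<in> elts ?C (-1)" using vertex_MC[of 0 ?n] C.MC_closed by auto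
      let ?\<omega> = "twisted_dif ?C ?g0 (int m) ?gt"
      have \<omega>: "?\<omega> \<in> boundary_cdgl d ?n (int m - 1)"
        using top_cell[of ?n] Suc by simp
      have \<omega>c: "?\<omega> \<in> elts ?C (int m - 1)" by (rule C.twisted_dif_closed[OF g0(2) gt])
      have dt: "dif ?C (int m) ?gt \<in> elts ?C (int m - 1)" using gt by simp
      have bt: "brk ?C (-1) (int m) ?g0 ?gt \<in> elts ?C (int m - 1)" using C.brk_closed[OF g0(2) gt] by simp
      \<comment> \<open>A provisional value at the top generator; by \<open>boundary_agreement\<close> it does not affect the value at \<open>?\<omega>\<close>.\<close>
      obtain \<phi> where \<phi>: "lie_morphism ?C A \<phi>"
        "\<forall>I\<in>faces ?n. I \<noteq> ?top \<longrightarrow> \<phi> (face_deg I) (face_gen ?n I) = f I"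
        using ex[of "\<zero>\<^bsub>sp A (int m)\<^esub>"] by auto
      have a: "?a \<in> elts A (-1)" using A.MC_closed[OF MC0] .
      have \<phi>0: "\<phi> (-1) ?g0 = ?a" using \<phi>(2) v0 by auto
      let ?z = "\<phi> (int m - 1) ?\<omega>"
      have z: "?z \<in> elts A (int m - 1)" by (rule lie_morphism_closed[OF \<phi>(1) \<omega>c])
      have v_lie: "lie_morphism ?C B v" by (rule cdgl_morphism_lie[OF v])
      have p\<phi>: "lie_morphism ?C B (\<lambda>n x. p n (\<phi> n x))"
        by (rule lie_morphism_comp[OF \<phi>(1) cdgl_morphism_lie[OF p_morphism]])
      have pz: "p (int m - 1) ?z = twisted_dif B (p (-1) ?a) (int m) (v (int m) ?gt)"
      proof -
        have "p (int m - 1) (\<phi> (int m - 1) ?\<omega>) = v (int m - 1) ?\<omega>"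
        proof (rule boundary_agreement(1)[OF BB p\<phi> v_lie _ _ _ \<omega>])
          fix I assume I: "I \<in> faces ?n" "I \<noteq> ?top"
          have gI: "face_gen ?n I \<in> elts ?C (face_deg I)" by (rule simplex_gen_closed[OF I(1)])
          show "p (face_deg I) (\<phi> (face_deg I) (face_gen ?n I)) = v (face_deg I) (face_gen ?n I)"
            using \<phi>(2) I pf[OF I] by simp
          show "v (face_deg I - 1) (dif ?C (face_deg I) (face_gen ?n I)) = dif B (face_deg I) (v (face_deg I) (face_gen ?n I))"
            by (rule cdgl_morphism_dif[OF v gI])
          show "p (face_deg I - 1) (\<phi> (face_deg I - 1) (dif ?C (face_deg I) (face_gen ?n I))) =
              dif B (face_deg I) (p (face_deg I) (\<phi> (face_deg I) (face_gen ?n I)))"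
            unfolding facet[OF \<phi> I] by (rule cdgl_morphism_dif[OF p_morphism lie_morphism_closed[OF \<phi>(1) gI]])
        qed
        also have "\<dots> = twisted_dif B (v (-1) ?g0) (int m) (v (int m) ?gt)"
          by (rule cdgl_morphism_twisted_dif[OF v CC BB g0(2) gt])
        also have "v (-1) ?g0 = p (-1) ?a" using pf[OF v0] by simp
        finally show ?thesis .
      qed
      have tz: "twisted_dif A ?a (int m - 1) ?z = \<zero>\<^bsub>sp A (int m - 1 - 1)\<^esub>"
      proof -
        have "\<phi> (int m - 1 - 1) (dif ?C (int m - 1) ?\<omega>) = dif A (int m - 1) ?z"
          by (rule boundary_agreement(2)[OF AA \<phi>(1) \<phi>(1) refl facet[OF \<phi>] facet[OF \<phi>] \<omega>])
        moreover have "brk ?C (-1) (int m - 1) ?g0 ?\<omega> \<in> elts ?C (int m - 1 - 1)"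
          using C.brk_closed[OF g0(2) \<omega>c] by simp
        moreover have "\<phi> (int m - 1 - 1) (brk ?C (-1) (int m - 1) ?g0 ?\<omega>) = brk A (-1) (int m - 1) ?a ?z"
          using lie_morphism_brk[OF \<phi>(1) g0(2) \<omega>c] \<phi>0 by simp
        ultimately have "twisted_dif A ?a (int m - 1) ?z = \<phi> (int m - 1 - 1) (twisted_dif ?C ?g0 (int m - 1) ?\<omega>)"
          unfolding twisted_dif_def[of _ _ "int m - 1"] using C.dif_closed[OF \<omega>c]
          by (simp only: lie_morphism_ops(2)[OF \<phi>(1) CC AA])
        also have "\<dots> = \<zero>\<^bsub>sp A (int m - 1 - 1)\<^esub>"
          using C.twisted_dif_square[OF g0(1) gt] lie_morphism_ops(1)[OF \<phi>(1) CC AA, of "int m - 2"] by simp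
        finally show ?thesis .
      qed
      have "0 \<le> int m - 1" using Suc by simp
      note prim = lift_primitive[OF MC0 this z tz, unfolded diff_add_cancel]
      obtain u where u: "u \<in> elts A (int m)" "?z = twisted_dif A ?a (int m) u" "p (int m) u = v (int m) ?gt"
        using prim[OF lie_morphism_closed[OF v_lie gt] pz] by blast
      obtain \<psi> where \<psi>: "lie_morphism ?C A \<psi>"
        "\<forall>I\<in>faces ?n. I \<noteq> ?top \<longrightarrow> \<psi> (face_deg I) (face_gen ?n I) = f I" "\<psi> (int m) ?gt = u"
        using ex[OF u(1)] by blast
      have \<psi>0: "\<psi> (-1) ?g0 = ?a" using \<psi>(2) v0 by auto
      have "\<psi> (int m - 1) ?\<omega> = ?z"
        by (rule boundary_agreement(1)[OF AA \<psi>(1) \<phi>(1) _ facet[OF \<psi>(1,2)] facet[OF \<phi>] \<omega>])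
          (use \<phi>(2) \<psi>(2) in auto)
      moreover have "\<psi> (int m - 1) (brk ?C (-1) (int m) ?g0 ?gt) = brk A (-1) (int m) ?a u"
        using lie_morphism_brk[OF \<psi>(1) g0(2) gt] \<psi>0 \<psi>(3) by simp
      ultimately have "\<psi> (int m - 1) (dif ?C (int m) ?gt) \<oplus>\<^bsub>sp A (int m - 1)\<^esub> brk A (-1) (int m) ?a u =
          dif A (int m) u \<oplus>\<^bsub>sp A (int m - 1)\<^esub> brk A (-1) (int m) ?a u"
        using u(2) dt bt by (simp add: twisted_dif_def lie_morphism_ops(2)[OF \<psi>(1) CC AA])
      then have "\<psi> (int m - 1) (dif ?C (int m) ?gt) = dif A (int m) (\<psi> (int m) ?gt)"
        using A.sp.add.right_cancel[of "brk A (-1) (int m) ?a u" "int m - 1"] A.brk_closed[OF a u(1)]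
          lie_morphism_closed[OF \<psi>(1) dt] A.dif_closed[OF u(1)] \<psi>(3) by simp
      then have "cdgl_morphism ?C A \<psi>"
        using facet[OF \<psi>(1,2)] top by (intro simplex_cdgl_morphismI[OF AA \<psi>(1)]) metis
      then show ?thesis using \<psi> u(3) by blast
    qed
  qed
  then obtain \<phi> where \<phi>: "cdgl_morphism ?C A \<phi>"
    "\<forall>I\<in>faces ?n. I \<noteq> ?top \<longrightarrow> \<phi> (face_deg I) (face_gen ?n I) = f I"
    "p (int m) (\<phi> (int m) (face_gen ?n ?top)) = v (int m) (face_gen ?n ?top)" by blast
  have "\<phi> (face_deg J) (face_gen ?n (coface_map i ` J)) = \<kappa> i (face_deg J) (face_gen m J)"
    if iJ: "i \<le> ?n" "J \<in> faces m" for i J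
  proof -
    have "coface_map i ` J \<noteq> ?top" using coface_map_proper[of i J m] iJ(1) by linarith
    from \<phi>(2)[rule_format, OF coface_map_faces[OF iJ] this] show ?thesis
      unfolding face_deg_coface f[OF iJ] .
  qed
  moreover have "p (face_deg I) (\<phi> (face_deg I) (face_gen ?n I)) = v (face_deg I) (face_gen ?n I)"
    if I: "I \<in> faces ?n" for I
    using \<phi>(2,3) pf[OF I] top I by (cases "I = ?top") auto
  ultimately show ?thesis using \<phi>(1) by blast
qed

lemma lift_vertex:
  assumes v: "cdgl_morphism (S 0) B v"
  shows "\<exists>\<phi>. cdgl_morphism (S 0) A \<phi> \<and>
    (\<forall>I\<in>faces 0. p (face_deg I) (\<phi> (face_deg I) (face_gen 0 I)) = v (face_deg I) (face_gen 0 I))"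
proof -
  have F: "I = {0}" if "I \<in> faces 0" for I using that by (auto simp: faces_iff)
  have "v (-1) (face_gen 0 {0}) \<in> MC B"
    using cdgl_morphism_MC[OF v complete_dgl BB vertex_MC[of 0 0]] by simp
  then obtain a where a: "a \<in> MC A" "p (-1) a = v (-1) (face_gen 0 {0})" using lift_MC by blast
  have "a \<in> elts A (face_deg I)" if "I \<in> faces 0" for I using F[OF that] A.MC_closed[OF a(1)] by simp
  from simplex_ex_lie_morphism[OF AA this] obtain \<phi> where
    \<phi>: "lie_morphism (S 0) A \<phi>" "\<forall>I\<in>faces 0. \<phi> (face_deg I) (face_gen 0 I) = a" by blast
  have "{0} \<in> faces 0" by (auto simp: faces_iff)
  then have g: "\<phi> (-1) (face_gen 0 {0}) = a" using \<phi>(2) by force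
  have "cdgl_morphism (S 0) A \<phi>"
  proof (rule simplex_cdgl_morphismI[OF AA \<phi>(1)])
    fix I assume "I \<in> faces 0"
    then have "I = {0}" by (rule F)
    then show "\<phi> (face_deg I - 1) (dif (S 0) (face_deg I) (face_gen 0 I)) = dif A (face_deg I) (\<phi> (face_deg I) (face_gen 0 I))"
      using lie_morphism_MC_iff[OF \<phi>(1) complete_dgl AA vertex_MC[of 0 0]] g a(1) by simp
  qed
  moreover have "p (face_deg I) (\<phi> (face_deg I) (face_gen 0 I)) = v (face_deg I) (face_gen 0 I)"
    if "I \<in> faces 0" for I using F[OF that] g a(2) by simp
  ultimately show ?thesis by blast
qed

end

section \<open>Lifting cocones over the simplices of a simplicial set\<close>

lemma codegeneracy_codegeneracy_map:
  "i < j \<Longrightarrow> codegeneracy_map (j - 1) (codegeneracy_map i k) = codegeneracy_map i (codegeneracy_map j k)"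
  by (auto simp: codegeneracy_map_def)

lemma codegeneracy_coface_map_less:
  "i < j \<Longrightarrow> codegeneracy_map j (coface_map i k) = coface_map i (codegeneracy_map (j - 1) k)"
  by (auto simp: codegeneracy_map_def coface_map_def)

lemma codegeneracy_coface_map_same:
  "i = j \<or> i = Suc j \<Longrightarrow> codegeneracy_map j (coface_map i k) = k"
  by (auto simp: codegeneracy_map_def coface_map_def)

lemma codegeneracy_coface_map_greater:
  "Suc j < i \<Longrightarrow> codegeneracy_map j (coface_map i k) = coface_map (i - 1) (codegeneracy_map j k)"
  by (auto simp: codegeneracy_map_def coface_map_def)

lemma coface_coface_map: "i < j \<Longrightarrow> coface_map j (coface_map i k) = coface_map i (coface_map (j - 1) k)"
  by (auto simp: coface_map_def)

lemma codegeneracy_faces: "\<lbrakk>j \<le> n; I \<in> faces (Suc n)\<rbrakk> \<Longrightarrow> codegeneracy_map j ` I \<in> faces n"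
  by (force simp: faces_iff codegeneracy_map_def)

lemma face_deg_image: "inj_on g I \<Longrightarrow> face_deg (g ` I) = face_deg I"
  by (simp add: face_deg_def card_image)

definition agree_on_generators ::
    "nat \<Rightarrow> (int \<Rightarrow> simp_elt \<Rightarrow> 'b) \<Rightarrow> (int \<Rightarrow> simp_elt \<Rightarrow> 'b) \<Rightarrow> bool"
  where "agree_on_generators n \<phi> \<psi> \<longleftrightarrow>
    (\<forall>I\<in>faces n. \<phi> (face_deg I) (face_gen n I) = \<psi> (face_deg I) (face_gen n I))"

context cosimplicial_simplex_cdgl
begin

lemma eq_morphism_iff_generators:
  assumes "complete_dg_lie_algebra A" "cdgl_morphism (S n) A \<phi>" "cdgl_morphism (S n) A \<psi>"
  shows "eq_morphism (S n) \<phi> \<psi> \<longleftrightarrow> agree_on_generators n \<phi> \<psi>"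
  using simplex_lie_morphism_eqI[OF assms(1) assms(2)[THEN cdgl_morphism_lie] assms(3)[THEN cdgl_morphism_lie]]
    simplex_gen_closed
  by (auto simp: eq_morphism_def agree_on_generators_def)

lemma morphism_codegeneracy_gen:
  assumes "complete_dg_lie_algebra A" "cdgl_morphism (S n) A \<phi>" "j \<le> n" "I \<in> faces (Suc n)"
  shows "\<phi> (face_deg I) (cd n j (face_deg I) (face_gen (Suc n) I)) =
    (if inj_on (codegeneracy_map j) I
     then \<phi> (face_deg (codegeneracy_map j ` I)) (face_gen n (codegeneracy_map j ` I))
     else \<zero>\<^bsub>sp A (face_deg I)\<^esub>)"
  using codegeneracy_gen[OF assms(3,4)] face_deg_image[of "codegeneracy_map j" I]
    lie_morphism_ops(1)[OF cdgl_morphism_lie[OF assms(2)] complete_dgl assms(1)] by simp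

lemma codegeneracy_codegeneracy:
  assumes "i < j" "j \<le> Suc n" "I \<in> faces (Suc (Suc n))"
  shows "cd n (j - 1) (face_deg I) (cd (Suc n) i (face_deg I) (face_gen (Suc (Suc n)) I)) =
    cd n i (face_deg I) (cd (Suc n) j (face_deg I) (face_gen (Suc (Suc n)) I))"
proof -
  have two: "cd n k (face_deg I) (cd (Suc n) l (face_deg I) (face_gen (Suc (Suc n)) I)) =
      (if inj_on (codegeneracy_map k \<circ> codegeneracy_map l) I
       then face_gen n ((codegeneracy_map k \<circ> codegeneracy_map l) ` I) else \<zero>\<^bsub>sp (S n) (face_deg I)\<^esub>)"
    if "k \<le> n" "l \<le> Suc n" for k l
  proof (cases "inj_on (codegeneracy_map l) I")
    case True
    then show ?thesis
      using morphism_codegeneracy_gen[OF complete_dgl codegeneracy_morphism[OF that(1)] that(2) assms(3)]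
        codegeneracy_gen[OF that(1) codegeneracy_faces[OF that(2) assms(3)]]
        comp_inj_on_iff[OF True, of "codegeneracy_map k"]
      by (simp add: face_deg_image image_comp)
  next
    case False
    then have "\<not> inj_on (codegeneracy_map k \<circ> codegeneracy_map l) I"
      using inj_on_imageI2 by blast
    then show ?thesis
      using False morphism_codegeneracy_gen[OF complete_dgl codegeneracy_morphism[OF that(1)] that(2) assms(3)] by simp
  qed
  have "codegeneracy_map (j - 1) \<circ> codegeneracy_map i = codegeneracy_map i \<circ> codegeneracy_map j"
    using codegeneracy_codegeneracy_map[OF assms(1)] by (auto simp: fun_eq_iff)
  then show ?thesis using two[of "j - 1" i] two[of i j] assms by simp
qed

end

locale cocone_lifting = lifting_setup d cf cd A B p + simplicial_set X
  for d cf cd and A B :: "'u cdgl" and p and X :: "'x sset" +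
  fixes w :: "nat \<Rightarrow> 'x \<Rightarrow> int \<Rightarrow> simp_elt \<Rightarrow> 'u"
  assumes cocone: "model_cocone d cf cd X B w"
begin

lemma w_morphism: "x \<in> simplices X n \<Longrightarrow> cdgl_morphism (S n) B (w n x)"
  using cocone by (simp add: model_cocone_def)

lemma w_face:
  "\<lbrakk>x \<in> simplices X (Suc n); i \<le> Suc n; I \<in> faces n\<rbrakk> \<Longrightarrow>
    w n (face X n i x) (face_deg I) (face_gen n I) = w (Suc n) x (face_deg I) (face_gen (Suc n) (coface_map i ` I))"
  using cocone coface_gen[of i n I] simplex_gen_closed[of I n]
  by (auto simp: model_cocone_def eq_morphism_def comp_morphism_def)

lemma w_degeneracy:
  "\<lbrakk>x \<in> simplices X n; j \<le> n; I \<in> faces (Suc n)\<rbrakk> \<Longrightarrow>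
    w (Suc n) (degeneracy X n j x) (face_deg I) (face_gen (Suc n) I) =
    w n x (face_deg I) (cd n j (face_deg I) (face_gen (Suc n) I))"
  using cocone simplex_gen_closed[of I "Suc n"]
  by (auto simp: model_cocone_def eq_morphism_def comp_morphism_def)

definition lifts :: "nat \<Rightarrow> 'x \<Rightarrow> (int \<Rightarrow> simp_elt \<Rightarrow> 'u) \<Rightarrow> bool"
  where "lifts n x \<phi> \<longleftrightarrow> cdgl_morphism (S n) A \<phi> \<and> agree_on_generators n (comp_morphism p \<phi>) (w n x)"

text \<open>
  The conditions on the lift at an \<open>(n+1)\<close>-simplex \<open>x\<close>, given the lifts \<open>k\<close> at all \<open>n\<close>-simplices. The condition refers
  to all presentations of \<open>x\<close> as a degeneracy, since there may be several.
\<close>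

definition extends :: "nat \<Rightarrow> ('x \<Rightarrow> int \<Rightarrow> simp_elt \<Rightarrow> 'u) \<Rightarrow> 'x \<Rightarrow> (int \<Rightarrow> simp_elt \<Rightarrow> 'u) \<Rightarrow> bool"
  where "extends n k x \<phi> \<longleftrightarrow> lifts (Suc n) x \<phi> \<and>
    (\<forall>i\<le>Suc n. agree_on_generators n (k (face X n i x)) (comp_morphism \<phi> (cf n i))) \<and>
    (\<forall>y\<in>simplices X n. \<forall>j\<le>n. x = degeneracy X n j y \<longrightarrow>
       agree_on_generators (Suc n) \<phi> (comp_morphism (k y) (cd n j)))"

text \<open>
  The lifts are chosen dimension by dimension. The conditions at dimension \<open>n + 1\<close> refer to the lifts in dimension \<open>n\<close>
  only; their solvability also depends on the conditions met there.
\<close>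

primrec lifted_cocone :: "nat \<Rightarrow> 'x \<Rightarrow> int \<Rightarrow> simp_elt \<Rightarrow> 'u"
  where
    "lifted_cocone 0 = (\<lambda>x. SOME \<phi>. lifts 0 x \<phi>)"
  | "lifted_cocone (Suc n) = (\<lambda>x. SOME \<phi>. extends n (lifted_cocone n) x \<phi>)"

abbreviation "K \<equiv> lifted_cocone"

lemma degeneracy_inj:
  assumes "y \<in> simplices X n" "y' \<in> simplices X n" "j \<le> n" "degeneracy X n j y = degeneracy X n j y'"
  shows "y = y'"
  using face_degeneracy_same[of j j n y] face_degeneracy_same[of j j n y'] assms by metis

text \<open>
  If \<open>s\<^sub>i y = s\<^sub>j z\<close> with \<open>i < j\<close>, then the common origin of \<open>y\<close> and \<open>z\<close> is the face \<open>d\<^sub>i z\<close>: apply \<open>d\<^sub>i\<close> to the equation for \<open>y\<close>, and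
  cancel the injective \<open>s\<^sub>j\<close> for \<open>z\<close>.
\<close>

lemma degenerate_twice:
  assumes y: "y \<in> simplices X n" and z: "z \<in> simplices X n" and ij: "i < j" "j \<le> n"
    and e: "degeneracy X n i y = degeneracy X n j z"
  shows "\<exists>m u. n = Suc m \<and> u \<in> simplices X m \<and> y = degeneracy X m (j - 1) u \<and> z = degeneracy X m i u"
proof -
  obtain m where m: "n = Suc m" using ij by (cases n) auto
  let ?u = "face X m i z"
  have u: "?u \<in> simplices X m" using face_closed[of i m z] z ij m by simp
  have "y = face X n i (degeneracy X n i y)" using face_degeneracy_same[of i i n y] ij y by simp
  also have "\<dots> = degeneracy X m (j - 1) ?u"
    unfolding e using face_degeneracy_less[of i j m z] ij z m by simp
  finally have y': "y = degeneracy X m (j - 1) ?u" .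
  have "degeneracy X n j z = degeneracy X n i (degeneracy X m (j - 1) ?u)"
    unfolding e[symmetric] by (rule arg_cong[OF y'])
  also have "\<dots> = degeneracy X n j (degeneracy X m i ?u)"
    using degeneracy_degeneracy[of i "j - 1" m ?u] ij u m by simp
  finally have "degeneracy X n j z = degeneracy X n j (degeneracy X m i ?u)" .
  then have "z = degeneracy X m i ?u"
    using degeneracy_inj[OF z _ ij(2)] degeneracy_closed[of i m ?u] u ij m by simp
  then show ?thesis using m u y' by blast
qed

text \<open>The induction step: the lifts chosen up to dimension \<open>n\<close> satisfy their conditions.\<close>

context
  fixes n
  assumes ext: "\<And>m x. \<lbrakk>n = Suc m; x \<in> simplices X n\<rbrakk> \<Longrightarrow> extends m (K m) x (K n x)"
    and lft: "\<And>m x. \<lbrakk>m \<le> n; x \<in> simplices X m\<rbrakk> \<Longrightarrow> lifts m x (K m x)"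
begin

lemma K_morphism: "\<lbrakk>m \<le> n; x \<in> simplices X m\<rbrakk> \<Longrightarrow> cdgl_morphism (S m) A (K m x)"
  using lft by (simp add: lifts_def)

lemma K_face:
  assumes "n = Suc m" "x \<in> simplices X n" "i \<le> n" "J \<in> faces m"
  shows "K m (face X m i x) (face_deg J) (face_gen m J) = K n x (face_deg J) (face_gen n (coface_map i ` J))"
  using ext[OF assms(1,2)] assms coface_gen[of i m J]
  by (simp add: extends_def agree_on_generators_def comp_morphism_def)

lemma K_degeneracy:
  assumes "n = Suc m" "y \<in> simplices X m" "j \<le> m" "x \<in> elts (S n) q"
  shows "K n (degeneracy X m j y) q x = K m y q (cd m j q x)"
proof -
  have c: "degeneracy X m j y \<in> simplices X n" using degeneracy_closed assms by simp
  have "agree_on_generators n (K n (degeneracy X m j y)) (comp_morphism (K m y) (cd m j))"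
    using ext[OF assms(1) c] assms by (auto simp: extends_def)
  moreover have "cdgl_morphism (S n) A (comp_morphism (K m y) (cd m j))"
    using cdgl_morphism_comp_morphism[OF codegeneracy_morphism[OF assms(3)] K_morphism[OF _ assms(2)]] assms(1) by simp
  ultimately have "eq_morphism (S n) (K n (degeneracy X m j y)) (comp_morphism (K m y) (cd m j))"
    using eq_morphism_iff_generators[OF AA K_morphism[OF order_refl c]] by simp
  then show ?thesis using assms(4) by (simp add: eq_morphism_def comp_morphism_def)
qed

text \<open>
  By \<open>degenerate_twice\<close> both sides are the lift at a common simplex composed with a twofold codegeneracy.
\<close>

lemma degenerate_presentations_agree:
  assumes y: "y \<in> simplices X n" and z: "z \<in> simplices X n" and ij: "i \<le> n" "j \<le> n"
    and e: "degeneracy X n i y = degeneracy X n j z" and I: "I \<in> faces (Suc n)"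
  shows "K n y (face_deg I) (cd n i (face_deg I) (face_gen (Suc n) I)) =
    K n z (face_deg I) (cd n j (face_deg I) (face_gen (Suc n) I))"
proof -
  have wlog: "K n y (face_deg I) (cd n i (face_deg I) (face_gen (Suc n) I)) =
      K n z (face_deg I) (cd n j (face_deg I) (face_gen (Suc n) I))"
    if h: "y \<in> simplices X n" "z \<in> simplices X n" "i < j" "j \<le> n" "degeneracy X n i y = degeneracy X n j z"
    for y z i j
  proof -
    obtain m u where m: "n = Suc m" "u \<in> simplices X m" "y = degeneracy X m (j - 1) u" "z = degeneracy X m i u"
      using degenerate_twice[OF h] by blast
    have c: "cd n k (face_deg I) (face_gen (Suc n) I) \<in> elts (S n) (face_deg I)" if "k \<le> n" for k
      using lie_morphism_closed[OF cdgl_morphism_lie[OF codegeneracy_morphism[OF that]] simplex_gen_closed[OF I]] .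
    have "K n y (face_deg I) (cd n i (face_deg I) (face_gen (Suc n) I)) =
        K m u (face_deg I) (cd m (j - 1) (face_deg I) (cd n i (face_deg I) (face_gen (Suc n) I)))"
      unfolding m(3) using h m by (intro K_degeneracy c) auto
    also have "cd m (j - 1) (face_deg I) (cd n i (face_deg I) (face_gen (Suc n) I)) =
        cd m i (face_deg I) (cd n j (face_deg I) (face_gen (Suc n) I))"
      using codegeneracy_codegeneracy[of i j m I] h I m(1) by simp
    also have "K m u (face_deg I) \<dots> = K n z (face_deg I) (cd n j (face_deg I) (face_gen (Suc n) I))"
      unfolding m(4) using h m by (intro K_degeneracy[symmetric] c) auto
    finally show ?thesis .
  qed
  consider "i < j" | "i = j" | "j < i" by linarith
  then show ?thesis
  proof cases
    case 1
    then show ?thesis using wlog[OF y z] ij e by simp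
  next
    case 2
    then show ?thesis using degeneracy_inj[OF y z ij(1)] e by simp
  next
    case 3
    then show ?thesis using wlog[OF z y] ij e by simp
  qed
qed

text \<open>
  The simplicial identities for a face of a degeneracy match the cosimplicial identities for a codegeneracy of a coface,
  so composing the lift at \<open>y\<close> with the codegeneracy is compatible with all faces.
\<close>

lemma extend_degenerate:
  assumes y: "y \<in> simplices X n" and j: "j \<le> n"
  shows "extends n (K n) (degeneracy X n j y) (comp_morphism (K n y) (cd n j))"
proof -
  let ?x = "degeneracy X n j y" and ?\<phi> = "comp_morphism (K n y) (cd n j)"
  have mor: "cdgl_morphism (S (Suc n)) A ?\<phi>"
    by (rule cdgl_morphism_comp_morphism[OF codegeneracy_morphism[OF j] K_morphism[OF order_refl y]])
  have val: "?\<phi> (face_deg I) (face_gen (Suc n) I) =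
      (if inj_on (codegeneracy_map j) I
       then K n y (face_deg (codegeneracy_map j ` I)) (face_gen n (codegeneracy_map j ` I))
       else \<zero>\<^bsub>sp A (face_deg I)\<^esub>)" if "I \<in> faces (Suc n)" for I
    using morphism_codegeneracy_gen[OF AA K_morphism[OF order_refl y] j that] by (simp add: comp_morphism_def)
  have lifts: "lifts (Suc n) ?x ?\<phi>"
  proof -
    have "agree_on_generators n (comp_morphism p (K n y)) (w n y)"
      using lft[OF order_refl y] by (simp add: lifts_def)
    then have e: "eq_morphism (S n) (comp_morphism p (K n y)) (w n y)"
      using eq_morphism_iff_generators[OF BB cdgl_morphism_comp_morphism[OF K_morphism[OF order_refl y] p_morphism]
          w_morphism[OF y]] by simp
    have "p (face_deg I) (?\<phi> (face_deg I) (face_gen (Suc n) I)) = w (Suc n) ?x (face_deg I) (face_gen (Suc n) I)"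
      if I: "I \<in> faces (Suc n)" for I
      using e w_degeneracy[OF y j I]
        lie_morphism_closed[OF cdgl_morphism_lie[OF codegeneracy_morphism[OF j]] simplex_gen_closed[OF I]]
      by (simp add: eq_morphism_def comp_morphism_def)
    then show ?thesis using mor by (simp add: lifts_def agree_on_generators_def comp_morphism_def)
  qed
  have shifted: "K n (face X n i ?x) (face_deg J) (face_gen n J) = ?\<phi> (face_deg J) (face_gen (Suc n) (coface_map i ` J))"
    if n: "n = Suc m" and i: "i \<le> Suc n" and J: "J \<in> faces n"
      and i': "i' \<le> n" and j': "j' \<le> m" and u: "face X n i ?x = degeneracy X m j' (face X m i' y)"
      and maps: "\<And>k. codegeneracy_map j (coface_map i k) = coface_map i' (codegeneracy_map j' k)"
    for m i i' j' J
  proof -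
    have uc: "face X m i' y \<in> simplices X m" using face_closed y i' n by simp
    have inj: "inj_on (codegeneracy_map j) (coface_map i ` J) \<longleftrightarrow> inj_on (codegeneracy_map j') J"
    proof -
      have "inj_on (codegeneracy_map j) (coface_map i ` J) \<longleftrightarrow> inj_on (codegeneracy_map j \<circ> coface_map i) J"
        by (rule comp_inj_on_iff[OF inj_on_subset[OF coface_map_inj subset_UNIV]])
      also have "codegeneracy_map j \<circ> coface_map i = coface_map i' \<circ> codegeneracy_map j'"
        using maps by (simp add: fun_eq_iff)
      also have "inj_on \<dots> J \<longleftrightarrow> inj_on (codegeneracy_map j') J"
        using inj_eq[OF coface_map_inj] by (simp add: inj_on_def)
      finally show ?thesis .
    qed
    have im: "codegeneracy_map j ` coface_map i ` J = coface_map i' ` codegeneracy_map j' ` J"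
      using maps by (simp add: image_image)
    have J': "J \<in> faces (Suc m)" using J n by simp
    have "K n (face X n i ?x) (face_deg J) (face_gen n J) = K m (face X m i' y) (face_deg J) (cd m j' (face_deg J) (face_gen (Suc m) J))"
      unfolding u using K_degeneracy[OF n uc j', of "face_gen n J" "face_deg J"] simplex_gen_closed[OF J] n by simp
    also have "\<dots> = (if inj_on (codegeneracy_map j') J
        then K m (face X m i' y) (face_deg (codegeneracy_map j' ` J)) (face_gen m (codegeneracy_map j' ` J))
        else \<zero>\<^bsub>sp A (face_deg J)\<^esub>)"
      using morphism_codegeneracy_gen[OF AA K_morphism[OF _ uc] j' J'] n by simp
    also have "\<dots> = ?\<phi> (face_deg J) (face_gen (Suc n) (coface_map i ` J))"
      using val[OF coface_map_faces[OF i J]] K_face[OF n y i' codegeneracy_faces[OF j' J']]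
      by (simp add: inj im face_deg_coface)
    finally show ?thesis .
  qed
  have faces: "K n (face X n i ?x) (face_deg J) (face_gen n J) = ?\<phi> (face_deg J) (face_gen (Suc n) (coface_map i ` J))"
    if i: "i \<le> Suc n" and J: "J \<in> faces n" for i J
  proof -
    consider "i < j" | "i = j \<or> i = Suc j" | "Suc j < i" by linarith
    then show ?thesis
    proof cases
      case 1
      then obtain m where m: "n = Suc m" using j by (cases n) auto
      then show ?thesis
        using 1 j y m codegeneracy_coface_map_less[OF 1] face_degeneracy_less[of i j m y]
        by (intro shifted[OF m i J, of i "j - 1"]) auto
    next
      case 2
      have id: "codegeneracy_map j (coface_map i k) = k" for k using codegeneracy_coface_map_same[OF 2] .
      have "inj_on (codegeneracy_map j) (coface_map i ` J)" by (auto simp: inj_on_def id)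
      moreover have "codegeneracy_map j ` coface_map i ` J = J" by (simp add: image_image id)
      ultimately show ?thesis
        using val[OF coface_map_faces[OF i J]] face_degeneracy_same[OF 2 j y] by (simp add: face_deg_coface)
    next
      case 3
      then obtain m where m: "n = Suc m" using i by (cases n) auto
      then show ?thesis
        using 3 i y m codegeneracy_coface_map_greater[OF 3] face_degeneracy_greater[of j i m y]
        by (intro shifted[OF m i J, of "i - 1" j]) auto
    qed
  qed
  have "agree_on_generators n (K n (face X n i ?x)) (comp_morphism ?\<phi> (cf n i))" if "i \<le> Suc n" for i
    using faces[OF that] coface_gen[OF that] by (simp add: agree_on_generators_def comp_morphism_def)
  moreover have "agree_on_generators (Suc n) ?\<phi> (comp_morphism (K n z) (cd n i))"
    if "z \<in> simplices X n" "i \<le> n" "?x = degeneracy X n i z" for z i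
    using degenerate_presentations_agree[OF y that(1) j that(2,3)]
    by (simp add: agree_on_generators_def comp_morphism_def)
  ultimately show ?thesis using lifts by (simp add: extends_def)
qed

text \<open>
  Two facets of the simplex meet in a common face, on which both lifts restrict to the lift at the corresponding face of
  \<open>x\<close>. In dimension one the two facets are disjoint, so that there is nothing to compare.
\<close>

lemma facet_lifts_compatible:
  assumes x: "x \<in> simplices X (Suc n)" and ij: "i \<le> Suc n" "j \<le> Suc n"
    and J: "J \<in> faces n" "J' \<in> faces n" and e: "coface_map i ` J = coface_map j ` J'"
  shows "K n (face X n i x) (face_deg J) (face_gen n J) = K n (face X n j x) (face_deg J') (face_gen n J')"
proof -
  have wlog: "K n (face X n i x) (face_deg J) (face_gen n J) = K n (face X n j x) (face_deg J') (face_gen n J')"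
    if h: "i < j" "j \<le> Suc n" "J \<in> faces n" "J' \<in> faces n" "coface_map i ` J = coface_map j ` J'" for i j J J'
  proof -
    have missing: "i \<notin> coface_map j ` J'" unfolding h(5)[symmetric] by (auto simp: coface_map_def)
    have iJ': "i \<notin> J'" using missing h(1) by (force simp: coface_map_def)
    obtain m where m: "n = Suc m"
    proof (cases n)
      case 0
      then have "J' = {0}" "i = 0" using h(1,2,4) by (auto simp: faces_iff)
      then show ?thesis using iJ' by simp
    qed
    obtain Q where Q: "Q \<in> faces m" "J' = coface_map i ` Q"
      using proper_face[of J' m i] h iJ' m by auto
    have "coface_map i ` J = coface_map i ` coface_map (j - 1) ` Q"
      unfolding h(5) Q(2) by (simp add: image_image coface_coface_map[OF h(1)])
    then have J: "J = coface_map (j - 1) ` Q" by (simp only: inj_image_eq_iff[OF coface_map_inj])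
    have c: "face X n i x \<in> simplices X n" "face X n j x \<in> simplices X n"
      using face_closed[of i n x] face_closed[of j n x] x h(1,2) by auto
    have "K n (face X n i x) (face_deg J) (face_gen n J) = K m (face X m (j - 1) (face X n i x)) (face_deg Q) (face_gen m Q)"
      using K_face[OF m c(1) _ Q(1), of "j - 1"] h(1,2) by (simp add: J face_deg_coface)
    also have "face X m (j - 1) (face X n i x) = face X m i (face X n j x)"
      using face_face[of i j m x] h(1,2) x m by simp
    also have "K m \<dots> (face_deg Q) (face_gen m Q) = K n (face X n j x) (face_deg J') (face_gen n J')"
      using K_face[OF m c(2) _ Q(1), of i] h(1,2) by (simp add: Q(2) face_deg_coface)
    finally show ?thesis .
  qed
  consider "i < j" | "i = j" | "j < i" by linarith
  then show ?thesis
  proof cases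
    case 1
    then show ?thesis using wlog ij J e by blast
  next
    case 2
    then have "J = J'" using e by (simp only: inj_image_eq_iff[OF coface_map_inj])
    then show ?thesis using 2 by simp
  next
    case 3
    then show ?thesis using wlog[OF 3 ij(1) J(2,1) e[symmetric]] by simp
  qed
qed

lemma ex_extends:
  assumes x: "x \<in> simplices X (Suc n)" shows "\<exists>\<phi>. extends n (K n) x \<phi>"
proof (cases "\<exists>y\<in>simplices X n. \<exists>j\<le>n. x = degeneracy X n j y")
  case True
  then show ?thesis using extend_degenerate by blast
next
  case False
  have c: "face X n i x \<in> simplices X n" if "i \<le> Suc n" for i using face_closed[OF that x] .
  have pK: "p (face_deg J) (K n (face X n i x) (face_deg J) (face_gen n J)) = w (Suc n) x (face_deg J) (face_gen (Suc n) (coface_map i ` J))"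
    if "i \<le> Suc n" "J \<in> faces n" for i J
    using lft[OF order_refl c[OF that(1)]] that(2) w_face[OF x that]
    by (simp add: lifts_def agree_on_generators_def comp_morphism_def)
  obtain \<phi> where \<phi>: "cdgl_morphism (S (Suc n)) A \<phi>"
    "\<forall>i\<le>Suc n. \<forall>J\<in>faces n. \<phi> (face_deg J) (face_gen (Suc n) (coface_map i ` J)) = K n (face X n i x) (face_deg J) (face_gen n J)"
    "\<forall>I\<in>faces (Suc n). p (face_deg I) (\<phi> (face_deg I) (face_gen (Suc n) I)) = w (Suc n) x (face_deg I) (face_gen (Suc n) I)"
    using extend_over_simplex[OF w_morphism[OF x] K_morphism[OF order_refl c] pK facet_lifts_compatible[OF x]] by blast
  have "extends n (K n) x \<phi>"
    using \<phi> False coface_gen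
    by (auto simp: extends_def lifts_def agree_on_generators_def comp_morphism_def)
  then show ?thesis by blast
qed

end

lemma K_spec:
  "(\<forall>m x. n = Suc m \<longrightarrow> x \<in> simplices X n \<longrightarrow> extends m (K m) x (K n x)) \<and>
   (\<forall>m\<le>n. \<forall>x\<in>simplices X m. lifts m x (K m x))"
proof (induction n)
  case 0
  have "lifts 0 x (K 0 x)" if "x \<in> simplices X 0" for x
    using lift_vertex[OF w_morphism[OF that]] someI_ex[of "lifts 0 x"]
    by (simp add: lifts_def agree_on_generators_def comp_morphism_def)
  then show ?case by simp
next
  case (Suc n)
  have ex: "\<exists>\<phi>. extends n (K n) x \<phi>" if "x \<in> simplices X (Suc n)" for x
    using ex_extends[of n x] Suc that by blast
  have e: "extends n (K n) x (K (Suc n) x)" if "x \<in> simplices X (Suc n)" for x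
    using someI_ex[OF ex[OF that]] by simp
  have "lifts (Suc n) x (K (Suc n) x)" if "x \<in> simplices X (Suc n)" for x
    using e[OF that] by (simp add: extends_def)
  then show ?case using e Suc le_Suc_eq by auto
qed

lemma lifted_model_cocone:
  shows "model_cocone d cf cd X A K"
    and "x \<in> simplices X n \<Longrightarrow> eq_morphism (S n) (comp_morphism p (K n x)) (w n x)"
proof -
  have lft: "lifts n x (K n x)" if "x \<in> simplices X n" for n x using K_spec[of n] that by blast
  have mor: "cdgl_morphism (S n) A (K n x)" if "x \<in> simplices X n" for n x
    using lft[OF that] by (simp add: lifts_def)
  show "eq_morphism (S n) (comp_morphism p (K n x)) (w n x)" if x: "x \<in> simplices X n"
    using lft[OF x] eq_morphism_iff_generators[OF BB cdgl_morphism_comp_morphism[OF mor[OF x] p_morphism] w_morphism[OF x]]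
    by (simp add: lifts_def)
  have ext: "extends n (K n) x (K (Suc n) x)" if "x \<in> simplices X (Suc n)" for n x using K_spec[of "Suc n"] that by blast
  show "model_cocone d cf cd X A K"
    unfolding model_cocone_def
  proof (intro conjI allI ballI impI)
    fix n x i assume x: "x \<in> simplices X (Suc n)" and i: "i \<le> Suc n"
    show "eq_morphism (S n) (K n (face X n i x)) (comp_morphism (K (Suc n) x) (cf n i))"
      using ext[OF x] i eq_morphism_iff_generators[OF AA mor[OF face_closed[OF i x]]
          cdgl_morphism_comp_morphism[OF coface_morphism[OF i] mor[OF x]]]
      by (simp add: extends_def)
  next
    fix n x j assume x: "x \<in> simplices X n" and j: "j \<le> n"
    show "eq_morphism (S (Suc n)) (K (Suc n) (degeneracy X n j x)) (comp_morphism (K n x) (cd n j))"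
      using ext[OF degeneracy_closed[OF j x]] x j eq_morphism_iff_generators[OF AA mor[OF degeneracy_closed[OF j x]]
          cdgl_morphism_comp_morphism[OF codegeneracy_morphism[OF j] mor[OF x]]]
      by (auto simp: extends_def)
  qed (rule mor)
qed

end

section \<open>The model of a simplicial set is cofibrant\<close>

lemma model_cocone_comp:
  assumes k: "model_cocone d cf cd X L \<iota>" and v: "cdgl_morphism L B v"
  shows "model_cocone d cf cd X B (\<lambda>n x. comp_morphism v (\<iota> n x))"
  unfolding model_cocone_def
proof (intro conjI allI ballI impI)
  show "cdgl_morphism (simplex_cdgl d n) B (comp_morphism v (\<iota> n x))" if "x \<in> simplices X n" for n x
    using k v that by (intro cdgl_morphism_comp_morphism[of _ L]) (auto simp: model_cocone_def)
qed (use k in \<open>simp_all add: model_cocone_def eq_morphism_def comp_morphism_def\<close>)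

lemma zero_cdgl_morphism:
  assumes "complete_dg_lie_algebra L"
  shows "cdgl_morphism zero_cdgl L (\<lambda>n _. \<zero>\<^bsub>sp L n\<^esub>)"
proof -
  interpret complete_dg_lie_algebra L by fact
  show ?thesis
    using fil_mem(1) by (auto simp: cdgl_morphism_def zero_cdgl_def Q_linear_def)
qed

lemma morphism_from_zero_cdgl:
  assumes "complete_dg_lie_algebra L" "cdgl_morphism zero_cdgl L u" "x \<in> elts zero_cdgl n"
  shows "u n x = \<zero>\<^bsub>sp L n\<^esub>"
proof -
  interpret complete_dg_lie_algebra L by fact
  have l: "Q_linear (sp zero_cdgl n) (sp L n) (u n)" using assms(2) by (simp add: cdgl_morphism_def)
  have "0 \<odot>\<^bsub>sp zero_cdgl n\<^esub> x = x" using assms(3) by (simp add: zero_cdgl_def)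
  then show ?thesis using Q_linear_smult[OF l assms(3), of 0] Q_linear_closed[OF l assms(3)] by simp
qed

theorem proposition0p5:
  fixes d :: "nat \<Rightarrow> int \<Rightarrow> simp_elt \<Rightarrow> simp_elt"
    and cf cd :: "nat \<Rightarrow> nat \<Rightarrow> int \<Rightarrow> simp_elt \<Rightarrow> simp_elt"
    and X :: "'x sset"
    and LX :: "'u cdgl"
    and \<iota> :: "nat \<Rightarrow> 'x \<Rightarrow> int \<Rightarrow> simp_elt \<Rightarrow> 'u"
  assumes "cosimplicial_simplex_cdgl d cf cd"
    and "simplicial_set X"
    and "finite_sset X"
    and "is_model d cf cd X LX \<iota>"
  shows "cofibrant LX"
proof -
  have L: "complete_dg_lie_algebra LX" and \<iota>: "model_cocone d cf cd X LX \<iota>"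
    using assms(4) by (auto simp: is_model_def)
  have "left_lifting zero_cdgl LX (\<lambda>n _. \<zero>\<^bsub>sp LX n\<^esub>) A B p"
    if A: "complete_dg_lie_algebra A" and B: "complete_dg_lie_algebra B"
      and p: "fibration A B p" "weak_equivalence A B p" for A B :: "'u cdgl" and p
    unfolding left_lifting_def
  proof (intro allI impI, elim conjE)
    fix u v assume u: "cdgl_morphism zero_cdgl A u" and v: "cdgl_morphism LX B v"
    let ?w = "\<lambda>n x. comp_morphism v (\<iota> n x)"
    have w: "model_cocone d cf cd X B ?w" by (rule model_cocone_comp[OF \<iota> v])
    interpret cocone_lifting d cf cd A B p X ?w
      by (intro cocone_lifting.intro lifting_setup.intro trivial_fibration.intro cocone_lifting_axioms.intro
          trivial_fibration_axioms.intro assms(1,2) A B p w)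
    obtain h where h: "cdgl_morphism LX A h"
      and hK: "\<And>n x. x \<in> simplices X n \<Longrightarrow> eq_morphism (S n) (comp_morphism h (\<iota> n x)) (K n x)"
      using assms(4) A lifted_model_cocone(1) unfolding is_model_def by metis
    \<comment> \<open>Both \<open>p \<circ> h\<close> and \<open>v\<close> are induced by the cocone \<open>v \<circ> \<iota>\<close>.\<close>
    obtain h' where h': "\<And>g. \<lbrakk>cdgl_morphism LX B g;
        \<And>n x. x \<in> simplices X n \<Longrightarrow> eq_morphism (S n) (comp_morphism g (\<iota> n x)) (?w n x)\<rbrakk> \<Longrightarrow> eq_morphism LX h' g"
      using assms(4) B w unfolding is_model_def by metis
    have "eq_morphism LX h' v" by (rule h'[OF v]) (simp add: eq_morphism_def)
    moreover have "eq_morphism LX h' (comp_morphism p h)"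
    proof (rule h'[OF cdgl_morphism_comp_morphism[OF h p_morphism]])
      fix n x assume x: "x \<in> simplices X n"
      show "eq_morphism (S n) (comp_morphism (comp_morphism p h) (\<iota> n x)) (?w n x)"
        using hK[OF x] lifted_model_cocone(2)[OF x] by (simp add: eq_morphism_def comp_morphism_def)
    qed
    ultimately have "eq_morphism LX (comp_morphism p h) v" by (simp add: eq_morphism_def)
    moreover have "eq_morphism zero_cdgl (comp_morphism h (\<lambda>n _. \<zero>\<^bsub>sp LX n\<^esub>)) u"
      using morphism_from_zero_cdgl[OF A u] lie_morphism_ops(1)[OF cdgl_morphism_lie[OF h] L A]
      by (simp add: eq_morphism_def comp_morphism_def)
    ultimately show "\<exists>h. cdgl_morphism LX A h \<and>
        eq_morphism zero_cdgl (comp_morphism h (\<lambda>n _. \<zero>\<^bsub>sp LX n\<^esub>)) u \<and> eq_morphism LX (comp_morphism p h) v"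
      using h by blast
  qed
  then show ?thesis
    unfolding cofibrant_def cofibration_def using zero_cdgl_morphism[OF L] by blast
qed

end
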